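(* Let $P$ be a lower segment, of height $h_P \in [1,6]$, of a poset in $\mathfrak{N}_2$, encoded by the 0-1-word $w_0 w_1 \cdots w_{h_P-1}$ in which $w_k = 1$ if $P(k,k+1)$ is a 6-crown and $w_k = 0$ if $P(k,k+1)$ is of type $3C$. (The words which occur are exactly the 0-1-words with $w_0 = 1$; $P$ itself belongs to $\mathfrak{N}_2$ if and only if $h_P \ge 2$ and additionally $w_{h_P-1}=1$.) Then $P$ has a 4-crown stack as retract if and only if its code is one of the following: height 2: $10$; height 3: $111$, $101$; height 4: $1001$, $1010$, $1000$; height 5: $11101$, $10111$, $11001$, $10101$, $10011$, $10001$, $11110$, $11100$, $10110$, $10100$; height 6: $111111$, $111101$, $101111$, $101101$, $101001$, $100101$, $100001$, $101010$, $100110$, $101000$, $100100$, $100010$, $100000$. In particular, the posets $P \in \mathfrak{N}_2$ of height at most six having a 4-crown stack as retract are exactly those with code $111$, $101$, $1001$, $11101$, $10111$, $11001$, $10101$, $10011$, $10001$, $111111$, $111101$, $101111$, $101101$, $101001$, $100101$, $100001$.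
   Context: All posets are finite. $[i,j] = \{i,\dots,j\}$ for integers. The height $h_P$ of a poset $P$ is the maximal length (cardinality minus one) of a chain in $P$. Level sets: $P(0) := \min P$ and $P(k+1) := \min(P \setminus \bigcup_{i=0}^k P(i))$ for $0 \le k < h_P$. For $k \le \ell$, $P(k,\ell) := P(k) \cup P(\ell)$ and $P(k\to\ell) := \bigcup_{i=k}^{\ell} P(i)$; subsets are identified with the induced sub-posets. A lower segment of $P$ is a sub-poset $P(0\to k)$ with $k \in [0,h_P]$. A retract of $P$ is an induced sub-poset that is the image of an idempotent order-preserving map $P \to P$. For $n \geq 2$, a $2n$-crown is a poset with $2n$ points $x_{i,j}$, $i \in [0,n-1]$, $j \in \{0,1\}$, whose only comparabilities between different points are $x_{0,0} < x_{0,1} > x_{1,0} < \cdots > x_{n-1,0} < x_{n-1,1} > x_{0,0}$. A 4-crown stack is a poset $R$ of height at least 1 such that $R(k,k+1)$ is a 4-crown for all $k \in [0,h_R-1]$, all other comparabilities being induced by transitivity. A poset is of type $33$ if it is the ordinal sum of two 3-element antichains, and of type $3C$ if it consists of three disjoint two-element chains without further comparabilities. A section of width three is a poset $P$ of height at least one with carrier $\{c_{k,j} : k \in [0,h_P], j \in \{0,1,2\}\}$ such that: $c_{0,j} < \cdots < c_{h_P,j}$ is a chain for each $j$; $\{c_{k,0},c_{k,1},c_{k,2}\}$ is an antichain for each $k$; the map $c_{k,j} \mapsto c_{k,(j+1) \bmod 3}$ is an automorphism of $P$; and $P(k,k+1) \not\simeq 33$ for all $k \in [0,h_P-1]$. (Then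 $P(k) = \{c_{k,0},c_{k,1},c_{k,2}\}$, and two consecutive levels form a 6-crown or are of type $3C$.) A section is nice if it contains no irreducible point, i.e. no point with exactly one lower cover or exactly one upper cover. In a nice section of width three, $P(0,1)$ and $P(h_P-1,h_P)$ are 6-crowns. The horizon of such a section with $h_P \geq 2$ is the smallest positive integer $\eta$ with $P(k,k+\eta) \simeq 33$ for all $k \in [0,h_P-\eta]$. $\mathfrak{N}_2$ is the class of nice sections (of width three) with horizon 2 and height at least two. Lower segments of posets in $\mathfrak{N}_2$ of equal height are isomorphic iff they have the same code. *)

theory Defs
  imports Main
begin

text \<open>
  A poset is represented by its reflexive order relation \<open>r\<close>; the carrier is \<open>Field r\<close>.
  The induced sub-poset on \<open>B \<subseteq> Field r\<close> is \<open>Restr r B\<close>, whose field is \<open>B\<close> by reflexivity.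
\<close>

definition finite_poset :: "'a rel \<Rightarrow> bool" where
  "finite_poset r \<longleftrightarrow> finite (Field r) \<and> Partial_order r"

definition strict :: "'a rel \<Rightarrow> 'a rel" where
  "strict r = r - Id"

definition poset_height :: "'a rel \<Rightarrow> nat" where
  "poset_height r = Max {card C - 1 | C. C \<in> Chains r}"

definition minimals :: "'a rel \<Rightarrow> 'a set \<Rightarrow> 'a set" where
  "minimals r B = {x \<in> B. \<forall>y\<in>B. (y, x) \<in> r \<longrightarrow> y = x}"

fun level :: "'a rel \<Rightarrow> nat \<Rightarrow> 'a set" where
  "level r 0 = minimals r (Field r)"
| "level r (Suc k) = minimals r (Field r - (\<Union>i\<in>{0..k}. level r i))"

definition two_levels :: "'a rel \<Rightarrow> nat \<Rightarrow> nat \<Rightarrow> 'a rel" where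
  "two_levels r k l = Restr r (level r k \<union> level r l)"

definition level_range :: "'a rel \<Rightarrow> nat \<Rightarrow> nat \<Rightarrow> 'a rel" where
  "level_range r k l = Restr r (\<Union>i\<in>{k..l}. level r i)"

definition lower_segment :: "'a rel \<Rightarrow> 'a rel \<Rightarrow> bool" where
  "lower_segment p q \<longleftrightarrow> (\<exists>k\<in>{0..poset_height q}. p = level_range q 0 k)"

definition retract_of :: "'a rel \<Rightarrow> 'a rel \<Rightarrow> bool" where
  "retract_of s r \<longleftrightarrow>
     (\<exists>f. f ` Field r \<subseteq> Field r
        \<and> monotone_on (Field r) (\<lambda>x y. (x, y) \<in> r) (\<lambda>x y. (x, y) \<in> r) f
        \<and> (\<forall>x\<in>Field r. f (f x) = f x)
        \<and> s = Restr r (f ` Field r))"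

definition order_automorphism :: "'a rel \<Rightarrow> ('a \<Rightarrow> 'a) \<Rightarrow> bool" where
  "order_automorphism r f \<longleftrightarrow>
     bij_betw f (Field r) (Field r)
     \<and> (\<forall>x\<in>Field r. \<forall>y\<in>Field r. (x, y) \<in> r \<longleftrightarrow> (f x, f y) \<in> r)"

text \<open>\<open>crown n r\<close> says that \<open>r\<close> is a \<open>2n\<close>-crown.\<close>

definition crown :: "nat \<Rightarrow> 'a rel \<Rightarrow> bool" where
  "crown n r \<longleftrightarrow> n \<ge> 2 \<and>
     (\<exists>x :: nat \<Rightarrow> nat \<Rightarrow> 'a.
        inj_on (\<lambda>(i, j). x i j) ({0..n - 1} \<times> {0, 1})
        \<and> r = Id_on {x i j | i j. i \<in> {0..n - 1} \<and> j \<in> {0, 1}}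
              \<union> {(x i 0, x i 1) | i. i \<in> {0..n - 1}}
              \<union> {(x ((i + 1) mod n) 0, x i 1) | i. i \<in> {0..n - 1}})"

definition four_crown_stack :: "'a rel \<Rightarrow> bool" where
  "four_crown_stack r \<longleftrightarrow>
     finite_poset r \<and> poset_height r \<ge> 1
     \<and> (\<forall>k\<in>{0..poset_height r - 1}. crown 2 (two_levels r k (k + 1)))
     \<and> strict r = (\<Union>k\<in>{0..poset_height r - 1}. strict (two_levels r k (k + 1)))\<^sup>+"

definition type_33 :: "'a rel \<Rightarrow> bool" where
  "type_33 r \<longleftrightarrow>
     (\<exists>A B. card A = 3 \<and> card B = 3 \<and> A \<inter> B = {} \<and> r = Id_on (A \<union> B) \<union> A \<times> B)"

definition type_3C :: "'a rel \<Rightarrow> bool" where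
  "type_3C r \<longleftrightarrow>
     (\<exists>a b :: nat \<Rightarrow> 'a.
        inj_on a {0..2} \<and> inj_on b {0..2} \<and> a ` {0..2} \<inter> b ` {0..2} = {}
        \<and> r = Id_on (a ` {0..2} \<union> b ` {0..2}) \<union> {(a j, b j) | j. j \<in> {0..2}})"

definition width_three_section :: "'a rel \<Rightarrow> bool" where
  "width_three_section r \<longleftrightarrow>
     finite_poset r \<and> poset_height r \<ge> 1
     \<and> (\<exists>c :: nat \<Rightarrow> nat \<Rightarrow> 'a.
          inj_on (\<lambda>(k, j). c k j) ({0..poset_height r} \<times> {0..2})
          \<and> Field r = {c k j | k j. k \<in> {0..poset_height r} \<and> j \<in> {0..2}}
          \<and> (\<forall>j\<in>{0..2}. \<forall>k<poset_height r. (c k j, c (k + 1) j) \<in> strict r)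
          \<and> (\<forall>k\<in>{0..poset_height r}. \<forall>i\<in>{0..2}. \<forall>j\<in>{0..2}. (c k i, c k j) \<notin> strict r)
          \<and> (\<exists>f. order_automorphism r f
               \<and> (\<forall>k\<in>{0..poset_height r}. \<forall>j\<in>{0..2}. f (c k j) = c k ((j + 1) mod 3))))
     \<and> (\<forall>k\<in>{0..poset_height r - 1}. \<not> type_33 (two_levels r k (k + 1)))"

definition covered_by :: "'a rel \<Rightarrow> 'a \<Rightarrow> 'a \<Rightarrow> bool" where
  "covered_by r x y \<longleftrightarrow>
     (x, y) \<in> strict r \<and> \<not> (\<exists>z. (x, z) \<in> strict r \<and> (z, y) \<in> strict r)"

definition irreducible_point :: "'a rel \<Rightarrow> 'a \<Rightarrow> bool" where
  "irreducible_point r x \<longleftrightarrow>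
     x \<in> Field r \<and> ((\<exists>!y. covered_by r y x) \<or> (\<exists>!y. covered_by r x y))"

definition nice_section :: "'a rel \<Rightarrow> bool" where
  "nice_section r \<longleftrightarrow> width_three_section r \<and> \<not> (\<exists>x. irreducible_point r x)"

text \<open>
  The horizon is only meaningful for sections of height at least two. The condition
  \<open>k + \<eta> \<le> poset_height r\<close> is \<open>k \<in> [0, h - \<eta>]\<close> without truncated subtraction.
\<close>

definition horizon :: "'a rel \<Rightarrow> nat" where
  "horizon r = (LEAST \<eta>. 0 < \<eta> \<and>
     (\<forall>k. k + \<eta> \<le> poset_height r \<longrightarrow> type_33 (two_levels r k (k + \<eta>))))"

definition class_N2 :: "'a rel \<Rightarrow> bool" where
  "class_N2 r \<longleftrightarrow> nice_section r \<and> poset_height r \<ge> 2 \<and> horizon r = 2"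

definition N2_lower_segment :: "'a rel \<Rightarrow> bool" where
  "N2_lower_segment p \<longleftrightarrow> (\<exists>q. class_N2 q \<and> lower_segment p q)"

definition encoded_by :: "'a rel \<Rightarrow> nat list \<Rightarrow> bool" where
  "encoded_by p w \<longleftrightarrow>
     length w = poset_height p
     \<and> (\<forall>k<length w. (w ! k = 1 \<and> crown 3 (two_levels p k (k + 1)))
                   \<or> (w ! k = 0 \<and> type_3C (two_levels p k (k + 1))))"

definition has_stack_retract :: "'a rel \<Rightarrow> bool" where
  "has_stack_retract p \<longleftrightarrow> (\<exists>s. four_crown_stack s \<and> retract_of s p)"

end

theory Submission
  imports Defs
begin

text \<open>
  Why the theorem is true.  A retraction of a finite poset onto a 4-crown stack cuts the poset, from
  the bottom upwards, into layers: the preimages of the levels of the stack.  Each layer lies on top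
  of a down-set, it falls into two parts without comparabilities between them (the preimages of the
  two points of a level), and it contains a pair, one point from each part, such that both points of
  a pair lie below both points of the next pair.  Conversely, sending the two parts of every layer
  to the two points of its pair is a retraction.  So the question is whether the poset can be
  peeled in this way, with at least two layers (\<open>stack_retract_peel\<close>).

  A 6-crown is the complement of a perfect matching between two 3-antichains, while type \<open>3C\<close> is
  the matching itself.  Aligning the levels along these matchings, every poset in the class, and
  every lower segment of one, becomes a poset on points \<open>(k, i)\<close> with three columns \<open>i\<close>: level \<open>k\<close>
  is completely below level \<open>k + 2\<close>, and \<open>(k, i)\<close> is below \<open>(k + 1, j)\<close> iff \<open>i = j\<close> (letter \<open>0\<close>) or
  \<open>i \<noteq> j\<close> (letter \<open>1\<close>) (\<open>class_N2_coded_ex\<close>).  In this form the word determines everything, and every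
  permutation of the three columns is an automorphism.

  Since levels two apart are completely comparable, a layer can touch at most three consecutive
  levels, and if it touches three then one of its two parts consists of points of the middle level.
  For a given pair, enlarging the layer never does harm, because all later pairs lie above the
  present one.  Hence one may assume that the layers removed so far exhaust all levels below some level
  \<open>t\<close> and part of level \<open>t\<close>; the future depends only on the rest \<open>R\<close> of that level and on the points
  of levels \<open>t\<close> and \<open>t + 1\<close> which lie above the last pair.  The possible next layers are the short and the
  long moves of \<open>peels_short\<close>, \<open>peels_long\<close> and \<open>peels_cases\<close>.

  Up to permuting columns and discarding dominated states, only eight states can arise, and they
  pass to one another on reading one or two letters.  So peelability is decided by a finite
  automaton (\<open>peels_accepts\<close>, which holds for words of any length); its transitions are
  verified by evaluating all moves from the eight states (\<open>moves_reduce\<close>, \<open>moves_serve\<close>,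
  \<open>last_moves\<close>).  Running it on the words of length at most six that start with \<open>1\<close> gives the lists of
  the theorem.
\<close>

section \<open>Peeling a poset into split layers\<close>

text \<open>
The down-set \<open>D\<close> has been removed already, and the points of the pair have to be taken from \<open>U\<close>,
the set of points above all earlier pairs.
\<close>

definition layer ::
  "'b set \<Rightarrow> ('b \<Rightarrow> 'b \<Rightarrow> bool) \<Rightarrow> 'b set \<Rightarrow> 'b set \<Rightarrow> 'b set \<Rightarrow> 'b set \<Rightarrow> 'b \<Rightarrow> 'b \<Rightarrow> bool" where
  "layer V lt D U X Y a b \<longleftrightarrow> X \<union> Y \<subseteq> V - D \<and> a \<in> X \<inter> U \<and> b \<in> Y \<inter> U
     \<and> (\<forall>x\<in>X. \<forall>y\<in>Y. x \<noteq> y \<and> \<not> lt x y \<and> \<not> lt y x)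
     \<and> (\<forall>y\<in>X \<union> Y. \<forall>x\<in>V. lt x y \<longrightarrow> x \<in> D \<union> X \<union> Y)"

fun peel :: "'b set \<Rightarrow> ('b \<Rightarrow> 'b \<Rightarrow> bool) \<Rightarrow> nat \<Rightarrow> 'b set \<Rightarrow> 'b set \<Rightarrow> bool" where
  "peel V lt 0 D U \<longleftrightarrow> V \<subseteq> D"
| "peel V lt (Suc n) D U \<longleftrightarrow> (\<exists>X Y a b. layer V lt D U X Y a b
      \<and> peel V lt n (D \<union> X \<union> Y) (U \<inter> {z. lt a z \<and> lt b z}))"

lemma layer_swap: "layer V lt D U X Y a b \<Longrightarrow> layer V lt D U Y X b a"
  unfolding layer_def by blast

lemma layerD:
  assumes "layer V lt D U X Y a b"
  shows "X \<union> Y \<subseteq> V - D" "a \<in> X" "a \<in> U" "b \<in> Y" "b \<in> U"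
    and "\<And>x y. x \<in> X \<Longrightarrow> y \<in> Y \<Longrightarrow> x \<noteq> y \<and> \<not> lt x y \<and> \<not> lt y x"
    and "\<And>x y. y \<in> X \<union> Y \<Longrightarrow> x \<in> V \<Longrightarrow> lt x y \<Longrightarrow> x \<in> D \<union> X \<union> Y"
  using assms unfolding layer_def by blast+

lemma peel_SucI:
  assumes "X \<union> Y \<subseteq> V - D" "a \<in> X" "a \<in> U" "b \<in> Y" "b \<in> U"
    and sep: "\<And>x y. x \<in> X \<Longrightarrow> y \<in> Y \<Longrightarrow> x \<noteq> y \<and> \<not> lt x y \<and> \<not> lt y x"
    and down: "\<And>x y. y \<in> X \<union> Y \<Longrightarrow> x \<in> V \<Longrightarrow> lt x y \<Longrightarrow> x \<in> D \<union> X \<union> Y"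
    and "peel V lt n (D \<union> X \<union> Y) (U \<inter> {z. lt a z \<and> lt b z})"
  shows "peel V lt (Suc n) D U"
proof -
  have "\<forall>x\<in>X. \<forall>y\<in>Y. x \<noteq> y \<and> \<not> lt x y \<and> \<not> lt y x"
    by (intro ballI sep)
  moreover have "\<forall>y\<in>X \<union> Y. \<forall>x\<in>V. lt x y \<longrightarrow> x \<in> D \<union> X \<union> Y"
    by (intro ballI impI down)
  moreover have "a \<in> X \<inter> U" "b \<in> Y \<inter> U" using assms by blast+
  ultimately have "layer V lt D U X Y a b" unfolding layer_def using assms(1) by (intro conjI)
  then show ?thesis using assms(8) by (auto simp only: peel.simps)
qed

text \<open>
The reason why states can be compared: removing more points is harmless as long as all
points available for later pairs survive, since a layer stays split when points are deleted from it.
\<close>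

lemma peel_mono:
  assumes "peel V lt n D U" "V \<inter> D \<subseteq> D'" "V \<inter> (U - D) \<subseteq> U' - D'"
  shows "peel V lt n D' U'"
  using assms
proof (induction n arbitrary: D U D' U')
  case 0
  then show ?case by auto
next
  case (Suc n)
  from Suc.prems(1) obtain X Y a b where L: "layer V lt D U X Y a b"
    and rest: "peel V lt n (D \<union> X \<union> Y) (U \<inter> {z. lt a z \<and> lt b z})"
    by (auto simp only: peel.simps)
  note XY = layerD(1)[OF L] and a = layerD(2,3)[OF L] and b = layerD(4,5)[OF L]
    and sep = layerD(6)[OF L] and down = layerD(7)[OF L]
  show ?case
  proof -
    have ab: "a \<in> U' - D'" "b \<in> U' - D'"
      using XY a b Suc.prems(3) by blast+
    show "peel V lt (Suc n) D' U'"
    proof (rule peel_SucI[of "X - D'" "Y - D'" _ _ a _ b])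
      show "X - D' \<union> (Y - D') \<subseteq> V - D'" using XY by blast
      show "a \<in> X - D'" "a \<in> U'" "b \<in> Y - D'" "b \<in> U'" using a b ab by auto
      show "x \<noteq> y \<and> \<not> lt x y \<and> \<not> lt y x" if "x \<in> X - D'" "y \<in> Y - D'" for x y
        using sep[of x y] that by auto
      show "x \<in> D' \<union> (X - D') \<union> (Y - D')" if "y \<in> X - D' \<union> (Y - D')" "x \<in> V" "lt x y" for x y
        using down[of y x] that Suc.prems(2) by auto
      show "peel V lt n (D' \<union> (X - D') \<union> (Y - D')) (U' \<inter> {z. lt a z \<and> lt b z})"
      proof (rule Suc.IH[OF rest])
        show "V \<inter> (D \<union> X \<union> Y) \<subseteq> D' \<union> (X - D') \<union> (Y - D')" using Suc.prems(2) by auto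
        show "V \<inter> (U \<inter> {z. lt a z \<and> lt b z} - (D \<union> X \<union> Y))
            \<subseteq> U' \<inter> {z. lt a z \<and> lt b z} - (D' \<union> (X - D') \<union> (Y - D'))"
          using Suc.prems(3) by auto
      qed
    qed
  qed
qed

text \<open>
Serves for the isomorphism between a poset and its coordinate form as well as for the permutations of
the columns.
\<close>

lemma peel_transfer:
  assumes "peel V lt n D U" and bij: "bij_betw \<pi> V V'"
    and iso: "\<And>x y. x \<in> V \<Longrightarrow> y \<in> V \<Longrightarrow> lt' (\<pi> x) (\<pi> y) \<longleftrightarrow> lt x y"
  shows "peel V' lt' n (\<pi> ` (D \<inter> V)) (\<pi> ` (U \<inter> V))"
  using assms(1)
proof (induction n arbitrary: D U)
  case 0
  then show ?case using bij by (auto simp: bij_betw_def)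
next
  case (Suc n)
  have inj: "inj_on \<pi> V" and img: "\<pi> ` V = V'" using bij by (auto simp: bij_betw_def)
  from Suc.prems(1) obtain X Y a b where L: "layer V lt D U X Y a b"
    and rest: "peel V lt n (D \<union> X \<union> Y) (U \<inter> {z. lt a z \<and> lt b z})"
    by (auto simp only: peel.simps)
  note XY = layerD(1)[OF L] and a = layerD(2,3)[OF L] and b = layerD(4,5)[OF L]
    and sep = layerD(6)[OF L] and down = layerD(7)[OF L]
  show ?case
  proof -
    have V: "x \<in> V" if "x \<in> X \<union> Y" for x using XY that by blast
    show "peel V' lt' (Suc n) (\<pi> ` (D \<inter> V)) (\<pi> ` (U \<inter> V))"
    proof (rule peel_SucI[of "\<pi> ` X" "\<pi> ` Y" _ _ "\<pi> a" _ "\<pi> b"])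
      show "\<pi> ` X \<union> \<pi> ` Y \<subseteq> V' - \<pi> ` (D \<inter> V)"
        using XY inj img by (auto simp: inj_on_def)
      show "\<pi> a \<in> \<pi> ` X" "\<pi> a \<in> \<pi> ` (U \<inter> V)" "\<pi> b \<in> \<pi> ` Y" "\<pi> b \<in> \<pi> ` (U \<inter> V)"
        using a b V by auto
      show "x \<noteq> y \<and> \<not> lt' x y \<and> \<not> lt' y x" if "x \<in> \<pi> ` X" "y \<in> \<pi> ` Y" for x y
      proof -
        from that obtain x0 y0 where "x0 \<in> X" "x = \<pi> x0" "y0 \<in> Y" "y = \<pi> y0" by auto
        then show ?thesis using sep[of x0 y0] V[of x0] V[of y0] iso[of x0 y0] iso[of y0 x0]
            inj_on_eq_iff[OF inj, of x0 y0] by simp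
      qed
      show "x \<in> \<pi> ` (D \<inter> V) \<union> \<pi> ` X \<union> \<pi> ` Y"
        if y: "y \<in> \<pi> ` X \<union> \<pi> ` Y" and x: "x \<in> V'" and xy: "lt' x y" for x y
      proof -
        from x img obtain x0 where x0: "x0 \<in> V" "x = \<pi> x0" by auto
        from y obtain y0 where y0: "y0 \<in> X \<union> Y" "y = \<pi> y0" by auto
        have "x0 \<in> D \<union> X \<union> Y" using down[OF y0(1) x0(1)] xy x0 y0 V iso by auto
        then show ?thesis using x0 by blast
      qed
      show "peel V' lt' n (\<pi> ` (D \<inter> V) \<union> \<pi> ` X \<union> \<pi> ` Y)
              (\<pi> ` (U \<inter> V) \<inter> {z. lt' (\<pi> a) z \<and> lt' (\<pi> b) z})"
      proof (rule peel_mono[OF Suc.IH[OF rest]])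
        show "V' \<inter> \<pi> ` ((D \<union> X \<union> Y) \<inter> V) \<subseteq> \<pi> ` (D \<inter> V) \<union> \<pi> ` X \<union> \<pi> ` Y" by blast
        show "V' \<inter> (\<pi> ` (U \<inter> {z. lt a z \<and> lt b z} \<inter> V) - \<pi> ` ((D \<union> X \<union> Y) \<inter> V))
            \<subseteq> \<pi> ` (U \<inter> V) \<inter> {z. lt' (\<pi> a) z \<and> lt' (\<pi> b) z} - (\<pi> ` (D \<inter> V) \<union> \<pi> ` X \<union> \<pi> ` Y)"
          (is "?l \<subseteq> ?r")
        proof
          fix z assume z: "z \<in> ?l"
          then obtain z0 where z0: "z0 \<in> U" "lt a z0" "lt b z0" "z0 \<in> V" "z = \<pi> z0" by blast
          have "X \<subseteq> V" "Y \<subseteq> V" using V by auto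
          then have "z \<notin> \<pi> ` (D \<inter> V) \<union> \<pi> ` X \<union> \<pi> ` Y" using z by blast
          then show "z \<in> ?r" using z0 iso[of a z0] iso[of b z0] V a b by auto
        qed
      qed
    qed
  qed
qed

section \<open>Retractions onto 4-crown stacks are peelings\<close>

lemma poset_facts:
  assumes "finite_poset r"
  shows "finite (Field r)" "x \<in> Field r \<Longrightarrow> (x, x) \<in> r"
    "(x, y) \<in> r \<Longrightarrow> (y, z) \<in> r \<Longrightarrow> (x, z) \<in> r" "(x, y) \<in> r \<Longrightarrow> (y, x) \<in> r \<Longrightarrow> x = y"
  using assms unfolding finite_poset_def order_on_defs
  by (auto dest: refl_onD transD antisymD)

lemma strict_iff: "(x, y) \<in> strict r \<longleftrightarrow> (x, y) \<in> r \<and> x \<noteq> y"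
  by (auto simp: strict_def)

lemma Field_Restr:
  assumes "finite_poset r" "A \<subseteq> Field r"
  shows "Field (Restr r A) = A"
proof
  show "Field (Restr r A) \<subseteq> A" by (auto simp: Field_def)
  show "A \<subseteq> Field (Restr r A)"
  proof
    fix x assume "x \<in> A"
    then have "(x, x) \<in> Restr r A" using assms poset_facts(2)[OF assms(1), of x] by blast
    then show "x \<in> Field (Restr r A)" by (rule FieldI1)
  qed
qed

lemma finite_poset_Restr:
  assumes "finite_poset r" "A \<subseteq> Field r"
  shows "finite_poset (Restr r A)"
  unfolding finite_poset_def
proof
  show "finite (Field (Restr r A))"
    using assms by (simp add: Field_Restr finite_poset_def finite_subset)
  show "Partial_order (Restr r A)"
    using assms(1) by (intro Partial_order_Restr) (simp add: finite_poset_def)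
qed

text \<open>
Levels are defined by successively removing minimal points.  For a poset in which every point
of positive rank has a point of the preceding rank below it, they are the sets of constant rank;
this computes the levels both of stacks and of the posets of words.
\<close>

lemma graded_level:
  assumes up: "\<And>x y. (x, y) \<in> r \<Longrightarrow> x \<noteq> y \<Longrightarrow> \<rho> x < \<rho> y"
    and down: "\<And>x k. x \<in> Field r \<Longrightarrow> \<rho> x = Suc k \<Longrightarrow> \<exists>y. (y, x) \<in> r \<and> \<rho> y = k"
  shows "level r k = {x \<in> Field r. \<rho> x = k}"
proof (induction k rule: less_induct)
  case (less k)
  have min: "minimals r {x \<in> Field r. k \<le> \<rho> x} = {x \<in> Field r. \<rho> x = k}"
  proof -
    have "\<rho> x = k" if x: "x \<in> minimals r {x \<in> Field r. k \<le> \<rho> x}" for x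
    proof (rule ccontr)
      assume "\<rho> x \<noteq> k"
      then obtain l where l: "\<rho> x = Suc l" "k \<le> l" using x by (cases "\<rho> x") (auto simp: minimals_def)
      then obtain y where "(y, x) \<in> r" "\<rho> y = l" using down x by (auto simp: minimals_def)
      moreover from this have "y \<in> Field r" by (auto simp: Field_def)
      ultimately show False using x l by (auto simp: minimals_def)
    qed
    moreover have "x \<in> minimals r {x \<in> Field r. k \<le> \<rho> x}" if "x \<in> Field r" "\<rho> x = k" for x
      using that up[of _ x] unfolding minimals_def by fastforce
    ultimately show ?thesis by (auto simp: minimals_def)
  qed
  show ?case
  proof (cases k)
    case 0
    then show ?thesis using min by simp
  next
    case (Suc j)
    have "(\<Union>i\<in>{0..j}. level r i) = {x \<in> Field r. \<rho> x < k}"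
      using less.IH Suc by (auto simp: less_Suc_eq_le)
    then have "Field r - (\<Union>i\<in>{0..j}. level r i) = {x \<in> Field r. k \<le> \<rho> x}" by auto
    then show ?thesis using min Suc by simp
  qed
qed

lemma graded_height:
  assumes poset: "finite_poset r"
    and up: "\<And>x y. (x, y) \<in> r \<Longrightarrow> x \<noteq> y \<Longrightarrow> \<rho> x < \<rho> y"
    and down: "\<And>x k. x \<in> Field r \<Longrightarrow> \<rho> x = Suc k \<Longrightarrow> \<exists>y. (y, x) \<in> r \<and> \<rho> y = k"
    and bound: "\<And>x. x \<in> Field r \<Longrightarrow> \<rho> x \<le> h" and top: "x0 \<in> Field r" "\<rho> x0 = h"
  shows "poset_height r = h"
proof -
  note pf = poset_facts[OF poset]
  have "\<exists>C. C \<in> Chains r \<and> card C = Suc k \<and> (\<forall>c\<in>C. (c, x) \<in> r)" if "x \<in> Field r" "\<rho> x = k" for x k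
    using that
  proof (induction k arbitrary: x)
    case 0
    then show ?case by (intro exI[of _ "{x}"]) (auto simp: Chains_def pf(2))
  next
    case (Suc k)
    then obtain y where y: "(y, x) \<in> r" "\<rho> y = k" using down by blast
    then have "y \<in> Field r" by (auto simp: Field_def)
    then obtain C where C: "C \<in> Chains r" "card C = Suc k" "\<forall>c\<in>C. (c, y) \<in> r" using Suc.IH y by blast
    have below: "(c, x) \<in> r" if "c \<in> C" for c using C(3) that y(1) pf(3) by blast
    have "\<rho> c \<le> k" if "c \<in> C" for c
      using C(3) that up[of c y] y(2) by (cases "c = y") (auto dest: less_imp_le)
    then have "x \<notin> C" using Suc.prems(2) by fastforce
    moreover have "finite C" using C(2) card_ge_0_finite[of C] by simp
    ultimately have "card (insert x C) = Suc (Suc k)" using C(2) by simp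
    moreover have "insert x C \<in> Chains r"
      using C(1) below pf(2)[OF Suc.prems(1)] by (auto simp: Chains_def)
    ultimately show ?case using below pf(2)[OF Suc.prems(1)] by (intro exI[of _ "insert x C"]) auto
  qed
  then obtain C where C: "C \<in> Chains r" "card C = Suc h" using top by blast
  have le: "card C - 1 \<le> h" if "C \<in> Chains r" for C
  proof -
    have CF: "C \<subseteq> Field r" using that by (auto simp: Chains_def Field_def)
    have "inj_on \<rho> C"
    proof (rule inj_onI, rule ccontr)
      fix x y assume xy: "x \<in> C" "y \<in> C" "\<rho> x = \<rho> y" "x \<noteq> y"
      then have "(x, y) \<in> r \<or> (y, x) \<in> r" using that by (auto simp: Chains_def)
      then show False using up[of x y] up[of y x] xy by auto
    qed
    then have "card C = card (\<rho> ` C)" by (simp add: card_image)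
    also have "\<dots> \<le> card {..h}" using CF bound by (intro card_mono) auto
    finally show ?thesis by simp
  qed
  show ?thesis unfolding poset_height_def
  proof (rule Max_eqI)
    show "finite {card C - 1 |C. C \<in> Chains r}"
      by (rule finite_subset[of _ "{..h}"]) (use le in auto)
    show "y \<le> h" if "y \<in> {card C - 1 |C. C \<in> Chains r}" for y using that le by auto
    show "h \<in> {card C - 1 |C. C \<in> Chains r}" using C by force
  qed
qed

text \<open>
An order-preserving map onto the stack with \<open>n\<close> levels, given by the level \<open>\<rho>\<close> and the side \<open>\<sigma>\<close> of the
image, together with an order-preserving section \<open>a\<close>, \<open>b\<close>.
\<close>

definition stack_map :: "'b set \<Rightarrow> ('b \<Rightarrow> 'b \<Rightarrow> bool) \<Rightarrow> nat
    \<Rightarrow> ('b \<Rightarrow> nat) \<Rightarrow> ('b \<Rightarrow> bool) \<Rightarrow> (nat \<Rightarrow> 'b) \<Rightarrow> (nat \<Rightarrow> 'b) \<Rightarrow> bool" where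
  "stack_map V lt n \<rho> \<sigma> a b \<longleftrightarrow>
     (\<forall>x\<in>V. \<rho> x < n)
   \<and> (\<forall>x\<in>V. \<forall>y\<in>V. lt x y \<longrightarrow> \<rho> x < \<rho> y \<or> \<rho> x = \<rho> y \<and> \<sigma> x = \<sigma> y)
   \<and> (\<forall>i<n. a i \<in> V \<and> b i \<in> V \<and> \<rho> (a i) = i \<and> \<rho> (b i) = i \<and> \<sigma> (a i) \<and> \<not> \<sigma> (b i))
   \<and> (\<forall>i. Suc i < n \<longrightarrow> lt (a i) (a (Suc i)) \<and> lt (a i) (b (Suc i)) \<and> lt (b i) (a (Suc i)) \<and> lt (b i) (b (Suc i)))"

lemma stack_map_peel:
  assumes map: "stack_map V lt n \<rho> \<sigma> a b" and trans: "\<And>x y z. lt x y \<Longrightarrow> lt y z \<Longrightarrow> lt x z"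
  shows "peel V lt n {} UNIV"
proof -
  have rank: "x \<in> V \<Longrightarrow> \<rho> x < n"
    and mono: "x \<in> V \<Longrightarrow> y \<in> V \<Longrightarrow> lt x y \<Longrightarrow> \<rho> x < \<rho> y \<or> \<rho> x = \<rho> y \<and> \<sigma> x = \<sigma> y" for x y
    using map unfolding stack_map_def by blast+
  have ab: "a i \<in> V" "b i \<in> V" "\<rho> (a i) = i" "\<rho> (b i) = i" "\<sigma> (a i)" "\<not> \<sigma> (b i)" if "i < n" for i
    using map that unfolding stack_map_def by blast+
  have step: "lt (a i) (a (Suc i))" "lt (a i) (b (Suc i))" "lt (b i) (a (Suc i))" "lt (b i) (b (Suc i))"
    if "Suc i < n" for i using map that unfolding stack_map_def by blast+
  have lt: "lt (a j) (a i) \<and> lt (a j) (b i) \<and> lt (b j) (a i) \<and> lt (b j) (b i)" if "j < i" "i < n" for i j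
    using that
  proof (induction i)
    case (Suc i)
    show ?case
    proof (cases "j = i")
      case True
      then show ?thesis using step[of i] Suc.prems by blast
    next
      case False
      then have "lt (a j) (a i)" "lt (b j) (a i)" using Suc by auto
      then show ?thesis using step[of i] Suc.prems trans by blast
    qed
  qed simp
  have "peel V lt k {x. \<rho> x < i} {z. \<forall>j<i. lt (a j) z \<and> lt (b j) z}" if "i + k = n" for k i
    using that
  proof (induction k arbitrary: i)
    case 0
    then show ?case using rank by auto
  next
    case (Suc k)
    then have i: "i < n" by simp
    have "{x. \<rho> x < Suc i} = {x. \<rho> x < i} \<union> {x. \<rho> x = i \<and> \<sigma> x} \<union> {x. \<rho> x = i \<and> \<not> \<sigma> x}"
      by auto
    moreover have "{z. \<forall>j<Suc i. lt (a j) z \<and> lt (b j) z}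
        = {z. \<forall>j<i. lt (a j) z \<and> lt (b j) z} \<inter> {z. lt (a i) z \<and> lt (b i) z}"
      by (auto simp: less_Suc_eq)
    ultimately have rest: "peel V lt k ({x. \<rho> x < i} \<union> {x. \<rho> x = i \<and> \<sigma> x} \<union> {x. \<rho> x = i \<and> \<not> \<sigma> x})
        ({z. \<forall>j<i. lt (a j) z \<and> lt (b j) z} \<inter> {z. lt (a i) z \<and> lt (b i) z})"
      using Suc.IH[of "Suc i"] Suc.prems by simp
    show ?case
    proof (rule peel_SucI[of "{x \<in> V. \<rho> x = i \<and> \<sigma> x}" "{x \<in> V. \<rho> x = i \<and> \<not> \<sigma> x}" _ _ "a i" _ "b i"])
      show "x \<noteq> y \<and> \<not> lt x y \<and> \<not> lt y x"
        if "x \<in> {x \<in> V. \<rho> x = i \<and> \<sigma> x}" "y \<in> {x \<in> V. \<rho> x = i \<and> \<not> \<sigma> x}" for x y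
        using that mono[of x y] mono[of y x] by auto
      show "x \<in> {x. \<rho> x < i} \<union> {x \<in> V. \<rho> x = i \<and> \<sigma> x} \<union> {x \<in> V. \<rho> x = i \<and> \<not> \<sigma> x}"
        if "y \<in> {x \<in> V. \<rho> x = i \<and> \<sigma> x} \<union> {x \<in> V. \<rho> x = i \<and> \<not> \<sigma> x}" "x \<in> V" "lt x y" for x y
        using that mono[of x y] by auto
      show "peel V lt k ({x. \<rho> x < i} \<union> {x \<in> V. \<rho> x = i \<and> \<sigma> x} \<union> {x \<in> V. \<rho> x = i \<and> \<not> \<sigma> x})
          ({z. \<forall>j<i. lt (a j) z \<and> lt (b j) z} \<inter> {z. lt (a i) z \<and> lt (b i) z})"
        by (rule peel_mono[OF rest]) auto
    qed (use ab[OF i] lt[OF _ i] in auto)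
  qed
  from this[of 0 n] show ?thesis by simp
qed

lemma peel_stack_map:
  assumes "peel V lt n D U"
  shows "\<exists>\<rho> \<sigma> a b. stack_map (V - D) lt n \<rho> \<sigma> a b \<and> (\<forall>i<n. a i \<in> U \<and> b i \<in> U)"
  using assms
proof (induction n arbitrary: D U)
  case 0
  then show ?case by (auto simp: stack_map_def)
next
  case (Suc n)
  from Suc.prems obtain X Y a0 b0 where L: "layer V lt D U X Y a0 b0"
    and rest: "peel V lt n (D \<union> X \<union> Y) (U \<inter> {z. lt a0 z \<and> lt b0 z})"
    by (auto simp only: peel.simps)
  note XY = layerD(1)[OF L] and a0 = layerD(2,3)[OF L] and b0 = layerD(4,5)[OF L]
    and sep = layerD(6)[OF L] and down = layerD(7)[OF L]
  from Suc.IH[OF rest] obtain \<rho> \<sigma> a b where map: "stack_map (V - (D \<union> X \<union> Y)) lt n \<rho> \<sigma> a b"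
    and U: "\<And>i. i < n \<Longrightarrow> a i \<in> U \<and> b i \<in> U \<and> lt a0 (a i) \<and> lt b0 (a i) \<and> lt a0 (b i) \<and> lt b0 (b i)"
    by blast
  let ?W = "V - (D \<union> X \<union> Y)"
  have rank: "x \<in> ?W \<Longrightarrow> \<rho> x < n"
    and mono: "x \<in> ?W \<Longrightarrow> y \<in> ?W \<Longrightarrow> lt x y \<Longrightarrow> \<rho> x < \<rho> y \<or> \<rho> x = \<rho> y \<and> \<sigma> x = \<sigma> y" for x y
    using map unfolding stack_map_def by blast+
  have ab: "a i \<in> ?W" "b i \<in> ?W" "\<rho> (a i) = i" "\<rho> (b i) = i" "\<sigma> (a i)" "\<not> \<sigma> (b i)" if "i < n" for i
    using map that unfolding stack_map_def by blast+
  have step: "lt (a i) (a (Suc i)) \<and> lt (a i) (b (Suc i)) \<and> lt (b i) (a (Suc i)) \<and> lt (b i) (b (Suc i))"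
    if "Suc i < n" for i using map that unfolding stack_map_def by blast
  define \<rho>' where "\<rho>' x = (if x \<in> X \<union> Y then 0 else Suc (\<rho> x))" for x
  define \<sigma>' where "\<sigma>' x = (if x \<in> X \<union> Y then x \<in> X else \<sigma> x)" for x
  have "stack_map (V - D) lt (Suc n) \<rho>' \<sigma>' (case_nat a0 a) (case_nat b0 b)"
    unfolding stack_map_def
  proof (intro conjI ballI allI impI)
    fix x assume "x \<in> V - D"
    then show "\<rho>' x < Suc n" using rank[of x] by (auto simp: \<rho>'_def)
  next
    fix x y assume x: "x \<in> V - D" and y: "y \<in> V - D" and xy: "lt x y"
    consider "y \<in> X \<union> Y" | "x \<in> X \<union> Y" "y \<notin> X \<union> Y" | "x \<notin> X \<union> Y" "y \<notin> X \<union> Y" by blast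
    then show "\<rho>' x < \<rho>' y \<or> \<rho>' x = \<rho>' y \<and> \<sigma>' x = \<sigma>' y"
    proof cases
      case 1
      then have "x \<in> X \<union> Y" using down[of y x] x xy by blast
      then show ?thesis using 1 sep[of x y] sep[of y x] xy by (auto simp: \<rho>'_def \<sigma>'_def)
    next
      case 2
      then show ?thesis by (auto simp: \<rho>'_def)
    next
      case 3
      then show ?thesis using mono[of x y] x y xy by (auto simp: \<rho>'_def \<sigma>'_def)
    qed
  next
    fix i assume i: "i < Suc n"
    have "a0 \<in> V - D" "b0 \<in> V - D" "b0 \<notin> X" using XY a0 b0 sep[of b0 b0] by blast+
    then show "case_nat a0 a i \<in> V - D" "case_nat b0 b i \<in> V - D" "\<rho>' (case_nat a0 a i) = i"
      "\<rho>' (case_nat b0 b i) = i" "\<sigma>' (case_nat a0 a i)" "\<not> \<sigma>' (case_nat b0 b i)"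
      using i a0 b0 ab by (cases i; auto simp: \<rho>'_def \<sigma>'_def)+
  next
    fix i assume i: "Suc i < Suc n"
    show "lt (case_nat a0 a i) (case_nat a0 a (Suc i))" "lt (case_nat a0 a i) (case_nat b0 b (Suc i))"
      "lt (case_nat b0 b i) (case_nat a0 a (Suc i))" "lt (case_nat b0 b i) (case_nat b0 b (Suc i))"
      using i U step by (cases i; auto)+
  qed
  moreover have "\<forall>i<Suc n. case_nat a0 a i \<in> U \<and> case_nat b0 b i \<in> U"
    using U a0 b0 by (auto split: nat.split)
  ultimately show ?case by blast
qed

lemma crown_2_iff:
  "crown 2 r \<longleftrightarrow> (\<exists>a b a' b'. distinct [a, b, a', b'] \<and> r = Id_on {a, b, a', b'} \<union> {a, b} \<times> {a', b'})"
proof -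
  have I: "{0..2 - 1} = {0, 1 :: nat}" by auto
  have inj: "inj_on (\<lambda>(i, j). x i j) ({0..2 - 1} \<times> {0, 1}) \<longleftrightarrow> distinct [x 0 0, x 1 0, x 0 1, x 1 1]"
    for x :: "nat \<Rightarrow> nat \<Rightarrow> 'a"
    unfolding I by (auto simp: inj_on_def)
  have rel: "Id_on {x i j | i j. i \<in> {0..2 - 1} \<and> j \<in> {0, 1}}
      \<union> {(x i 0, x i 1) | i. i \<in> {0..2 - 1}} \<union> {(x ((i + 1) mod 2) 0, x i 1) | i. i \<in> {0..2 - 1}}
    = Id_on {x 0 0, x 1 0, x 0 1, x 1 1} \<union> {x 0 0, x 1 0} \<times> {x 0 1, x 1 1}"
    for x :: "nat \<Rightarrow> nat \<Rightarrow> 'a"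
  proof -
    have 1: "{x i j | i j. i \<in> {0..2 - 1} \<and> j \<in> {0, 1}} = {x 0 0, x 1 0, x 0 1, x 1 1}"
      unfolding I by auto
    have 2: "{(x i 0, x i 1) | i. i \<in> {0..2 - 1}} = {(x 0 0, x 0 1), (x 1 0, x 1 1)}"
      unfolding I by auto
    have "{(x ((i + 1) mod 2) 0, x i 1) | i. i \<in> {0..2 - 1}} = (\<lambda>i. (x ((i + 1) mod 2) 0, x i 1)) ` {0..2 - 1}"
      by blast
    also have "\<dots> = {(x 1 0, x 0 1), (x 0 0, x 1 1)}" unfolding I by simp
    finally have 3: "{(x ((i + 1) mod 2) 0, x i 1) | i. i \<in> {0..2 - 1}} = {(x 1 0, x 0 1), (x 0 0, x 1 1)}" .
    show ?thesis unfolding 1 2 3 by auto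
  qed
  show ?thesis
  proof
    assume "crown 2 r"
    then show "\<exists>a b a' b'. distinct [a, b, a', b'] \<and> r = Id_on {a, b, a', b'} \<union> {a, b} \<times> {a', b'}"
      unfolding crown_def inj rel by blast
  next
    assume "\<exists>a b a' b'. distinct [a, b, a', b'] \<and> r = Id_on {a, b, a', b'} \<union> {a, b} \<times> {a', b'}"
    then obtain a b a' b' where *: "distinct [a, b, a', b']" "r = Id_on {a, b, a', b'} \<union> {a, b} \<times> {a', b'}"
      by blast
    define x :: "nat \<Rightarrow> nat \<Rightarrow> 'a"
      where "x i j = (if i = 0 then if j = 0 then a else a' else if j = 0 then b else b')" for i j
    have "x 0 0 = a" "x 1 0 = b" "x 0 1 = a'" "x 1 1 = b'" by (simp_all add: x_def)
    then show "crown 2 r" unfolding crown_def inj rel using * by (intro conjI exI[of _ x]) simp_all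
  qed
qed

text \<open>
A stack consists of consecutive levels that form a 4-crown.  Being antichains, each of the two
levels has to be one side of that crown.
\<close>

lemma crown2_antichains:
  assumes "crown 2 (Restr r (A \<union> B))" and poset: "finite_poset r"
    and AB: "A \<subseteq> Field r" "B \<subseteq> Field r" 
    and A: "\<And>x y. x \<in> A \<Longrightarrow> y \<in> A \<union> B \<Longrightarrow> (y, x) \<in> r \<Longrightarrow> y = x"
    and B: "\<And>x y. x \<in> B \<Longrightarrow> y \<in> B \<Longrightarrow> (y, x) \<in> r \<Longrightarrow> y = x"
  shows "\<exists>a b c d. a \<noteq> b \<and> c \<noteq> d \<and> A = {a, b} \<and> B = {c, d} \<and> A \<times> B \<subseteq> strict r"
proof -
  from assms(1) obtain a b c d where d: "distinct [a, b, c, d]"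
    and eq: "Restr r (A \<union> B) = Id_on {a, b, c, d} \<union> {a, b} \<times> {c, d}"
    unfolding crown_2_iff by blast
  have "Field (Restr r (A \<union> B)) = {a, b, c, d}"
    unfolding eq by (auto simp: Field_def)
  then have mem: "z \<in> A \<or> z \<in> B \<longleftrightarrow> z = a \<or> z = b \<or> z = c \<or> z = d" for z
    using Field_Restr[OF poset, of "A \<union> B"] AB by (simp add: set_eq_iff)
  have rel: "(a, c) \<in> r" "(b, d) \<in> r" "(b, c) \<in> r" "(a, d) \<in> r"
    using eq by blast+
  have top: "c \<notin> A" "d \<notin> A" using A[of c a] A[of d a] rel d mem by auto
  then have topB: "c \<in> B" "d \<in> B" using mem by blast+
  have bot: "a \<notin> B" "b \<notin> B"
    using B[of c a] B[of c b] rel d topB by auto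
  have "A = {a, b}" "B = {c, d}"
    using mem top topB bot by (simp_all add: set_eq_iff) metis+
  moreover have "{a, b} \<times> {c, d} \<subseteq> strict r" using rel d by (auto simp: strict_def)
  ultimately show ?thesis using d
    by (intro exI[of _ a] exI[of _ b] exI[of _ c] exI[of _ d]) simp
qed

lemma level_subset: "level r k \<subseteq> Field r"
  by (cases k) (auto simp: minimals_def)

lemma level_above:
  assumes "x \<in> level r k" "y \<in> level r l" "(y, x) \<in> r" "k \<le> l"
  shows "y = x"
proof -
  have "y \<in> Field r" by (rule subsetD[OF level_subset assms(2)])
  show ?thesis
  proof (cases k)
    case 0
    then show ?thesis using assms \<open>y \<in> Field r\<close> by (auto simp: minimals_def)
  next
    case (Suc m)
    have "y \<notin> (\<Union>i\<in>{0..m}. level r i)"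
      using assms(2,4) Suc by (cases l) (auto simp: minimals_def)
    then show ?thesis using assms(1,3) Suc \<open>y \<in> Field r\<close> by (auto simp: minimals_def)
  qed
qed

lemma level_disjoint:
  assumes "x \<in> level r k" "x \<in> level r l"
  shows "k = l"
proof -
  have "\<not> i < j" if "x \<in> level r i" "x \<in> level r j" for i j
    using that by (cases j) (auto simp: minimals_def less_Suc_eq_le)
  then show ?thesis using assms by (metis linorder_neqE_nat)
qed

lemma stack_retract_stack_map:
  assumes poset: "finite_poset r" and ret: "has_stack_retract r"
  shows "\<exists>n\<ge>2. \<exists>\<rho> \<sigma> a b. stack_map (Field r) (\<lambda>x y. (x, y) \<in> strict r) n \<rho> \<sigma> a b"
proof -
  note pf = poset_facts[OF poset]
  from ret obtain s f where s: "four_crown_stack s" and f: "f ` Field r \<subseteq> Field r"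
    "monotone_on (Field r) (\<lambda>x y. (x, y) \<in> r) (\<lambda>x y. (x, y) \<in> r) f"
    "\<And>x. x \<in> Field r \<Longrightarrow> f (f x) = f x" and sr: "s = Restr r (f ` Field r)"
    unfolding has_stack_retract_def retract_of_def by blast
  define h where "h = poset_height s"
  have ps: "finite_poset s" and h: "h \<ge> 1"
    and cr: "\<And>k. k \<le> h - 1 \<Longrightarrow> crown 2 (two_levels s k (k + 1))"
    and st: "strict s = (\<Union>k\<in>{0..h - 1}. strict (two_levels s k (k + 1)))\<^sup>+"
    using s unfolding four_crown_stack_def h_def by auto
  have Fs: "Field s = f ` Field r" unfolding sr by (rule Field_Restr[OF poset f(1)])
  have pair: "\<exists>a b c d. a \<noteq> b \<and> c \<noteq> d \<and> level s k = {a, b} \<and> level s (Suc k) = {c, d}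
      \<and> level s k \<times> level s (Suc k) \<subseteq> strict s" if "k < h" for k
  proof (rule crown2_antichains[OF _ ps])
    show "crown 2 (Restr s (level s k \<union> level s (Suc k)))"
      using cr[of k] that by (simp add: two_levels_def)
    show "y = x" if "x \<in> level s k" "y \<in> level s k \<union> level s (Suc k)" "(y, x) \<in> s" for x y
      using that level_above[of x s k y k] level_above[of x s k y "Suc k"] by (auto simp del: level.simps)
    show "y = x" if "x \<in> level s (Suc k)" "y \<in> level s (Suc k)" "(y, x) \<in> s" for x y
      using that level_above[of x s "Suc k" y "Suc k"] by (auto simp del: level.simps)
  qed (rule level_subset)+
  have two: "\<exists>a b. a \<noteq> b \<and> level s k = {a, b}" if "k \<le> h" for k
    using pair[of k] pair[of "k - 1"] that h by (cases "k = h") auto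
  then obtain a b where ab: "\<And>k. k \<le> h \<Longrightarrow> a k \<noteq> b k \<and> level s k = {a k, b k}" by metis
  have up: "\<exists>k l. k < l \<and> l \<le> h \<and> x \<in> level s k \<and> y \<in> level s l" if "(x, y) \<in> strict s" for x y
    using that unfolding st
  proof (induction rule: trancl_induct)
    case (base y)
    then obtain k where k: "k \<le> h - 1" "(x, y) \<in> strict (two_levels s k (k + 1))" by auto
    then have xy: "(x, y) \<in> s" "x \<noteq> y" "x \<in> level s k \<union> level s (Suc k)" "y \<in> level s k \<union> level s (Suc k)"
      by (auto simp: strict_def two_levels_def simp del: level.simps)
    then have "x \<in> level s k" "y \<in> level s (Suc k)" 
      using level_above[of y s k x k] level_above[of y s k x "Suc k"] level_above[of y s "Suc k" x "Suc k"] 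
      by (auto simp del: level.simps)
    then show ?case using k(1) h by (intro exI[of _ k] exI[of _ "Suc k"]) (auto simp del: level.simps)
  next
    case (step y z)
    then obtain k where k: "k \<le> h - 1" "(y, z) \<in> strict (two_levels s k (k + 1))" by auto
    then have xy: "(y, z) \<in> s" "y \<noteq> z" "y \<in> level s k \<union> level s (Suc k)" "z \<in> level s k \<union> level s (Suc k)"
      by (auto simp: strict_def two_levels_def simp del: level.simps)
    then have "y \<in> level s k" "z \<in> level s (Suc k)" 
      using level_above[of z s k y k] level_above[of z s k y "Suc k"] level_above[of z s "Suc k" y "Suc k"] 
      by (auto simp del: level.simps)
    moreover from step.IH obtain i j where "i < j" "x \<in> level s i" "y \<in> level s j" by blast
    ultimately have "i < Suc k" using level_disjoint[of y s j k] by simp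
    then show ?case using \<open>x \<in> level s i\<close> \<open>z \<in> level s (Suc k)\<close> k(1) h
      by (intro exI[of _ i] exI[of _ "Suc k"]) (auto simp del: level.simps)
  qed
  have inlev: "\<exists>k\<le>h. x \<in> level s k" if "x \<in> Field s" for x
  proof (cases "\<exists>y. (y, x) \<in> strict s")
    case True
    then show ?thesis using up by blast
  next
    case False
    then have "x \<in> level s 0" using that by (auto simp: minimals_def strict_def)
    then show ?thesis by blast
  qed
  define \<rho> where "\<rho> x = (THE k. f x \<in> level s k)" for x
  have \<rho>: "\<rho> x = k" if "f x \<in> level s k" for x k
    unfolding \<rho>_def using that by (intro the_equality) (auto dest: level_disjoint simp del: level.simps)
  define \<sigma> where "\<sigma> x \<longleftrightarrow> f x = a (\<rho> x)" for x
  have fix_stack: "f x = x" if "x \<in> Field s" for x using that f(3) unfolding Fs by auto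
  have abF: "a k \<in> Field r" "b k \<in> Field r" "f (a k) = a k" "f (b k) = b k" if "k \<le> h" for k
  proof -
    have "a k \<in> level s k" "b k \<in> level s k" using ab[OF that] by simp_all
    then have *: "a k \<in> Field s" "b k \<in> Field s" by (simp_all add: subsetD[OF level_subset] del: level.simps)
    then show "a k \<in> Field r" "b k \<in> Field r" using f(1) unfolding Fs by blast+
    show "f (a k) = a k" "f (b k) = b k" using * fix_stack by blast+
  qed
  have lev: "\<rho> x \<le> h \<and> f x \<in> level s (\<rho> x)" if "x \<in> Field r" for x
    using inlev[of "f x"] that \<rho> unfolding Fs by auto
  have "stack_map (Field r) (\<lambda>x y. (x, y) \<in> strict r) (Suc h) \<rho> \<sigma> a b"
    unfolding stack_map_def
  proof (intro conjI ballI allI impI)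
    show "\<rho> x < Suc h" if "x \<in> Field r" for x using lev[OF that] by simp
  next
    fix x y assume xy: "x \<in> Field r" "y \<in> Field r" "(x, y) \<in> strict r"
    then have "(f x, f y) \<in> r" using f(2) by (auto simp: monotone_on_def strict_def)
    then have fs: "(f x, f y) \<in> s" using xy by (auto simp: sr)
    show "\<rho> x < \<rho> y \<or> \<rho> x = \<rho> y \<and> \<sigma> x = \<sigma> y"
    proof (cases "f x = f y")
      case True
      then show ?thesis by (simp add: \<rho>_def \<sigma>_def)
    next
      case False
      then have "(f x, f y) \<in> strict s" using fs by (simp add: strict_iff)
      then obtain k l where "k < l" "f x \<in> level s k" "f y \<in> level s l" using up by blast
      then show ?thesis using \<rho> by auto
    qed
  next
    fix i assume "i < Suc h"
    then have i: "i \<le> h" by simp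
    have "f (a i) \<in> level s i" "f (b i) \<in> level s i" using abF[OF i] ab[OF i] by auto
    then have "\<rho> (a i) = i" "\<rho> (b i) = i" by (simp_all add: \<rho> del: level.simps)
    then show "a i \<in> Field r" "b i \<in> Field r" "\<rho> (a i) = i" "\<rho> (b i) = i" "\<sigma> (a i)" "\<not> \<sigma> (b i)"
      using abF[OF i] ab[OF i] by (auto simp: \<sigma>_def)
  next
    fix i assume "Suc i < Suc h"
    then have i: "i < h" "i \<le> h" "Suc i \<le> h" by auto
    have "level s i \<times> level s (Suc i) \<subseteq> strict s" using pair[OF i(1)] by blast
    moreover have "strict s \<subseteq> strict r" by (auto simp: sr strict_def)
    ultimately show "(a i, a (Suc i)) \<in> strict r" "(a i, b (Suc i)) \<in> strict r"
      "(b i, a (Suc i)) \<in> strict r" "(b i, b (Suc i)) \<in> strict r"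
      using ab[OF i(2)] ab[OF i(3)] by (auto simp del: level.simps)
  qed
  moreover have "Suc h \<ge> 2" using h by simp
  ultimately show ?thesis by blast
qed

text \<open>
The composition of the map onto the stack with its section is the retraction.  What needs an
argument is that the image, a chain of 2-antichains each completely below the next, satisfies
the description of a 4-crown stack by levels.
\<close>

lemma stack_map_stack_retract:
  assumes poset: "finite_poset r" and n: "n \<ge> 2"
    and map: "stack_map (Field r) (\<lambda>x y. (x, y) \<in> strict r) n \<rho> \<sigma> a b"
  shows "has_stack_retract r"
proof -
  note pf = poset_facts[OF poset]
  have rank: "\<rho> x < n" if "x \<in> Field r" for x
    using map that unfolding stack_map_def by blast
  have mono: "\<rho> x < \<rho> y \<or> \<rho> x = \<rho> y \<and> \<sigma> x = \<sigma> y" if "(x, y) \<in> r" for x y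
  proof (cases "x = y")
    case False
    then have "(x, y) \<in> strict r" using that by (simp add: strict_iff)
    moreover have "x \<in> Field r" "y \<in> Field r" using that by (auto intro: FieldI1 FieldI2)
    ultimately show ?thesis using map unfolding stack_map_def by blast
  qed simp
  have ab: "a i \<in> Field r" "b i \<in> Field r" "\<rho> (a i) = i" "\<rho> (b i) = i" "\<sigma> (a i)" "\<not> \<sigma> (b i)" if "i < n" for i
    using map that unfolding stack_map_def by blast+
  have step: "(a i, a (Suc i)) \<in> r" "(a i, b (Suc i)) \<in> r" "(b i, a (Suc i)) \<in> r" "(b i, b (Suc i)) \<in> r"
    if "Suc i < n" for i using map that unfolding stack_map_def strict_iff by blast+
  define f where "f x = (if \<sigma> x then a (\<rho> x) else b (\<rho> x))" for x
  have f: "f x \<in> Field r" "\<rho> (f x) = \<rho> x" "\<sigma> (f x) = \<sigma> x" if "x \<in> Field r" for x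
    using ab[OF rank[OF that]] by (auto simp: f_def)
  have ff: "f (f x) = f x" if "x \<in> Field r" for x using f(2,3)[OF that] by (simp only: f_def[of "f x"] f_def[of x, symmetric])
  define S where "S = f ` Field r"
  have fS: "f x = x" if "x \<in> S" for x using that ff by (auto simp: S_def)
  have SF: "S \<subseteq> Field r" using f by (auto simp: S_def)
  have S: "S = {a i |i. i < n} \<union> {b i |i. i < n}"
  proof
    show "S \<subseteq> {a i |i. i < n} \<union> {b i |i. i < n}" using rank by (auto simp: S_def f_def)
    have "f (a i) = a i" "f (b i) = b i" if "i < n" for i using ab[OF that] by (auto simp: f_def)
    then show "{a i |i. i < n} \<union> {b i |i. i < n} \<subseteq> S" using ab unfolding S_def by force
  qed
  have lt: "(a i, a j) \<in> r \<and> (a i, b j) \<in> r \<and> (b i, a j) \<in> r \<and> (b i, b j) \<in> r" if "i < j" "j < n" for i j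
    using that
  proof (induction j)
    case (Suc j)
    show ?case
    proof (cases "i = j")
      case True
      then show ?thesis using step[of j] Suc.prems by blast
    next
      case False
      then have "(a i, a j) \<in> r" "(b i, a j) \<in> r" using Suc by auto
      then show ?thesis using step[of j] Suc.prems pf(3) by blast
    qed
  qed simp
  have cmp: "(x, y) \<in> r \<longleftrightarrow> \<rho> x < \<rho> y \<or> x = y" if "x \<in> S" "y \<in> S" for x y
  proof -
    have F: "x \<in> Field r" "y \<in> Field r" using that SF by auto
    have "(x, y) \<in> r" if "\<rho> x < \<rho> y"
    proof -
      have "(f x, f y) \<in> r" using lt[OF that rank[OF F(2)]] by (auto simp: f_def)
      then show ?thesis using fS \<open>x \<in> S\<close> \<open>y \<in> S\<close> by simp
    qed
    moreover have "x = y" if "\<rho> x = \<rho> y" "\<sigma> x = \<sigma> y"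
    proof -
      have "f x = f y" using that by (simp add: f_def)
      then show ?thesis using fS[OF \<open>x \<in> S\<close>] fS[OF \<open>y \<in> S\<close>] by simp
    qed
    ultimately show ?thesis using mono[of x y] pf(2)[OF F(1)] by auto
  qed
  define s where "s = Restr r S"
  have ps: "finite_poset s" unfolding s_def by (rule finite_poset_Restr[OF poset SF])
  have Fs: "Field s = S" unfolding s_def by (rule Field_Restr[OF poset SF])
  have s: "(x, y) \<in> s \<longleftrightarrow> x \<in> S \<and> y \<in> S \<and> (\<rho> x < \<rho> y \<or> x = y)" for x y
    using cmp by (auto simp: s_def)
  have up: "\<rho> x < \<rho> y" if "(x, y) \<in> s" "x \<noteq> y" for x y using that s by auto
  have down: "\<exists>y. (y, x) \<in> s \<and> \<rho> y = k" if "x \<in> Field s" "\<rho> x = Suc k" for x k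
  proof -
    have "k < n" using that rank[of x] SF Fs by auto
    then show ?thesis using that ab[of k] S Fs s by (intro exI[of _ "a k"]) auto
  qed
  have lev: "level s k = {a k, b k}" if "k < n" for k
  proof -
    have "level s k = {x \<in> Field s. \<rho> x = k}" by (rule graded_level[OF up down])
    also have "\<dots> = {a k, b k}" unfolding Fs S using ab(3,4) that by auto
    finally show ?thesis .
  qed
  have height: "poset_height s = n - 1"
  proof (rule graded_height[OF ps up down])
    show "\<rho> x \<le> n - 1" if "x \<in> Field s" for x using rank[of x] that SF Fs by auto
    show "a (n - 1) \<in> Field s" "\<rho> (a (n - 1)) = n - 1" using ab[of "n - 1"] n Fs S by auto
  qed
  have in_S: "a i \<in> S" "b i \<in> S" if "i < n" for i using that S by auto
  have two: "two_levels s k (k + 1) = Id_on {a k, b k, a (Suc k), b (Suc k)} \<union> {a k, b k} \<times> {a (Suc k), b (Suc k)}"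
    if "Suc k < n" for k
    using that lev[of k] lev[of "Suc k"] in_S[of k] in_S[of "Suc k"] ab[of k] ab[of "Suc k"]
    unfolding two_levels_def by (auto simp: s simp del: level.simps)
  have "crown 2 (two_levels s k (k + 1))" if "k \<in> {0..poset_height s - 1}" for k
  proof -
    have k: "Suc k < n" using that height n by auto
    show ?thesis unfolding crown_2_iff two[OF k] using ab[of k] ab[of "Suc k"] k
      by (intro exI[of _ "a k"] exI[of _ "b k"] exI[of _ "a (Suc k)"] exI[of _ "b (Suc k)"]) auto
  qed
  moreover have "strict s = (\<Union>k\<in>{0..poset_height s - 1}. strict (two_levels s k (k + 1)))\<^sup>+" (is "_ = ?T\<^sup>+")
  proof
    have "(x, y) \<in> ?T\<^sup>+" if "x \<in> S" "y \<in> S" "\<rho> y = Suc (\<rho> x + k)" for x y k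
      using that
    proof (induction k arbitrary: y)
      case 0
      have "\<rho> y < n" using rank[of y] 0 SF by auto
      then have k: "Suc (\<rho> x) < n" using 0 by simp
      then have "x \<in> {a (\<rho> x), b (\<rho> x)}" "y \<in> {a (Suc (\<rho> x)), b (Suc (\<rho> x))}"
        using fS[of x] fS[of y] 0 by (auto simp: f_def split: if_splits)
      moreover have "x \<noteq> y" using 0 by auto
      ultimately have "(x, y) \<in> strict (two_levels s (\<rho> x) (\<rho> x + 1))" unfolding two[OF k] strict_def by blast
      moreover have "\<rho> x \<in> {0..poset_height s - 1}" using k height by auto
      ultimately show ?case by blast
    next
      case (Suc k)
      have "\<rho> y < n" using rank[of y] Suc.prems SF by auto
      then have k: "Suc (\<rho> x + k) < n" using Suc.prems by simp
      let ?z = "a (Suc (\<rho> x + k))"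
      have z: "(x, ?z) \<in> ?T\<^sup>+" using Suc.IH[of ?z] Suc.prems in_S[OF k] ab[OF k] by simp
      have k': "Suc (Suc (\<rho> x + k)) < n" using \<open>\<rho> y < n\<close> Suc.prems by simp
      have "y \<in> {a (Suc (Suc (\<rho> x + k))), b (Suc (Suc (\<rho> x + k)))}"
        using fS[of y] Suc.prems by (auto simp: f_def split: if_splits)
      moreover have "?z \<noteq> y" using Suc.prems ab[OF k] by auto
      ultimately have "(?z, y) \<in> strict (two_levels s (Suc (\<rho> x + k)) (Suc (\<rho> x + k) + 1))"
        unfolding two[OF k'] strict_def by blast
      moreover have "Suc (\<rho> x + k) \<in> {0..poset_height s - 1}" using k' height by auto
      ultimately have "(?z, y) \<in> ?T" by blast
      then show ?case using z by (rule trancl_into_trancl[rotated])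
    qed
    then show "strict s \<subseteq> ?T\<^sup>+"
      using s by (auto simp: strict_iff dest!: less_imp_Suc_add)
    have "trans (strict s)" using s by (auto simp: trans_def strict_iff)
    moreover have "?T \<subseteq> strict s" by (auto simp: strict_def two_levels_def)
    ultimately show "?T\<^sup>+ \<subseteq> strict s" 
      using trancl_mono[of _ ?T "strict s"] trancl_id[of "strict s"] by blast
  qed
  ultimately have "four_crown_stack s"
    unfolding four_crown_stack_def using ps height n by auto
  moreover have "retract_of s r" unfolding retract_of_def
  proof (intro exI[of _ f] conjI ballI)
    show "f ` Field r \<subseteq> Field r" using f by auto
    show "monotone_on (Field r) (\<lambda>x y. (x, y) \<in> r) (\<lambda>x y. (x, y) \<in> r) f"
    proof (rule monotone_onI)
      fix x y assume xy: "x \<in> Field r" "y \<in> Field r" "(x, y) \<in> r"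
      then have "f x \<in> S" "f y \<in> S" by (auto simp: S_def)
      moreover have "\<rho> (f x) < \<rho> (f y) \<or> f x = f y" using mono[OF xy(3)] f(2)[OF xy(1)] f(2)[OF xy(2)] by (auto simp: f_def)
      ultimately show "(f x, f y) \<in> r" using cmp by blast
    qed
    show "s = Restr r (f ` Field r)" by (simp add: s_def S_def)
  qed (use ff in auto)
  ultimately show ?thesis unfolding has_stack_retract_def by blast
qed

lemma stack_retract_peel:
  assumes "finite_poset r"
  shows "has_stack_retract r \<longleftrightarrow> (\<exists>n\<ge>2. peel (Field r) (\<lambda>x y. (x, y) \<in> strict r) n {} UNIV)"
proof
  assume "has_stack_retract r"
  then obtain n \<rho> \<sigma> a b where "n \<ge> 2" "stack_map (Field r) (\<lambda>x y. (x, y) \<in> strict r) n \<rho> \<sigma> a b"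
    using stack_retract_stack_map[OF assms] by blast
  moreover from this(2) have "peel (Field r) (\<lambda>x y. (x, y) \<in> strict r) n {} UNIV"
  proof (rule stack_map_peel)
    show "(x, z) \<in> strict r" if "(x, y) \<in> strict r" "(y, z) \<in> strict r" for x y z
      using that poset_facts(3,4)[OF assms] unfolding strict_iff by blast
  qed
  ultimately show "\<exists>n\<ge>2. peel (Field r) (\<lambda>x y. (x, y) \<in> strict r) n {} UNIV" by blast
next
  assume "\<exists>n\<ge>2. peel (Field r) (\<lambda>x y. (x, y) \<in> strict r) n {} UNIV"
  then obtain n where n: "n \<ge> 2" "peel (Field r) (\<lambda>x y. (x, y) \<in> strict r) n {} UNIV" by blast
  then show "has_stack_retract r"
    using peel_stack_map[OF n(2)] stack_map_stack_retract[OF assms n(1)] by auto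
qed

section \<open>The poset of a 0-1-word\<close>

text \<open>
The comparabilities between consecutive levels for the letter \<open>c\<close>: a 6-crown is
the complement of a perfect matching.
\<close>

definition joins :: "bool \<Rightarrow> nat \<Rightarrow> nat \<Rightarrow> bool" where
  "joins c i j \<longleftrightarrow> (i = j) = (\<not> c)"
definition three :: "nat set" where "three = {0, 1, 2}"
definition below :: "(nat \<Rightarrow> bool) \<Rightarrow> nat \<times> nat \<Rightarrow> nat \<times> nat \<Rightarrow> bool" where
  "below w p q \<longleftrightarrow> fst p + 2 \<le> fst q \<or> (fst q = Suc (fst p) \<and> joins (w (fst p)) (snd p) (snd q))"

definition points :: "nat \<Rightarrow> (nat \<times> nat) set" where
  "points h = {..h} \<times> three"

lemma below_fst: "below w p q \<Longrightarrow> fst p < fst q"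
  by (auto simp: below_def)

lemma below_trans: "below w p q \<Longrightarrow> below w q s \<Longrightarrow> below w p s"
  by (auto simp: below_def)

lemma lower_neighbour: "j \<in> three \<Longrightarrow> \<exists>i\<in>three. joins c i j"
  by (auto simp: three_def joins_def)

lemma upper_neighbour: "i \<in> three \<Longrightarrow> \<exists>j\<in>three. joins c i j"
  by (auto simp: three_def joins_def)

text \<open>
The poset \<open>r\<close> of height \<open>h\<close> in coordinates.  The word \<open>w\<close> is an infinite one so that lower segments
can keep the word and the coordinates of the whole poset.
\<close>

locale coded =
  fixes r :: "'a rel" and h :: nat and w :: "nat \<Rightarrow> bool" and c :: "nat \<times> nat \<Rightarrow> 'a"
  assumes inj: "inj_on c (points h)"
    and r_eq: "r = {(c p, c q) | p q. p \<in> points h \<and> q \<in> points h \<and> (p = q \<or> below w p q)}"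
begin

lemma c_inj: "p \<in> points h \<Longrightarrow> q \<in> points h \<Longrightarrow> c p = c q \<longleftrightarrow> p = q"
  using inj by (meson inj_on_eq_iff)

lemma r_iff: "(x, y) \<in> r \<longleftrightarrow> (\<exists>p q. x = c p \<and> y = c q \<and> p \<in> points h \<and> q \<in> points h \<and> (p = q \<or> below w p q))"
  unfolding r_eq by blast

lemma rel_iff: "p \<in> points h \<Longrightarrow> q \<in> points h \<Longrightarrow> (c p, c q) \<in> r \<longleftrightarrow> p = q \<or> below w p q"
  unfolding r_iff using c_inj by blast

lemma strict_rel_iff: "p \<in> points h \<Longrightarrow> q \<in> points h \<Longrightarrow> (c p, c q) \<in> strict r \<longleftrightarrow> below w p q"
  using rel_iff[of p q] c_inj[of p q] below_fst[of w p q] by (auto simp: strict_iff)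

lemma strictE:
  assumes "(x, y) \<in> strict r"
  obtains p q where "x = c p" "y = c q" "p \<in> points h" "q \<in> points h" "below w p q"
  using assms unfolding strict_iff r_iff by blast

lemma Field_coded: "Field r = c ` points h"
proof
  show "Field r \<subseteq> c ` points h" unfolding Field_def using r_iff by auto
  show "c ` points h \<subseteq> Field r"
  proof
    fix x assume "x \<in> c ` points h"
    then have "(x, x) \<in> r" using rel_iff by auto
    then show "x \<in> Field r" by (rule FieldI1)
  qed
qed

lemma coded_poset: "finite_poset r"
proof -
  have "finite (points h)" by (simp add: points_def three_def)
  moreover have "refl_on (Field r) r"
    unfolding refl_on_def Field_coded using rel_iff r_iff by auto
  moreover have "trans r"
  proof (rule transI)
    fix x y z assume "(x, y) \<in> r" "(y, z) \<in> r"
    then obtain p q q' s where "x = c p" "y = c q" "y = c q'" "z = c s" "p \<in> points h" "q \<in> points h"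
      "q' \<in> points h" "s \<in> points h" "p = q \<or> below w p q" "q' = s \<or> below w q' s"
      unfolding r_iff by blast
    moreover from this have "q = q'" using c_inj by blast
    ultimately show "(x, z) \<in> r" using rel_iff[of p s] below_trans[of w p q s] by auto
  qed
  moreover have "antisym r"
  proof (rule antisymI)
    fix x y assume "(x, y) \<in> r" "(y, x) \<in> r"
    then obtain p q p' q' where "x = c p" "y = c q" "y = c q'" "x = c p'" "p \<in> points h" "q \<in> points h"
      "q' \<in> points h" "p' \<in> points h" "p = q \<or> below w p q" "q' = p' \<or> below w q' p'"
      unfolding r_iff by blast
    moreover from this have "q = q'" "p = p'" using c_inj by blast+
    ultimately show "x = y" using below_fst[of w p q] below_fst[of w q p] by auto
  qed
  ultimately show ?thesis
    unfolding finite_poset_def order_on_defs Field_coded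
    by (auto simp: r_iff)
qed

definition "height_of x = fst (inv_into (points h) c x)"

lemma height_of: "p \<in> points h \<Longrightarrow> height_of (c p) = fst p"
  using inj by (simp add: height_of_def inv_into_f_f)

lemma height_up: "(x, y) \<in> r \<Longrightarrow> x \<noteq> y \<Longrightarrow> height_of x < height_of y"
  unfolding r_iff using below_fst height_of by fastforce

lemma height_down:
  assumes "x \<in> Field r" "height_of x = Suc k"
  shows "\<exists>y. (y, x) \<in> r \<and> height_of y = k"
proof -
  obtain l i where p: "x = c (l, i)" "(l, i) \<in> points h" using assms(1) unfolding Field_coded by auto
  have l: "l = Suc k" using assms(2) height_of[OF p(2)] p(1) by simp
  obtain j where j: "j \<in> three" "joins (w k) j i"
    using lower_neighbour[of i] p(2) by (auto simp: points_def)
  have q: "(k, j) \<in> points h" using p(2) j(1) l by (auto simp: points_def)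
  have "below w (k, j) (l, i)" using j(2) l by (simp add: below_def)
  then show ?thesis using rel_iff[OF q p(2)] height_of[OF q] p(1) by auto
qed

lemma level_coded: "k \<le> h \<Longrightarrow> level r k = c ` ({k} \<times> three)"
proof -
  assume k: "k \<le> h"
  have "level r k = {x \<in> Field r. height_of x = k}"
    by (rule graded_level[OF height_up height_down])
  also have "\<dots> = c ` ({k} \<times> three)"
    using k height_of unfolding Field_coded by (auto simp: points_def image_iff)
  finally show ?thesis .
qed

lemma height_coded: "poset_height r = h"
proof (rule graded_height[OF coded_poset height_up height_down])
  show "height_of x \<le> h" if "x \<in> Field r" for x
    using that height_of unfolding Field_coded by (auto simp: points_def)
  have p: "(h, 0) \<in> points h" by (simp add: points_def three_def)
  then show "c (h, 0) \<in> Field r" "height_of (c (h, 0)) = h" using height_of[OF p] by (auto simp: Field_coded)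
qed

lemma coded_segment: "k \<le> h \<Longrightarrow> coded (level_range r 0 k) k w c"
proof -
  assume k: "k \<le> h"
  have "(\<Union>i\<in>{0..k}. level r i) = c ` points k"
    using k level_coded by (auto simp: points_def simp del: level.simps)
  moreover have sub: "points k \<subseteq> points h" using k by (auto simp: points_def)
  moreover have "Restr r (c ` points k) = {(c p, c q) | p q. p \<in> points k \<and> q \<in> points k \<and> (p = q \<or> below w p q)}"
    (is "?l = ?r")
  proof (intro equalityI subsetI)
    fix z assume "z \<in> ?l"
    then obtain p q where z: "z = (c p, c q)" "p \<in> points k" "q \<in> points k" "(c p, c q) \<in> r" by blast
    then have "p = q \<or> below w p q" using rel_iff[of p q] sub by blast
    then show "z \<in> ?r" using z by blast
  next
    fix z assume "z \<in> ?r"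
    then obtain p q where z: "z = (c p, c q)" "p \<in> points k" "q \<in> points k" "p = q \<or> below w p q" by blast
    then have "(c p, c q) \<in> r" using rel_iff[of p q] sub by blast
    then show "z \<in> ?l" using z by blast
  qed
  moreover have "inj_on c (points k)" using sub inj by (blast intro: inj_on_subset)
  ultimately show ?thesis unfolding coded_def level_range_def by simp
qed

lemma two_levels_coded:
  assumes "k < l" "l \<le> h"
  shows "two_levels r k l = Id_on (c ` ({k, l} \<times> three))
     \<union> {(c (k, i), c (l, j)) | i j. i \<in> three \<and> j \<in> three \<and> below w (k, i) (l, j)}" (is "_ = ?rhs")
proof -
  have sub: "{k, l} \<times> three \<subseteq> points h" using assms by (auto simp: points_def)
  have "level r k \<union> level r l = c ` ({k, l} \<times> three)"
    using assms level_coded by (auto simp del: level.simps)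
  then have "two_levels r k l = Restr r (c ` ({k, l} \<times> three))" by (simp add: two_levels_def)
  also have "\<dots> = ?rhs"
  proof
    show "Restr r (c ` ({k, l} \<times> three)) \<subseteq> ?rhs"
    proof
      fix z assume "z \<in> Restr r (c ` ({k, l} \<times> three))"
      then obtain p q where z: "z = (c p, c q)" "p \<in> {k, l} \<times> three" "q \<in> {k, l} \<times> three" "(c p, c q) \<in> r" by blast
      then have "p = q \<or> below w p q" using rel_iff[of p q] sub by blast
      then show "z \<in> ?rhs"
      proof
        assume b: "below w p q"
        then have "fst p = k" "fst q = l" using below_fst[OF b] z(2,3) assms(1) by auto
        then show ?thesis using z b by (cases p; cases q) auto
      qed (use z in auto)
    qed
    show "?rhs \<subseteq> Restr r (c ` ({k, l} \<times> three))"
    proof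
      fix z assume "z \<in> ?rhs"
      then obtain p q where z: "z = (c p, c q)" "p \<in> {k, l} \<times> three" "q \<in> {k, l} \<times> three" "p = q \<or> below w p q"
        by (auto simp: Id_on_def)
      then show "z \<in> Restr r (c ` ({k, l} \<times> three))" using rel_iff[of p q] sub by blast
    qed
  qed
  finally show ?thesis .
qed

end

section \<open>Levels, codes and irreducible points of the poset of a word\<close>

lemma three_conv: "{0..2} = three" "{0..3 - 1} = three" "{0..<3} = three" "{..<3} = three"
  by (auto simp: three_def)

lemma card_three: "card three = 3"
  by (simp add: three_def)

lemma three_sets: "{f i |i. i \<in> three} = {f 0, f 1, f 2}"
  by (auto simp: three_def)

lemma three_sets2: "{f i j |i j. i \<in> three \<and> j \<in> {0, 1}} = {f 0 0, f 1 0, f 2 0, f 0 1, f 1 1, f 2 (1 :: nat)}"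
  unfolding three_def by blast

text \<open>
In a 6-crown some point has two lower covers, in type \<open>3C\<close> none has.  This makes codes unique.
\<close>

lemma crown_3C_exclusive: "crown 3 r \<Longrightarrow> type_3C r \<Longrightarrow> False"
proof -
  assume crown: "crown 3 r" and C: "type_3C r"
  from crown obtain x :: "nat \<Rightarrow> nat \<Rightarrow> 'a" where
    inj: "inj_on (\<lambda>(i, j). x i j) ({0..3 - 1} \<times> {0, 1})"
    and r: "r = Id_on {x i j | i j. i \<in> {0..3 - 1} \<and> j \<in> {0, 1}}
              \<union> {(x i 0, x i 1) | i. i \<in> {0..3 - 1}} \<union> {(x ((i + 1) mod 3) 0, x i 1) | i. i \<in> {0..3 - 1}}"
    unfolding crown_def by (elim conjE exE)
  from C obtain a b :: "nat \<Rightarrow> 'a" where b: "inj_on b {0..2}"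
    and r': "r = Id_on (a ` {0..2} \<union> b ` {0..2}) \<union> {(a j, b j) | j. j \<in> {0..2}}"
    unfolding type_3C_def by (elim conjE exE)
  have m: "(x 0 0, x 0 1) \<in> r" "(x ((0 + 1) mod 3) 0, x 0 1) \<in> r" unfolding r by fastforce+
  have ne: "x 0 0 \<noteq> x 1 0" "x 0 0 \<noteq> x 0 1" "x 1 0 \<noteq> x 0 1"
    using inj_on_eq_iff[OF inj, of "(0, 0)" "(1, 0)"] inj_on_eq_iff[OF inj, of "(0, 0)" "(0, 1)"]
      inj_on_eq_iff[OF inj, of "(1, 0)" "(0, 1)"] by simp_all
  have pair: "\<exists>j\<in>{0..2}. p = a j \<and> q = b j" if "(p, q) \<in> r" "p \<noteq> q" for p q
    using that unfolding r' by blast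
  obtain j where j: "j \<in> {0..2}" "x 0 0 = a j" "x 0 1 = b j" using pair[OF m(1) ne(2)] by blast
  obtain l where l: "l \<in> {0..2}" "x 1 0 = a l" "x 0 1 = b l" using pair[of "x 1 0" "x 0 1"] m(2) ne(3) by auto
  show False using inj_onD[OF b, of j l] j l ne(1) by simp
qed

context coded
begin

lemma crown_level:
  assumes "k < h" "w k"
  shows "crown 3 (two_levels r k (k + 1))"
proof -
  have pts: "(l, i) \<in> points h" if "l \<in> {k, Suc k}" "i \<in> three" for l i
    using that assms(1) by (auto simp: points_def)
  have img: "c ` ({k, Suc k} \<times> three) = {c (k, 0), c (k, 1), c (k, 2), c (Suc k, 0), c (Suc k, 1), c (Suc k, 2)}"
    by (auto simp: three_def)
  have "{(c (k, i), c (Suc k, j)) | i j. i \<in> three \<and> j \<in> three \<and> below w (k, i) (Suc k, j)}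
      = (\<lambda>(i, j). (c (k, i), c (Suc k, j))) ` {(i, j). i \<in> three \<and> j \<in> three \<and> i \<noteq> j}"
    using assms(2) by (auto simp: below_def joins_def)
  also have "{(i, j). i \<in> three \<and> j \<in> three \<and> i \<noteq> j} = {(0, 1), (0, 2), (1, 0), (1, 2), (2, 0), (2, 1)}"
    by (auto simp: three_def)
  finally have pairs: "{(c (k, i), c (Suc k, j)) | i j. i \<in> three \<and> j \<in> three \<and> below w (k, i) (Suc k, j)}
      = (\<lambda>(i, j). (c (k, i), c (Suc k, j))) ` {(0, 1), (0, 2), (1, 0), (1, 2), (2, 0), (2, 1)}" .
  have eq: "two_levels r k (k + 1) = Id_on {c (k, 0), c (k, 1), c (k, 2), c (Suc k, 0), c (Suc k, 1), c (Suc k, 2)}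
      \<union> (\<lambda>(i, j). (c (k, i), c (Suc k, j))) ` {(0, 1), (0, 2), (1, 0), (1, 2), (2, 0), (2, 1)}"
    using two_levels_coded[of k "Suc k"] assms(1) unfolding img pairs by simp
  define x where "x = (\<lambda>i j :: nat. if j = 0 then c (k, i) else c (Suc k, (i + 2) mod 3))"
  have x: "x 0 0 = c (k, 0)" "x 1 0 = c (k, 1)" "x 2 0 = c (k, 2)"
    "x 0 1 = c (Suc k, 2)" "x 1 1 = c (Suc k, 0)" "x 2 1 = c (Suc k, 1)"
    by (simp_all add: x_def numeral_2_eq_2)
  have m: "((0 :: nat) + 1) mod 3 = 1" "((1 :: nat) + 1) mod 3 = 2" "((2 :: nat) + 1) mod 3 = 0" by simp_all
  show ?thesis unfolding crown_def three_conv eq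
  proof (intro conjI exI[of _ x])
    show "inj_on (\<lambda>(i, j). x i j) (three \<times> {0, 1})"
    proof (rule inj_onI)
      fix p q assume pq: "p \<in> three \<times> {0, 1}" "q \<in> three \<times> {0, 1}" "(\<lambda>(i, j). x i j) p = (\<lambda>(i, j). x i j) q"
      have "(i + 2) mod 3 \<in> three" for i :: nat
        using three_conv(3) by force
      moreover have "(i + 2) mod 3 = (j + 2) mod 3 \<longleftrightarrow> i = j" if "i \<in> three" "j \<in> three" for i j
        using that by (auto simp: three_def)
      ultimately show "p = q" using pq c_inj pts by (auto simp: x_def split: if_splits)
    qed
    show "Id_on {c (k, 0), c (k, 1), c (k, 2), c (Suc k, 0), c (Suc k, 1), c (Suc k, 2)}
      \<union> (\<lambda>(i, j). (c (k, i), c (Suc k, j))) ` {(0, 1), (0, 2), (1, 0), (1, 2), (2, 0), (2, 1)}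
      = Id_on {x i j | i j. i \<in> three \<and> j \<in> {0, 1}} \<union> {(x i 0, x i 1) | i. i \<in> three}
        \<union> {(x ((i + 1) mod 3) 0, x i 1) | i. i \<in> three}"
      unfolding three_sets2 three_sets m x image_insert prod.case image_empty by blast
  qed simp
qed

lemma type_3C_level:
  assumes "k < h" "\<not> w k"
  shows "type_3C (two_levels r k (k + 1))"
proof -
  have pts: "(l, i) \<in> points h" if "l \<in> {k, Suc k}" "i \<in> three" for l i
    using that assms(1) by (auto simp: points_def)
  have img: "c ` ({k, Suc k} \<times> three) = (\<lambda>i. c (k, i)) ` three \<union> (\<lambda>i. c (Suc k, i)) ` three"
    by auto
  have "{(c (k, i), c (Suc k, j)) | i j. i \<in> three \<and> j \<in> three \<and> below w (k, i) (Suc k, j)}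
      = {(c (k, j), c (Suc k, j)) | j. j \<in> three}"
    using assms(2) by (auto simp: below_def joins_def)
  then have eq: "two_levels r k (k + 1) = Id_on ((\<lambda>i. c (k, i)) ` three \<union> (\<lambda>i. c (Suc k, i)) ` three)
      \<union> {(c (k, j), c (Suc k, j)) | j. j \<in> three}"
    using two_levels_coded[of k "Suc k"] assms(1) unfolding img by simp
  show ?thesis unfolding type_3C_def three_conv
  proof (intro exI conjI)
    show "inj_on (\<lambda>i. c (k, i)) three" "inj_on (\<lambda>i. c (Suc k, i)) three"
      "(\<lambda>i. c (k, i)) ` three \<inter> (\<lambda>i. c (Suc k, i)) ` three = {}"
      using c_inj pts by (auto simp: inj_on_def)
  qed (rule eq)
qed

lemma encoded_by_iff: "encoded_by r v \<longleftrightarrow> v = map (\<lambda>k. if w k then 1 else 0) [0..<h]"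
proof -
  have code: "(n = 1 \<and> crown 3 (two_levels r k (k + 1)) \<or> n = 0 \<and> type_3C (two_levels r k (k + 1)))
      \<longleftrightarrow> n = (if w k then 1 else 0)" if "k < h" for k and n :: nat
    using crown_level[OF that] type_3C_level[OF that] crown_3C_exclusive by (cases "w k") auto
  show ?thesis
  proof
    assume e: "encoded_by r v"
    then have "length v = h" by (simp add: encoded_by_def height_coded)
    moreover from this have "v ! k = (if w k then 1 else 0)" if "k < h" for k
      using e code[OF that] that unfolding encoded_by_def by blast
    ultimately show "v = map (\<lambda>k. if w k then 1 else 0) [0..<h]" by (intro nth_equalityI) auto
  next
    assume v: "v = map (\<lambda>k. if w k then 1 else 0) [0..<h]"
    then show "encoded_by r v" unfolding encoded_by_def height_coded
      using code by auto
  qed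
qed

lemma type_33_iff:
  assumes "k < l" "l \<le> h"
  shows "type_33 (two_levels r k l) \<longleftrightarrow> (\<forall>i\<in>three. \<forall>j\<in>three. below w (k, i) (l, j))"
proof
  assume all: "\<forall>i\<in>three. \<forall>j\<in>three. below w (k, i) (l, j)"
  have pts: "{k, l} \<times> three \<subseteq> points h" using assms by (auto simp: points_def)
  have inj': "inj_on c ({k} \<times> three)" "inj_on c ({l} \<times> three)"
    using pts by (auto intro: inj_on_subset[OF inj])
  have "two_levels r k l = Id_on (c ` ({k} \<times> three) \<union> c ` ({l} \<times> three)) \<union> c ` ({k} \<times> three) \<times> c ` ({l} \<times> three)"
    unfolding two_levels_coded[OF assms] using all by auto
  moreover have "card (c ` ({k} \<times> three)) = 3" "card (c ` ({l} \<times> three)) = 3"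
    using inj' by (simp_all add: card_image card_cartesian_product card_three)
  moreover have "c ` ({k} \<times> three) \<inter> c ` ({l} \<times> three) = {}"
    using c_inj pts assms(1) by fastforce
  ultimately show "type_33 (two_levels r k l)" unfolding type_33_def by blast
next
  assume "type_33 (two_levels r k l)"
  then obtain A B where AB: "A \<inter> B = {}" "two_levels r k l = Id_on (A \<union> B) \<union> A \<times> B"
    unfolding type_33_def by blast
  have pts: "(k, i) \<in> points h" "(l, i) \<in> points h" if "i \<in> three" for i
    using that assms by (auto simp: points_def)
  have mem: "c (k, i) \<in> A \<and> c (l, j) \<in> B" if "i \<in> three" "j \<in> three" "below w (k, i) (l, j)" for i j
  proof -
    have "(c (k, i), c (l, j)) \<in> two_levels r k l" unfolding two_levels_coded[OF assms] using that by blast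
    moreover have "c (k, i) \<noteq> c (l, j)" using c_inj pts that assms(1) by simp
    ultimately show ?thesis unfolding AB(2) by auto
  qed
  show "\<forall>i\<in>three. \<forall>j\<in>three. below w (k, i) (l, j)"
  proof (intro ballI)
    fix i j assume ij: "i \<in> three" "j \<in> three"
    obtain i' where i': "i' \<in> three" "below w (k, i') (l, j)"
      using lower_neighbour[OF ij(2), of "w k"] assms(1) by (cases "l = Suc k") (auto simp: below_def)
    obtain j' where j': "j' \<in> three" "below w (k, i) (l, j')"
      using upper_neighbour[OF ij(1), of "w k"] assms(1) by (cases "l = Suc k") (auto simp: below_def)
    have "(c (k, i), c (l, j)) \<in> two_levels r k l"
      using mem[OF i'(1) ij(2) i'(2)] mem[OF ij(1) j'] unfolding AB(2) by blast
    then have "(c (k, i), c (l, j)) \<in> r" by (simp add: two_levels_def)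
    then show "below w (k, i) (l, j)" using rel_iff[of "(k, i)" "(l, j)"] pts ij assms(1) by simp
  qed
qed

lemma not_type_33_consecutive: "k < h \<Longrightarrow> \<not> type_33 (two_levels r k (k + 1))"
  using type_33_iff[of k "Suc k"] by (auto simp: below_def joins_def three_def)

lemma horizon_coded:
  assumes "2 \<le> h"
  shows "horizon r = 2"
  unfolding horizon_def height_coded
proof (rule Least_equality)
  show "0 < (2 :: nat) \<and> (\<forall>k. k + 2 \<le> h \<longrightarrow> type_33 (two_levels r k (k + 2)))"
    using type_33_iff by (auto simp: below_def)
  show "2 \<le> \<eta>" if "0 < \<eta> \<and> (\<forall>k. k + \<eta> \<le> h \<longrightarrow> type_33 (two_levels r k (k + \<eta>)))" for \<eta>
  proof (rule ccontr)
    assume "\<not> 2 \<le> \<eta>"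
    then have "\<eta> = 1" using that by simp
    then show False using that not_type_33_consecutive[of 0] assms by auto
  qed
qed

lemma covered_iff:
  assumes "p \<in> points h" "q \<in> points h"
  shows "covered_by r (c p) (c q) \<longleftrightarrow> below w p q \<and> \<not> (\<exists>z\<in>points h. below w p z \<and> below w z q)"
proof -
  have "(\<exists>z. (c p, z) \<in> strict r \<and> (z, c q) \<in> strict r) \<longleftrightarrow> (\<exists>z\<in>points h. below w p z \<and> below w z q)"
  proof
    assume "\<exists>z. (c p, z) \<in> strict r \<and> (z, c q) \<in> strict r"
    then obtain z where z: "(c p, z) \<in> strict r" "(z, c q) \<in> strict r" by blast
    from z(1) obtain z' where "z = c z'" "z' \<in> points h" by (rule strictE)
    then show "\<exists>z\<in>points h. below w p z \<and> below w z q" using z strict_rel_iff assms by auto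
  next
    assume "\<exists>z\<in>points h. below w p z \<and> below w z q"
    then obtain z where "z \<in> points h" "below w p z" "below w z q" by blast
    then show "\<exists>z. (c p, z) \<in> strict r \<and> (z, c q) \<in> strict r" using strict_rel_iff assms by blast
  qed
  then show ?thesis unfolding covered_by_def using strict_rel_iff[OF assms] by simp
qed

lemma covered_points: "covered_by r x y \<Longrightarrow> \<exists>p\<in>points h. \<exists>q\<in>points h. x = c p \<and> y = c q"
  unfolding covered_by_def by (blast elim: strictE)

lemma covered_next: "k < h \<Longrightarrow> i \<in> three \<Longrightarrow> j \<in> three \<Longrightarrow> joins (w k) i j \<Longrightarrow> covered_by r (c (k, i)) (c (Suc k, j))"
  by (subst covered_iff) (auto simp: points_def below_def)

text \<open>
Covers skip a level exactly when the only possible intermediate points are not in the way.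
They are the reason why an inner letter \<open>0\<close> creates no irreducible points.
\<close>

lemma covered_second:
  assumes "k + 2 \<le> h" "i \<in> three" "j \<in> three"
    and "\<And>l. l \<in> three \<Longrightarrow> joins (w k) i l \<Longrightarrow> \<not> joins (w (Suc k)) l j"
  shows "covered_by r (c (k, i)) (c (k + 2, j))"
  using assms by (subst covered_iff) (auto simp: points_def below_def)

lemma irreducible_bottom:
  assumes "0 < h" "\<not> w 0"
  shows "irreducible_point r (c (1, 0))"
proof -
  have pts: "(1, 0) \<in> points h" "(0, 0) \<in> points h" using assms(1) by (auto simp: points_def three_def)
  have "covered_by r y (c (1, 0)) \<longleftrightarrow> y = c (0, 0)" for y
  proof
    assume y: "covered_by r y (c (1, 0))"
    then obtain p where p: "p \<in> points h" "y = c p" using covered_points by blast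
    then have "below w p (1, 0)" using y covered_iff pts by blast
    then show "y = c (0, 0)" using p assms(2) by (cases p) (auto simp: below_def joins_def)
  next
    assume "y = c (0, 0)"
    then show "covered_by r y (c (1, 0))"
      using covered_next[of 0 0 0] assms by (simp add: three_def joins_def)
  qed
  then show ?thesis using pts Field_coded unfolding irreducible_point_def by auto
qed

lemma irreducible_top:
  assumes "0 < h" "\<not> w (h - 1)"
  shows "irreducible_point r (c (h - 1, 0))"
proof -
  have pts: "(h - 1, 0) \<in> points h" "(h, 0) \<in> points h" using assms(1) by (auto simp: points_def three_def)
  have "covered_by r (c (h - 1, 0)) y \<longleftrightarrow> y = c (h, 0)" for y
  proof
    assume y: "covered_by r (c (h - 1, 0)) y"
    then obtain p where p: "p \<in> points h" "y = c p" using covered_points by blast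
    then have "below w (h - 1, 0) p" using y covered_iff pts by blast
    then show "y = c (h, 0)" using p assms by (cases p) (auto simp: below_def joins_def points_def)
  next
    assume "y = c (h, 0)"
    then show "covered_by r (c (h - 1, 0)) y"
      using covered_next[of "h - 1" 0 0] assms by (simp add: three_def joins_def)
  qed
  then show ?thesis using pts Field_coded unfolding irreducible_point_def by auto
qed

lemma other_two: "i \<in> three \<Longrightarrow> \<exists>j\<in>three. \<exists>l\<in>three. j \<noteq> i \<and> l \<noteq> i \<and> j \<noteq> l"
  by (auto simp: three_def)

lemma no_irreducible:
  assumes "w 0" "w (h - 1)"
  shows "\<not> irreducible_point r x"
proof
  assume irr: "irreducible_point r x"
  then obtain k i where x: "x = c (k, i)" "(k, i) \<in> points h"
    unfolding irreducible_point_def Field_coded by auto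
  then have k: "k \<le> h" and i: "i \<in> three" by (auto simp: points_def)
  obtain j l where jl: "j \<in> three" "l \<in> three" "j \<noteq> i" "l \<noteq> i" "j \<noteq> l" using other_two[OF i] by blast
  have two_low: "\<exists>y z. y \<noteq> z \<and> covered_by r y x \<and> covered_by r z x" if y: "covered_by r y x" for y
  proof -
    have "k \<noteq> 0"
    proof
      assume "k = 0"
      obtain p where "p \<in> points h" "y = c p" using covered_points[OF y] by blast
      then have "below w p (k, i)" using y covered_iff x by blast
      then show False using \<open>k = 0\<close> by (simp add: below_def)
    qed
    then obtain m where m: "k = Suc m" by (cases k) auto
    show ?thesis
    proof (cases "w m")
      case True
      then have "covered_by r (c (m, j)) x" "covered_by r (c (m, l)) x"
        using covered_next[of m j i] covered_next[of m l i] jl i k m x by (auto simp: joins_def)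
      moreover have "c (m, j) \<noteq> c (m, l)" using c_inj jl k m by (simp add: points_def)
      ultimately show ?thesis by blast
    next
      case False
      then have "m \<noteq> 0" using assms(1) by (metis)
      then obtain m' where m': "m = Suc m'" by (cases m) auto
      obtain j' where j': "j' \<in> three" "\<not> joins (w m') j' i"
        using jl i by (cases "w m'") (auto simp: joins_def)
      have "covered_by r (c (m, i)) x"
        using covered_next[of m i i] False i k m x by (auto simp: joins_def)
      moreover have "covered_by r (c (m', j')) x"
        using covered_second[of m' j' i] j' False i k m m' x by (auto simp: joins_def)
      moreover have "c (m, i) \<noteq> c (m', j')" using c_inj i j' k m m' by (simp add: points_def)
      ultimately show ?thesis by blast
    qed
  qed
  have two_up: "\<exists>y z. y \<noteq> z \<and> covered_by r x y \<and> covered_by r x z" if y: "covered_by r x y" for y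
  proof -
    have "k \<noteq> h"
    proof
      assume "k = h"
      obtain p where p: "p \<in> points h" "y = c p" using covered_points[OF y] by blast
      then have "below w (k, i) p" using y covered_iff x by blast
      then show False using \<open>k = h\<close> p by (auto simp: below_def points_def)
    qed
    then have kh: "k < h" using k by simp
    show ?thesis
    proof (cases "w k")
      case True
      then have "covered_by r x (c (Suc k, j))" "covered_by r x (c (Suc k, l))"
        using covered_next[of k i j] covered_next[of k i l] jl i kh x by (auto simp: joins_def)
      moreover have "c (Suc k, j) \<noteq> c (Suc k, l)" using c_inj jl kh by (simp add: points_def)
      ultimately show ?thesis by blast
    next
      case False
      then have "k \<noteq> h - 1" using assms(2) by metis
      then have k2: "k + 2 \<le> h" using kh by simp
      obtain j' where j': "j' \<in> three" "\<not> joins (w (Suc k)) i j'"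
        using jl i by (cases "w (Suc k)") (auto simp: joins_def)
      have "covered_by r x (c (Suc k, i))"
        using covered_next[of k i i] False i kh x by (auto simp: joins_def)
      moreover have "covered_by r x (c (k + 2, j'))"
        using covered_second[of k i j'] j' False i k2 x by (auto simp: joins_def)
      moreover have "c (Suc k, i) \<noteq> c (k + 2, j')" using c_inj i j' k2 by (simp add: points_def)
      ultimately show ?thesis by blast
    qed
  qed
  show False using irr two_low two_up unfolding irreducible_point_def by metis
qed

end

section \<open>Membership in the class\<close>

text \<open>
The description of a section by three chains and the one by matchings between consecutive levels differ
by a shift of the columns at every 6-crown.  The offset of a level is the sum of the shifts \<open>m\<close> below it,
and translates between the two.
\<close>

fun offset :: "(nat \<Rightarrow> nat) \<Rightarrow> nat \<Rightarrow> nat" where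
  "offset m 0 = 0"
| "offset m (Suc k) = (offset m k + m k) mod 3"

lemma mod3_three: "n mod 3 \<in> three"
  by (simp flip: three_conv(4))

lemma shift_inj: "i \<in> three \<Longrightarrow> j \<in> three \<Longrightarrow> (i + s) mod 3 = (j + s) mod 3 \<longleftrightarrow> i = j"
  for i j s :: nat
  unfolding three_def
  by (auto; presburger)

lemma shift_surj: "j \<in> three \<Longrightarrow> \<exists>i\<in>three. j = (i + s) mod 3"
  for j s :: nat
  unfolding three_def
  by (auto; presburger)

context coded
begin

text \<open>
The chains of the section must run along comparabilities, so they move one column to the right
at every 6-crown and stay in their column otherwise.
\<close>

lemma width_three_section_coded:
  assumes "1 \<le> h"
  shows "width_three_section r"
proof -
  let ?s = "offset (\<lambda>k. if w k then 1 else 0)"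
  define d where "d k j = c (k, (j + ?s k) mod 3)" for k j
  define f where "f x = (case inv_into (points h) c x of (k, i) \<Rightarrow> c (k, (i + 1) mod 3))" for x
  have pt: "(k, j mod 3) \<in> points h" if "k \<le> h" for k j
    using that mod3_three by (simp add: points_def)
  have f: "f (c (k, i)) = c (k, (i + 1) mod 3)" if "(k, i) \<in> points h" for k i
    using that inj by (simp add: f_def inv_into_f_f)
  have fd: "f (d k j) = d k ((j + 1) mod 3)" if "k \<le> h" for k j
    unfolding d_def f[OF pt[OF that]] by (simp add: mod_simps ac_simps)
  have joins: "joins b ((i + 1) mod 3) ((j + 1) mod 3) \<longleftrightarrow> joins b i j" if "i \<in> three" "j \<in> three" for b i j
    using shift_inj[OF that, of 1] by (simp add: joins_def)
  have img: "(\<lambda>i. (i + 1) mod 3) ` three = three" by (auto simp: three_def)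
  show ?thesis unfolding width_three_section_def height_coded three_conv
  proof (intro conjI exI[of _ d])
    show "inj_on (\<lambda>(k, j). d k j) ({0..h} \<times> three)"
    proof (rule inj_onI)
      fix p q assume pq: "p \<in> {0..h} \<times> three" "q \<in> {0..h} \<times> three" "(\<lambda>(k, j). d k j) p = (\<lambda>(k, j). d k j) q"
      obtain k j l i where *: "p = (k, j)" "q = (l, i)" by (cases p; cases q)
      then have "c (k, (j + ?s k) mod 3) = c (l, (i + ?s l) mod 3)" "k \<le> h" "l \<le> h"
        using pq by (simp_all add: d_def)
      then have "(k, (j + ?s k) mod 3) = (l, (i + ?s l) mod 3)" using c_inj[OF pt pt] by blast
      then have "k = l" "(j + ?s l) mod 3 = (i + ?s l) mod 3" by auto
      then show "p = q" using shift_inj[of j i "?s l"] pq * by simp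
    qed
    show "Field r = {d k j |k j. k \<in> {0..h} \<and> j \<in> three}"
    proof
      show "Field r \<subseteq> {d k j |k j. k \<in> {0..h} \<and> j \<in> three}"
      proof
        fix x assume "x \<in> Field r"
        then obtain k i where x: "x = c (k, i)" "k \<le> h" "i \<in> three" unfolding Field_coded by (auto simp: points_def)
        obtain j where "j \<in> three" "i = (j + ?s k) mod 3" using shift_surj[OF x(3)] by blast
        then have "x = d k j" by (simp add: d_def x)
        then show "x \<in> {d k j |k j. k \<in> {0..h} \<and> j \<in> three}" using x \<open>j \<in> three\<close> by auto
      qed
      show "{d k j |k j. k \<in> {0..h} \<and> j \<in> three} \<subseteq> Field r"
        using pt unfolding Field_coded d_def by auto
    qed
    show "\<forall>j\<in>three. \<forall>k<h. (d k j, d (k + 1) j) \<in> strict r"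
    proof (intro ballI allI impI)
      fix j k assume "j \<in> three" "k < h"
      have "(a mod 3 = (a + 1) mod 3) = False" for a :: nat by presburger
      then have "joins (w k) ((j + ?s k) mod 3) ((j + ?s (Suc k)) mod 3)"
        by (simp add: joins_def mod_simps ac_simps)
      then show "(d k j, d (k + 1) j) \<in> strict r"
        using strict_rel_iff[OF pt pt, of k "k + 1"] \<open>k < h\<close> by (simp add: d_def below_def)
    qed
    show "\<forall>k\<in>{0..h}. \<forall>i\<in>three. \<forall>j\<in>three. (d k i, d k j) \<notin> strict r"
      using strict_rel_iff[OF pt pt] by (auto simp: d_def below_def)
    show "\<exists>f. order_automorphism r f \<and> (\<forall>k\<in>{0..h}. \<forall>j\<in>three. f (d k j) = d k ((j + 1) mod 3))"
    proof (intro exI[of _ f] conjI ballI)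
      show "order_automorphism r f" unfolding order_automorphism_def Field_coded
      proof (intro conjI ballI)
        show "bij_betw f (c ` points h) (c ` points h)" unfolding bij_betw_def
        proof
          show "inj_on f (c ` points h)"
          proof (rule inj_onI)
            fix x y assume "x \<in> c ` points h" "y \<in> c ` points h" "f x = f y"
            then obtain k i l j where *: "x = c (k, i)" "y = c (l, j)" "(k, i) \<in> points h" "(l, j) \<in> points h"
              "c (k, (i + 1) mod 3) = c (l, (j + 1) mod 3)" using f by auto
            then have "k \<le> h" "l \<le> h" by (simp_all add: points_def)
            then have "(k, (i + 1) mod 3) = (l, (j + 1) mod 3)" using c_inj[OF pt pt] *(5) by blast
            then show "x = y" using * shift_inj[of i j 1] by (simp add: points_def)
          qed
          have "f ` c ` points h = c ` ({..h} \<times> (\<lambda>i. (i + 1) mod 3) ` three)"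
          proof -
            have "f ` c ` points h = (\<lambda>(k, i). c (k, (i + 1) mod 3)) ` points h"
              unfolding image_image using f by (intro image_cong) auto
            also have "\<dots> = c ` ({..h} \<times> (\<lambda>i. (i + 1) mod 3) ` three)"
              unfolding points_def by force
            finally show ?thesis .
          qed
          then show "f ` c ` points h = c ` points h" unfolding img points_def .
        qed
        fix x y assume "x \<in> c ` points h" "y \<in> c ` points h"
        then obtain k i l j where *: "x = c (k, i)" "y = c (l, j)" "(k, i) \<in> points h" "(l, j) \<in> points h" by auto
        then have "k \<le> h" "l \<le> h" "i \<in> three" "j \<in> three" by (auto simp: points_def)
        then show "(x, y) \<in> r \<longleftrightarrow> (f x, f y) \<in> r"
          using * f rel_iff[of "(k, i)" "(l, j)"] rel_iff[OF pt pt, of k l "i + 1" "j + 1"]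
            shift_inj[of i j 1] joins[of i j] by (simp add: below_def)
      qed
    qed (use fd in auto)
    show "\<forall>k\<in>{0..h - 1}. \<not> type_33 (two_levels r k (k + 1))"
      using not_type_33_consecutive assms by auto
  qed (use coded_poset assms in auto)
qed

lemma nice_section_coded: "1 \<le> h \<Longrightarrow> nice_section r \<longleftrightarrow> w 0 \<and> w (h - 1)"
  unfolding nice_section_def
  using width_three_section_coded no_irreducible irreducible_bottom irreducible_top by fastforce

lemma class_N2_coded: "1 \<le> h \<Longrightarrow> class_N2 r \<longleftrightarrow> 2 \<le> h \<and> w 0 \<and> w (h - 1)"
  unfolding class_N2_def height_coded using nice_section_coded horizon_coded by auto

lemma stack_retract_coded: "has_stack_retract r \<longleftrightarrow> (\<exists>n\<ge>2. peel (points h) (below w) n {} UNIV)"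
proof -
  have bij: "bij_betw c (points h) (Field r)" using inj unfolding Field_coded bij_betw_def by blast
  have "peel (Field r) (\<lambda>x y. (x, y) \<in> strict r) n {} UNIV \<longleftrightarrow> peel (points h) (below w) n {} UNIV" for n
  proof
    assume p: "peel (points h) (below w) n {} UNIV"
    have "peel (Field r) (\<lambda>x y. (x, y) \<in> strict r) n (c ` ({} \<inter> points h)) (c ` (UNIV \<inter> points h))"
      by (rule peel_transfer[OF p bij]) (rule strict_rel_iff)
    then show "peel (Field r) (\<lambda>x y. (x, y) \<in> strict r) n {} UNIV" by (rule peel_mono) auto
  next
    assume p: "peel (Field r) (\<lambda>x y. (x, y) \<in> strict r) n {} UNIV"
    have "below w (inv_into (points h) c x) (inv_into (points h) c y) \<longleftrightarrow> (x, y) \<in> strict r"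
      if xy: "x \<in> Field r" "y \<in> Field r" for x y
    proof -
      obtain p q where "x = c p" "y = c q" "p \<in> points h" "q \<in> points h"
        using xy unfolding Field_coded by blast
      then show ?thesis using strict_rel_iff[of p q] inj by (simp add: inv_into_f_f)
    qed
    then have "peel (points h) (below w) n (inv_into (points h) c ` ({} \<inter> Field r)) (inv_into (points h) c ` (UNIV \<inter> Field r))"
      by (rule peel_transfer[OF p bij_betw_inv_into[OF bij]])
    then show "peel (points h) (below w) n {} UNIV" by (rule peel_mono) auto
  qed
  then show ?thesis using stack_retract_peel[OF coded_poset] by simp
qed

end

text \<open>
By the rotation, the comparabilities between consecutive levels are determined by a set of shifts.
It contains \<open>0\<close> because of the chains and is not everything because two consecutive levels are
not of type \<open>33\<close>.  So it is \<open>{0}\<close>, or misses exactly one shift, and then the missing shift is the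
matching along which the levels get aligned.  Horizon \<open>2\<close> makes levels two apart completely
comparable, and the chains extend this to levels further apart.
\<close>

lemma class_N2_coded_ex:
  assumes "class_N2 q"
  shows "\<exists>w c. coded q (poset_height q) w c"
proof -
  define h where "h = poset_height q"
  have sec: "width_three_section q" and h2: "2 \<le> h" and hor: "horizon q = 2"
    using assms by (auto simp: class_N2_def nice_section_def h_def)
  from sec obtain d where poset: "finite_poset q"
    and inj: "inj_on (\<lambda>(k, j). d k j) ({0..h} \<times> three)"
    and Field: "Field q = {d k j |k j. k \<in> {0..h} \<and> j \<in> three}"
    and chain1: "\<And>j k. j \<in> three \<Longrightarrow> k < h \<Longrightarrow> (d k j, d (Suc k) j) \<in> strict q"
    and anti: "\<And>k i j. k \<le> h \<Longrightarrow> i \<in> three \<Longrightarrow> j \<in> three \<Longrightarrow> (d k i, d k j) \<notin> strict q"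
    and aut: "\<exists>f. order_automorphism q f \<and> (\<forall>k\<in>{0..h}. \<forall>j\<in>three. f (d k j) = d k ((j + 1) mod 3))"
    and not33: "\<And>k. k < h \<Longrightarrow> \<not> type_33 (two_levels q k (Suc k))"
    unfolding width_three_section_def three_conv h_def[symmetric] by fastforce
  note pf = poset_facts[OF poset]
  have trans: "(x, z) \<in> strict q" if "(x, y) \<in> strict q" "(y, z) \<in> strict q" for x y z
    using that pf(3,4) unfolding strict_iff by blast
  have dinj: "d k i = d l j \<longleftrightarrow> k = l \<and> i = j" if "k \<le> h" "l \<le> h" "i \<in> three" "j \<in> three" for k l i j
    using inj_on_eq_iff[OF inj, of "(k, i)" "(l, j)"] that by simp
  have dF: "d k j \<in> Field q" if "k \<le> h" "j \<in> three" for k j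
    using that unfolding Field by auto
  have chain: "(d k j, d l j) \<in> strict q" if "k < l" "l \<le> h" "j \<in> three" for k l j
    using that
  proof (induction l)
    case (Suc l)
    then show ?case using chain1[of j l] trans[of "d k j" "d l j" "d (Suc l) j"] by (cases "k = l") auto
  qed simp
  have up: "k < l" if "(d k i, d l j) \<in> strict q" "k \<le> h" "l \<le> h" "i \<in> three" "j \<in> three" for k l i j
  proof (rule ccontr)
    assume "\<not> k < l"
    then consider "k = l" | "l < k" by linarith
    then show False
    proof cases
      case 1
      then show ?thesis using anti that by blast
    next
      case 2
      then have "(d l j, d k j) \<in> strict q" using chain that by blast
      then have "(d k i, d k j) \<in> strict q" using trans that(1) by blast
      then show ?thesis using anti that by blast
    qed
  qed
  define rk where "rk x = (THE k. k \<le> h \<and> (\<exists>j\<in>three. x = d k j))" for x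
  have rk: "rk (d k j) = k" if "k \<le> h" "j \<in> three" for k j
    unfolding rk_def using that dinj by (intro the_equality) auto
  have level: "level q k = d k ` three" if "k \<le> h" for k
  proof -
    have "level q k = {x \<in> Field q. rk x = k}"
    proof (rule graded_level)
      fix x y assume xy: "(x, y) \<in> q" "x \<noteq> y"
      then have "x \<in> Field q" "y \<in> Field q" by (auto intro: FieldI1 FieldI2)
      then obtain k i l j where "x = d k i" "y = d l j" "k \<le> h" "l \<le> h" "i \<in> three" "j \<in> three"
        unfolding Field by auto
      then show "rk x < rk y" using up[of k i l j] rk xy by (simp add: strict_iff)
    next
      fix x k assume x: "x \<in> Field q" "rk x = Suc k"
      then obtain l j where l: "x = d l j" "l \<le> h" "j \<in> three" unfolding Field by auto
      then have "l = Suc k" using rk x by simp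
      then show "\<exists>y. (y, x) \<in> q \<and> rk y = k"
        using l chain1[of j k] rk[of k j] by (intro exI[of _ "d k j"]) (auto simp: strict_iff)
    qed
    then show ?thesis using that rk unfolding Field by auto
  qed
  have far2: "(d k i, d (k + 2) j) \<in> strict q" if "k + 2 \<le> h" "i \<in> three" "j \<in> three" for k i j
  proof -
    have "0 < (2 :: nat) \<and> (\<forall>k. k + 2 \<le> poset_height q \<longrightarrow> type_33 (two_levels q k (k + 2)))"
    proof -
      \<comment> \<open>The least \<open>\<eta>\<close> is meaningful: the condition is vacuous for every \<open>\<eta>\<close> above the height.\<close>
      have "\<exists>\<eta>. 0 < \<eta> \<and> (\<forall>k. k + \<eta> \<le> poset_height q \<longrightarrow> type_33 (two_levels q k (k + \<eta>)))"
        by (rule exI[of _ "Suc (poset_height q)"]) auto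
      from LeastI_ex[OF this] show ?thesis unfolding horizon_def[symmetric] hor .
    qed
    then have "type_33 (two_levels q k (k + 2))" using that(1) by (simp add: h_def)
    then obtain A B where AB: "two_levels q k (k + 2) = Id_on (A \<union> B) \<union> A \<times> B"
      unfolding type_33_def by (elim exE conjE)
    have mem: "d k l \<in> A \<and> d (k + 2) l \<in> B" if l: "l \<in> three" for l
    proof -
      have s: "(d k l, d (k + 2) l) \<in> strict q" using chain[of k "k + 2" l] that l \<open>k + 2 \<le> h\<close> by simp
      then have "(d k l, d (k + 2) l) \<in> two_levels q k (k + 2)"
        using level[of k] level[of "k + 2"] l \<open>k + 2 \<le> h\<close> unfolding two_levels_def by (auto simp: strict_iff simp del: level.simps)
      then show ?thesis using s unfolding AB strict_iff by auto
    qed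
    then have "(d k i, d (k + 2) j) \<in> two_levels q k (k + 2)" using that unfolding AB by blast
    moreover have "d k i \<noteq> d (k + 2) j" using dinj[of k "k + 2" i j] that by simp
    ultimately show ?thesis by (simp add: two_levels_def strict_iff)
  qed
  have far: "(d k i, d l j) \<in> strict q" if "k + 2 \<le> l" "l \<le> h" "i \<in> three" "j \<in> three" for k l i j
    using far2[of k i j] chain[of "k + 2" l j] trans[of "d k i" "d (k + 2) j" "d l j"] that
    by (cases "l = k + 2") auto
  define E where "E k s \<longleftrightarrow> (d k 0, d (Suc k) s) \<in> strict q" for k s
  have rot: "(d k i, d (Suc k) j) \<in> strict q \<longleftrightarrow> (d k ((i + 1) mod 3), d (Suc k) ((j + 1) mod 3)) \<in> strict q"
    if "k < h" "i \<in> three" "j \<in> three" for k i j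
  proof -
    from aut obtain f where f: "order_automorphism q f" "\<And>k j. k \<le> h \<Longrightarrow> j \<in> three \<Longrightarrow> f (d k j) = d k ((j + 1) mod 3)"
      by auto
    have "(d k i, d (Suc k) j) \<in> q \<longleftrightarrow> (f (d k i), f (d (Suc k) j)) \<in> q"
      using f(1) dF[of k i] dF[of "Suc k" j] that unfolding order_automorphism_def by simp
    then show ?thesis using f(2) that dinj[of k "Suc k"] mod3_three by (simp add: strict_iff)
  qed
  have shift: "(d k i, d (Suc k) ((i + s) mod 3)) \<in> strict q \<longleftrightarrow> E k s" if "k < h" "i \<in> three" "s \<in> three" for k i s
  proof -
    have m: "((0 + s) mod 3 + 1) mod 3 = (1 + s) mod 3" "((1 + s) mod 3 + 1) mod 3 = (2 + s) mod 3"
      by (simp_all add: mod_simps)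
    have "(d k 1, d (Suc k) ((1 + s) mod 3)) \<in> strict q \<longleftrightarrow> E k s"
      using rot[of k 0 "(0 + s) mod 3"] that(1,3) m(1) mod3_three[of "0 + s"] by (auto simp: E_def three_def)
    moreover have "(d k 2, d (Suc k) ((2 + s) mod 3)) \<in> strict q \<longleftrightarrow> (d k 1, d (Suc k) ((1 + s) mod 3)) \<in> strict q"
      using rot[of k 1 "(1 + s) mod 3"] that(1,3) m(2) mod3_three[of "1 + s"] by (simp add: three_def numeral_2_eq_2)
    ultimately show ?thesis using that(2,3) by (auto simp: E_def three_def numeral_2_eq_2)
  qed
  have E0: "E k 0" if "k < h" for k using chain1[of 0 k] that by (simp add: E_def three_def)
  have E12: "\<not> (E k 1 \<and> E k 2)" if kh: "k < h" for k
  proof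
    assume e: "E k 1 \<and> E k 2"
    have all: "(d k i, d (Suc k) j) \<in> strict q" if ij: "i \<in> three" "j \<in> three" for i j
    proof -
      obtain s where "s \<in> three" "j = (s + i) mod 3" using shift_surj[OF ij(2)] by blast
      then show ?thesis using shift[OF \<open>k < h\<close> ij(1), of s] e E0[OF \<open>k < h\<close>] by (auto simp: three_def add.commute)
    qed
    have "two_levels q k (Suc k) = Id_on (d k ` three \<union> d (Suc k) ` three) \<union> d k ` three \<times> d (Suc k) ` three" (is "?l = ?r")
    proof
      show "?l \<subseteq> ?r"
      proof
        fix z assume "z \<in> ?l"
        then obtain x y where z: "z = (x, y)" "(x, y) \<in> q" "x \<in> d k ` three \<union> d (Suc k) ` three" "y \<in> d k ` three \<union> d (Suc k) ` three"
          using level[of k] level[of "Suc k"] kh unfolding two_levels_def by (auto simp del: level.simps)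
        then obtain a i b j where ab: "x = d a i" "y = d b j" "a \<in> {k, Suc k}" "b \<in> {k, Suc k}" "i \<in> three" "j \<in> three"
          by blast
        show "z \<in> ?r"
        proof (cases "x = y")
          case False
          then have "a < b" using up[of a i b j] z ab kh by (auto simp: strict_iff)
          then show ?thesis using z ab by auto
        qed (use z in auto)
      qed
      show "?r \<subseteq> ?l"
        using level[of k] level[of "Suc k"] kh all pf(2) dF unfolding two_levels_def
        by (auto simp: strict_iff simp del: level.simps)
    qed
    moreover have "card (d a ` three) = 3" if "a \<le> h" for a
      using dinj that by (subst card_image) (auto simp: inj_on_def card_three)
    moreover have "d k ` three \<inter> d (Suc k) ` three = {}" using dinj[of k "Suc k"] kh by auto
    ultimately have "type_33 (two_levels q k (Suc k))"
      using kh unfolding type_33_def by (intro exI[of _ "d k ` three"] exI[of _ "d (Suc k) ` three"]) auto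
    then show False using not33 kh by blast
  qed
  \<comment> \<open>The matching between the levels \<open>k\<close> and \<open>k + 1\<close> is the shift \<open>m k\<close>: the missing shift for a 6-crown,
    and \<open>0\<close> for type \<open>3C\<close>.\<close>
  define m where "m k = (if E k 1 then 2 else if E k 2 then 1 else 0 :: nat)" for k
  define w where "w k \<longleftrightarrow> E k 1 \<or> E k 2" for k
  define c where "c = (\<lambda>(k, i). d k ((i + offset m k) mod 3))"
  have near: "(c (k, i), c (Suc k, j)) \<in> strict q \<longleftrightarrow> joins (w k) i j"
    if "k < h" "i \<in> three" "j \<in> three" for k i j
  proof -
    define o' where "o' = offset m k"
    obtain s where s: "s \<in> three" "(j + m k) mod 3 = (s + i) mod 3"
      using shift_surj[OF mod3_three, of "j + m k" i] by blast
    have "((i + o') mod 3 + s) mod 3 = ((s + i) mod 3 + o') mod 3" by (simp add: mod_simps ac_simps)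
    also have "\<dots> = (j + (o' + m k) mod 3) mod 3" unfolding s(2)[symmetric] by (simp add: mod_simps ac_simps)
    finally have "c (Suc k, j) = d (Suc k) (((i + o') mod 3 + s) mod 3)" by (simp add: c_def o'_def)
    moreover have "c (k, i) = d k ((i + o') mod 3)" by (simp add: c_def o'_def)
    ultimately have "(c (k, i), c (Suc k, j)) \<in> strict q \<longleftrightarrow> E k s"
      using shift[OF that(1) mod3_three s(1)] by simp
    also have "\<dots> \<longleftrightarrow> joins (w k) i j"
      using s that(2,3) E0[OF that(1)] E12[OF that(1)]
      unfolding three_def joins_def w_def m_def by (auto split: if_splits)
    finally show ?thesis .
  qed
  have cinj: "inj_on c (points h)"
  proof (rule inj_onI)
    fix p p' assume p: "p \<in> points h" "p' \<in> points h" "c p = c p'"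
    obtain k i l j where *: "p = (k, i)" "p' = (l, j)" by (cases p; cases p')
    then have "d k ((i + offset m k) mod 3) = d l ((j + offset m l) mod 3)" "k \<le> h" "l \<le> h"
      using p by (simp_all add: c_def points_def)
    then have "k = l \<and> (i + offset m k) mod 3 = (j + offset m l) mod 3"
      using dinj[OF _ _ mod3_three mod3_three] by blast
    then have "k = l" "(i + offset m l) mod 3 = (j + offset m l) mod 3" by auto
    then show "p = p'" using shift_inj[of i j "offset m l"] p * by (simp add: points_def)
  qed
  have cd: "\<exists>p\<in>points h. d k j = c p" if kj: "k \<le> h" "j \<in> three" for k j
  proof -
    obtain i where "i \<in> three" "j = (i + offset m k) mod 3" using shift_surj[OF kj(2)] by blast
    then show ?thesis using kj by (intro bexI[of _ "(k, i)"]) (auto simp: c_def points_def)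
  qed
  have cF: "c p \<in> Field q" if "p \<in> points h" for p
    using that dF mod3_three by (cases p) (auto simp: c_def points_def)
  have rel: "(c p, c p') \<in> strict q \<longleftrightarrow> below w p p'" if "p \<in> points h" "p' \<in> points h" for p p'
  proof -
    obtain k i l j where *: "p = (k, i)" "p' = (l, j)" by (cases p; cases p')
    then have b: "k \<le> h" "l \<le> h" "i \<in> three" "j \<in> three" using that by (auto simp: points_def)
    consider "l \<le> k" | "l = Suc k" | "k + 2 \<le> l" by linarith
    then show ?thesis
    proof cases
      case 1
      then show ?thesis
        using up[of k "(i + offset m k) mod 3" l "(j + offset m l) mod 3"] b mod3_three
        by (auto simp: * c_def below_def)
    next
      case 2
      then show ?thesis using near[of k i j] b by (simp add: * below_def)
    next
      case 3
      then show ?thesis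
        using far[of k l "(i + offset m k) mod 3" "(j + offset m l) mod 3"] b mod3_three
        by (simp add: * c_def below_def)
    qed
  qed
  have "q = {(c p, c p') | p p'. p \<in> points h \<and> p' \<in> points h \<and> (p = p' \<or> below w p p')}" (is "_ = ?r")
  proof (intro equalityI subrelI)
    fix x y assume xy: "(x, y) \<in> q"
    then have "x \<in> Field q" "y \<in> Field q" by (auto intro: FieldI1 FieldI2)
    moreover have "\<exists>p\<in>points h. z = c p" if "z \<in> Field q" for z
      using that cd unfolding Field by auto
    ultimately obtain p p' where p: "p \<in> points h" "p' \<in> points h" "x = c p" "y = c p'" by blast
    then have "p = p' \<or> below w p p'" using xy rel[of p p'] inj_on_eq_iff[OF cinj, of p p'] by (auto simp: strict_iff)
    then show "(x, y) \<in> ?r" using p by blast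
  next
    fix x y assume "(x, y) \<in> ?r"
    then obtain p p' where p: "p \<in> points h" "p' \<in> points h" "x = c p" "y = c p'" "p = p' \<or> below w p p'" by blast
    then show "(x, y) \<in> q" using rel[of p p'] pf(2)[OF cF[OF p(1)]] by (auto simp: strict_iff)
  qed
  then have "coded q h w c" using cinj by unfold_locales
  then show ?thesis unfolding h_def by blast
qed

section \<open>One layer of a peeling\<close>

definition nbrs :: "bool \<Rightarrow> nat \<Rightarrow> nat set" where
  "nbrs c i = {j \<in> three. joins c i j}"

text \<open>
A state \<open>(R, V0, V1)\<close> at level \<open>t\<close>: left are the points of level \<open>t\<close> in the columns \<open>R\<close> and all higher levels;
a later pair may use the columns \<open>V0\<close> of level \<open>t\<close>, the columns \<open>V1\<close> of level \<open>t + 1\<close>, and everything above.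
\<close>

type_synonym state = "nat set \<times> nat set \<times> nat set"

text \<open>
A short move leads from level \<open>t\<close> to level \<open>t + 1\<close>.  It takes all of \<open>R\<close>, splits it into \<open>A\<close> and \<open>R - A\<close>,
and adds every point of level \<open>t + 1\<close> whose lower neighbours in \<open>R\<close> are all on one side.  The three
cases say on which of the two levels the points of the pair are.  The letters are \<open>c\<close> above level \<open>t\<close>
and \<open>d\<close> above level \<open>t + 1\<close>.  With \<open>\<Phi>\<close> as a continuation, moves can both be reasoned about
and be evaluated.
\<close>

definition some_short :: "bool \<Rightarrow> bool \<Rightarrow> state \<Rightarrow> (state \<Rightarrow> bool) \<Rightarrow> bool" where
  "some_short c d = (\<lambda>(R, V0, V1) \<Phi>. \<exists>A\<in>Pow R.
     let P = {i \<in> three. nbrs c i \<inter> R \<subseteq> A}; Q = {i \<in> three. nbrs c i \<inter> R \<subseteq> R - A};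
         R' = three - P - Q
     in (\<exists>a\<in>A \<inter> V0. (\<exists>b\<in>(R - A) \<inter> V0. \<Phi> (R', V1 \<inter> nbrs c a \<inter> nbrs c b, three))
                     \<or> (\<exists>b\<in>Q \<inter> V1. \<Phi> (R', {}, nbrs d b)))
        \<or> (\<exists>a\<in>P \<inter> V1. \<exists>b\<in>Q \<inter> V1. a \<noteq> b \<and> \<Phi> (R', {}, nbrs d a \<inter> nbrs d b)))"

text \<open>
A long move leads from level \<open>t\<close> to level \<open>t + 2\<close>.  One part of the layer is a single point \<open>b\<close> of level \<open>t + 1\<close>
without neighbours in \<open>R\<close>; the other part is \<open>R\<close>, the rest of level \<open>t + 1\<close> and the points of level \<open>t + 2\<close>
that are not above \<open>b\<close>.  The three cases are the three possible levels of the other point of the pair.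
\<close>

definition some_long :: "bool \<Rightarrow> bool \<Rightarrow> bool \<Rightarrow> state \<Rightarrow> (state \<Rightarrow> bool) \<Rightarrow> bool" where
  "some_long c d e = (\<lambda>(R, V0, V1) \<Phi>. \<exists>b\<in>V1. nbrs c b \<inter> R = {} \<and>
     (R \<inter> V0 \<noteq> {} \<and> \<Phi> (nbrs d b, nbrs d b, three)
      \<or> (\<exists>a\<in>V1. a \<noteq> b \<and> \<Phi> (nbrs d b, nbrs d b \<inter> nbrs d a, three))
      \<or> (\<exists>a\<in>three - nbrs d b. \<Phi> (nbrs d b, {}, nbrs e a))))"

text \<open>
If \<open>s\<close> covers \<open>m\<close>, then in \<open>s\<close> at least as many points are gone as in \<open>m\<close>, without loss
for the pairs; so \<open>s\<close> can be peeled whenever \<open>m\<close> can.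
\<close>

definition covers :: "state \<Rightarrow> state \<Rightarrow> bool" where
  "covers = (\<lambda>(R, V0, V1) (R', V0', V1'). R \<subseteq> R' \<and> V0' \<inter> R' \<subseteq> V0 \<inter> R \<and> V1' \<subseteq> V1)"

definition arrange :: "nat \<Rightarrow> nat \<Rightarrow> nat \<Rightarrow> nat \<Rightarrow> nat" where
  "arrange p q r i = (if i = 0 then p else if i = 1 then q else if i = 2 then r else i)"
definition arrangements :: "(nat \<Rightarrow> nat) list" where
  "arrangements = [arrange 0 1 2, arrange 0 2 1, arrange 1 0 2, arrange 1 2 0, arrange 2 0 1, arrange 2 1 0]"

definition renamed :: "(nat \<Rightarrow> nat) \<Rightarrow> state \<Rightarrow> state" where
  "renamed \<sigma> = (\<lambda>(R, V0, V1). (\<sigma> ` R, \<sigma> ` V0, \<sigma> ` V1))"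

definition removed :: "nat \<Rightarrow> nat set \<Rightarrow> (nat \<times> nat) set" where
  "removed t R = {(k, i). k < t \<or> k = t \<and> i \<notin> R}"

definition usable :: "nat \<Rightarrow> nat set \<Rightarrow> nat set \<Rightarrow> (nat \<times> nat) set" where
  "usable t V0 V1 = {(k, i). k = t \<and> i \<in> V0 \<or> k = Suc t \<and> i \<in> V1 \<or> t + 2 \<le> k}"

definition peels :: "(nat \<Rightarrow> bool) \<Rightarrow> nat \<Rightarrow> nat \<Rightarrow> nat \<Rightarrow> state \<Rightarrow> bool" where
  "peels w h n t = (\<lambda>(R, V0, V1). peel (points h) (below w) n (removed t R) (usable t V0 V1))"

lemma peels_covers:
  assumes "peels w h n t m" "covers s m"
  shows "peels w h n t s"
proof -
  obtain R V0 V1 where s: "s = (R, V0, V1)" by (cases s)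
  obtain R' V0' V1' where m: "m = (R', V0', V1')" by (cases m)
  have *: "R \<subseteq> R'" "V0' \<inter> R' \<subseteq> V0 \<inter> R" "V1' \<subseteq> V1" using assms(2) by (auto simp: s m covers_def)
  have "peel (points h) (below w) n (removed t R') (usable t V0' V1')"
    using assms(1) by (simp add: m peels_def)
  moreover have "removed t R' \<subseteq> removed t R" "usable t V0' V1' - removed t R' \<subseteq> usable t V0 V1 - removed t R"
    using * by (auto simp: removed_def usable_def)
  ultimately have "peel (points h) (below w) n (removed t R) (usable t V0 V1)"
    by (elim peel_mono) blast+
  then show ?thesis by (simp add: s peels_def)
qed

lemma peels_renamed:
  assumes "peels w h n t s"  "\<sigma> \<in> set arrangements"
  shows "peels w h n t (renamed \<sigma> s)"
proof -
  obtain R V0 V1 where s: "s = (R, V0, V1)" by (cases s)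
  have inj: "\<sigma> i = \<sigma> j \<longleftrightarrow> i = j" for i j
    using assms(2) by (auto simp: arrangements_def arrange_def split: if_splits)
  have img: "\<sigma> ` three = three"
    using assms(2) by (auto simp: arrangements_def arrange_def three_def)
  let ?\<pi> = "\<lambda>(k, i). (k, \<sigma> i)"
  have "bij_betw ?\<pi> (points h) (points h)"
    unfolding bij_betw_def points_def
  proof
    show "inj_on ?\<pi> ({..h} \<times> three)" by (auto simp: inj_on_def inj)
    show "?\<pi> ` ({..h} \<times> three) = {..h} \<times> three" using img by force
  qed
  then have "peel (points h) (below w) n (?\<pi> ` (removed t R \<inter> points h)) (?\<pi> ` (usable t V0 V1 \<inter> points h))"
    using assms(1) unfolding s peels_def 
    by (intro peel_transfer[where lt = "below w"]) (auto simp: below_def joins_def inj)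
  then show ?thesis unfolding s peels_def renamed_def prod.case
    apply (rule peel_mono)
    subgoal by (auto simp: removed_def points_def inj)
    subgoal by (auto simp: removed_def points_def usable_def inj image_iff)
    done
qed

lemma nbrs_iff: "j \<in> nbrs c i \<longleftrightarrow> j \<in> three \<and> joins c i j"
  by (simp add: nbrs_def)

lemma joins_sym: "joins c i j \<longleftrightarrow> joins c j i"
  by (auto simp: joins_def)

lemma some_shortI:
  assumes A: "A \<subseteq> R"
    and m: "a \<in> A \<inter> V0 \<and> b \<in> (R - A) \<inter> V0
              \<and> \<Phi> ({i \<in> three. \<not> nbrs c i \<inter> R \<subseteq> A \<and> \<not> nbrs c i \<inter> R \<subseteq> R - A}, V1 \<inter> nbrs c a \<inter> nbrs c b, three)
         \<or> a \<in> A \<inter> V0 \<and> b \<in> three \<inter> V1 \<and> nbrs c b \<inter> R \<subseteq> R - A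
              \<and> \<Phi> ({i \<in> three. \<not> nbrs c i \<inter> R \<subseteq> A \<and> \<not> nbrs c i \<inter> R \<subseteq> R - A}, {}, nbrs d b)
         \<or> a \<in> three \<inter> V1 \<and> nbrs c a \<inter> R \<subseteq> A \<and> b \<in> three \<inter> V1 \<and> nbrs c b \<inter> R \<subseteq> R - A \<and> a \<noteq> b
              \<and> \<Phi> ({i \<in> three. \<not> nbrs c i \<inter> R \<subseteq> A \<and> \<not> nbrs c i \<inter> R \<subseteq> R - A}, {}, nbrs d a \<inter> nbrs d b)"
  shows "some_short c d (R, V0, V1) \<Phi>"
proof -
  have eq: "three - {i \<in> three. nbrs c i \<inter> R \<subseteq> A} - {i \<in> three. nbrs c i \<inter> R \<subseteq> R - A}
      = {i \<in> three. \<not> nbrs c i \<inter> R \<subseteq> A \<and> \<not> nbrs c i \<inter> R \<subseteq> R - A}" by auto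
  show ?thesis unfolding some_short_def prod.case Let_def
    apply (rule bexI[of _ A])
    subgoal unfolding eq using m by blast
    subgoal using A by blast
    done
qed

lemma some_shortE:
  assumes "some_short c d (R, V0, V1) \<Phi>"
  obtains A a b where "A \<subseteq> R"
    and "a \<in> A \<inter> V0 \<and> b \<in> (R - A) \<inter> V0
              \<and> \<Phi> ({i \<in> three. \<not> nbrs c i \<inter> R \<subseteq> A \<and> \<not> nbrs c i \<inter> R \<subseteq> R - A}, V1 \<inter> nbrs c a \<inter> nbrs c b, three)
         \<or> a \<in> A \<inter> V0 \<and> b \<in> three \<inter> V1 \<and> nbrs c b \<inter> R \<subseteq> R - A
              \<and> \<Phi> ({i \<in> three. \<not> nbrs c i \<inter> R \<subseteq> A \<and> \<not> nbrs c i \<inter> R \<subseteq> R - A}, {}, nbrs d b)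
         \<or> a \<in> three \<inter> V1 \<and> nbrs c a \<inter> R \<subseteq> A \<and> b \<in> three \<inter> V1 \<and> nbrs c b \<inter> R \<subseteq> R - A \<and> a \<noteq> b
              \<and> \<Phi> ({i \<in> three. \<not> nbrs c i \<inter> R \<subseteq> A \<and> \<not> nbrs c i \<inter> R \<subseteq> R - A}, {}, nbrs d a \<inter> nbrs d b)"
proof -
  have eq: "three - {i \<in> three. nbrs c i \<inter> R \<subseteq> A} - {i \<in> three. nbrs c i \<inter> R \<subseteq> R - A}
      = {i \<in> three. \<not> nbrs c i \<inter> R \<subseteq> A \<and> \<not> nbrs c i \<inter> R \<subseteq> R - A}" for A by auto
  from assms obtain A where A: "A \<subseteq> R" and
    "(\<exists>a\<in>A \<inter> V0. (\<exists>b\<in>(R - A) \<inter> V0. \<Phi> (three - {i \<in> three. nbrs c i \<inter> R \<subseteq> A} - {i \<in> three. nbrs c i \<inter> R \<subseteq> R - A}, V1 \<inter> nbrs c a \<inter> nbrs c b, three))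
        \<or> (\<exists>b\<in>{i \<in> three. nbrs c i \<inter> R \<subseteq> R - A} \<inter> V1. \<Phi> (three - {i \<in> three. nbrs c i \<inter> R \<subseteq> A} - {i \<in> three. nbrs c i \<inter> R \<subseteq> R - A}, {}, nbrs d b)))
      \<or> (\<exists>a\<in>{i \<in> three. nbrs c i \<inter> R \<subseteq> A} \<inter> V1. \<exists>b\<in>{i \<in> three. nbrs c i \<inter> R \<subseteq> R - A} \<inter> V1. a \<noteq> b
          \<and> \<Phi> (three - {i \<in> three. nbrs c i \<inter> R \<subseteq> A} - {i \<in> three. nbrs c i \<inter> R \<subseteq> R - A}, {}, nbrs d a \<inter> nbrs d b))"
    unfolding some_short_def prod.case Let_def by (elim bexE) (simp only: Pow_iff)
  then show thesis unfolding eq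
    by (elim disjE bexE conjE) (rule that[OF A], blast)+
qed

text \<open>
Points of level \<open>t + 1\<close> without neighbours in \<open>R\<close> could join either part.  They all go
to the part of \<open>a\<close>, except for \<open>b\<close> itself.
\<close>

lemma short_layer:
  assumes R: "R \<subseteq> three" and A: "A \<subseteq> R" and t: "Suc t \<le> h"
    and ab: "fst a = t \<and> snd a \<in> A \<and> snd a \<in> V0 \<or> fst a = Suc t \<and> snd a \<in> three \<inter> V1 \<and> nbrs (w t) (snd a) \<inter> R \<subseteq> A"
      "fst b = t \<and> snd b \<in> R - A \<and> snd b \<in> V0 \<or> fst b = Suc t \<and> snd b \<in> three \<inter> V1 \<and> nbrs (w t) (snd b) \<inter> R \<subseteq> R - A"
      "a \<noteq> b"
    and rest: "peels w h n (Suc t) ({i \<in> three. \<not> nbrs (w t) i \<inter> R \<subseteq> A \<and> \<not> nbrs (w t) i \<inter> R \<subseteq> R - A}, V0', V1')"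
    and V0': "\<And>i. i \<in> V0' \<Longrightarrow> i \<in> V1 \<and> below w a (Suc t, i) \<and> below w b (Suc t, i)"
    and V1': "\<And>i. i \<in> V1' \<Longrightarrow> below w a (t + 2, i) \<and> below w b (t + 2, i)"
  shows "peels w h (Suc n) t (R, V0, V1)"
proof -
  let ?X = "{(k, i). k = t \<and> i \<in> A \<or> k = Suc t \<and> i \<in> three \<and> nbrs (w t) i \<inter> R \<subseteq> A \<and> (Suc t, i) \<noteq> b}"
  let ?Y = "{(k, i). k = t \<and> i \<in> R - A
                 \<or> k = Suc t \<and> i \<in> three \<and> nbrs (w t) i \<inter> R \<subseteq> R - A \<and> (nbrs (w t) i \<inter> R \<noteq> {} \<or> (Suc t, i) = b)}"
  show ?thesis unfolding peels_def prod.case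
  proof (rule peel_SucI[of ?X ?Y _ _ a _ b])
    show "?X \<union> ?Y \<subseteq> points h - removed t R"
      using R A t by (auto simp: points_def removed_def)
    show "a \<in> ?X" "b \<in> ?Y" "a \<in> usable t V0 V1" "b \<in> usable t V0 V1"
      using ab by (cases a; cases b; auto simp: usable_def)+
    have nb: "joins (w t) l i \<longleftrightarrow> l \<in> nbrs (w t) i" if "l \<in> R" for l i
      using that R by (auto simp: nbrs_iff joins_sym)
    show "x \<noteq> y \<and> \<not> below w x y \<and> \<not> below w y x" if "x \<in> ?X" "y \<in> ?Y" for x y
    proof -
      obtain k i l j where "x = (k, i)" "y = (l, j)" by (cases x; cases y)
      then show ?thesis using that A nb[of i j] nb[of j i] by (auto simp: below_def)
    qed
    show "x \<in> removed t R \<union> ?X \<union> ?Y" if "y \<in> ?X \<union> ?Y" "x \<in> points h" "below w x y" for x y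
    proof -
      have "fst x < fst y" using that(3) by (auto simp: below_def)
      moreover have "fst y \<le> Suc t" using that(1) by auto
      ultimately have "fst x \<le> t" by linarith
      then show ?thesis using A by (cases x) (auto simp: removed_def)
    qed
    show "peel (points h) (below w) n (removed t R \<union> ?X \<union> ?Y) (usable t V0 V1 \<inter> {z. below w a z \<and> below w b z})"
    proof (rule peel_mono[OF rest[unfolded peels_def prod.case]], goal_cases)
      case 1
      show ?case
      proof
        fix x assume x: "x \<in> points h \<inter> removed (Suc t) {i \<in> three. \<not> nbrs (w t) i \<inter> R \<subseteq> A \<and> \<not> nbrs (w t) i \<inter> R \<subseteq> R - A}"
        obtain k i where ki: "x = (k, i)" by (cases x)
        have i3: "i \<in> three" using x by (simp add: ki points_def)
        have bi: "nbrs (w t) i \<inter> R \<subseteq> R - A" if "b = (Suc t, i)"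
          using ab(2) that by simp
        consider "k < t" | "k = t" | "k = Suc t" "nbrs (w t) i \<inter> R \<subseteq> A" "nbrs (w t) i \<inter> R = {} \<or> \<not> nbrs (w t) i \<inter> R \<subseteq> R - A"
            | "k = Suc t" "nbrs (w t) i \<inter> R \<subseteq> R - A" "nbrs (w t) i \<inter> R \<noteq> {}"
          using x i3 by (auto simp: ki removed_def less_Suc_eq)
        then show "x \<in> removed t R \<union> ?X \<union> ?Y"
        proof cases
          case 3
          then show ?thesis using i3 bi by (cases "b = (Suc t, i)") (auto simp: ki)
        qed (use i3 A in \<open>auto simp: ki removed_def\<close>)
      qed
    next
      case 2
      show ?case
      proof
        fix z assume "z \<in> points h \<inter> (usable (Suc t) V0' V1' -
              removed (Suc t) {i \<in> three. \<not> nbrs (w t) i \<inter> R \<subseteq> A \<and> \<not> nbrs (w t) i \<inter> R \<subseteq> R - A})"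
        moreover obtain k i where z: "z = (k, i)" by (cases z)
        moreover have "below w a (k, i) \<and> below w b (k, i)" if "t + 3 \<le> k"
          using ab that by (cases a; cases b) (auto simp: below_def)
        ultimately show "z \<in> usable t V0 V1 \<inter> {z. below w a z \<and> below w b z} - (removed t R \<union> ?X \<union> ?Y)"
          using V0'[of i] V1'[of i] by (auto simp: usable_def removed_def)
      qed
    qed
  qed
qed

lemma peels_short:
  assumes R: "R \<subseteq> three" and t: "Suc t \<le> h"
    and "some_short (w t) (w (Suc t)) (R, V0, V1) (peels w h n (Suc t))"
  shows "peels w h (Suc n) t (R, V0, V1)"
  using assms(3)
proof (rule some_shortE)
  fix A a b
  let ?R' = "{i \<in> three. \<not> nbrs (w t) i \<inter> R \<subseteq> A \<and> \<not> nbrs (w t) i \<inter> R \<subseteq> R - A}"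
  assume A: "A \<subseteq> R" and m:
    "a \<in> A \<inter> V0 \<and> b \<in> (R - A) \<inter> V0
       \<and> peels w h n (Suc t) (?R', V1 \<inter> nbrs (w t) a \<inter> nbrs (w t) b, three)
     \<or> a \<in> A \<inter> V0 \<and> b \<in> three \<inter> V1 \<and> nbrs (w t) b \<inter> R \<subseteq> R - A
       \<and> peels w h n (Suc t) (?R', {}, nbrs (w (Suc t)) b)
     \<or> a \<in> three \<inter> V1 \<and> nbrs (w t) a \<inter> R \<subseteq> A \<and> b \<in> three \<inter> V1 \<and> nbrs (w t) b \<inter> R \<subseteq> R - A \<and> a \<noteq> b
       \<and> peels w h n (Suc t) (?R', {}, nbrs (w (Suc t)) a \<inter> nbrs (w (Suc t)) b)"
  from m show ?thesis
  proof (elim disjE conjE)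
    assume "a \<in> A \<inter> V0" "b \<in> (R - A) \<inter> V0" "peels w h n (Suc t) (?R', V1 \<inter> nbrs (w t) a \<inter> nbrs (w t) b, three)"
    then show ?thesis
      by (intro short_layer[OF R A t, where a = "(t, a)" and b = "(t, b)"]) (auto simp: below_def nbrs_iff)
  next
    assume "a \<in> A \<inter> V0" "b \<in> three \<inter> V1" "nbrs (w t) b \<inter> R \<subseteq> R - A" "peels w h n (Suc t) (?R', {}, nbrs (w (Suc t)) b)"
    then show ?thesis
      by (intro short_layer[OF R A t, where a = "(t, a)" and b = "(Suc t, b)"]) (auto simp: below_def nbrs_iff)
  next
    assume "a \<in> three \<inter> V1" "nbrs (w t) a \<inter> R \<subseteq> A" "b \<in> three \<inter> V1" "nbrs (w t) b \<inter> R \<subseteq> R - A" "a \<noteq> b"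
      "peels w h n (Suc t) (?R', {}, nbrs (w (Suc t)) a \<inter> nbrs (w (Suc t)) b)"
    then show ?thesis
      by (intro short_layer[OF R A t, where a = "(Suc t, a)" and b = "(Suc t, b)"]) (auto simp: below_def nbrs_iff)
  qed
qed

lemma long_layer:
  assumes R: "R \<subseteq> three" "R \<noteq> {}" and t: "t + 2 \<le> h"
    and b: "b \<in> V1" "b \<in> three" "nbrs (w t) b \<inter> R = {}"
    and a: "fst a = t \<and> snd a \<in> R \<inter> V0 \<or> fst a = Suc t \<and> snd a \<in> V1 \<inter> three \<and> snd a \<noteq> b
            \<or> fst a = t + 2 \<and> snd a \<in> three - nbrs (w (Suc t)) b"
    and rest: "peels w h n (t + 2) (nbrs (w (Suc t)) b, V0', V1')"
    and V0': "\<And>i. i \<in> V0' \<Longrightarrow> below w a (t + 2, i) \<and> i \<in> nbrs (w (Suc t)) b"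
    and V1': "\<And>i. i \<in> V1' \<Longrightarrow> below w a (t + 3, i)"
  shows "peels w h (Suc n) t (R, V0, V1)"
proof -
  let ?X = "{(k, i). k = t \<and> i \<in> R \<or> k = Suc t \<and> i \<in> three \<and> i \<noteq> b \<or> k = t + 2 \<and> i \<in> three - nbrs (w (Suc t)) b}"
  let ?Y = "{(Suc t, b)}"
  show ?thesis unfolding peels_def prod.case
  proof (rule peel_SucI[of ?X ?Y _ _ a _ "(Suc t, b)"])
    show "?X \<union> ?Y \<subseteq> points h - removed t R"
      using R t b by (auto simp: points_def removed_def)
    show "a \<in> ?X" "a \<in> usable t V0 V1"
      using a by (cases a; auto simp: usable_def)+
    show "(Suc t, b) \<in> ?Y" "(Suc t, b) \<in> usable t V0 V1" using b by (auto simp: usable_def)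
    show "x \<noteq> y \<and> \<not> below w x y \<and> \<not> below w y x" if "x \<in> ?X" "y \<in> ?Y" for x y
    proof -
      obtain k i where x: "x = (k, i)" by (cases x)
      have "joins (w t) i b \<longleftrightarrow> i \<in> nbrs (w t) b" if "i \<in> R"
        using that R by (auto simp: nbrs_iff joins_sym)
      then show ?thesis using that b by (auto simp: x below_def nbrs_iff)
    qed
    show "x \<in> removed t R \<union> ?X \<union> ?Y" if "y \<in> ?X \<union> ?Y" "x \<in> points h" "below w x y" for x y
    proof -
      have "snd x \<in> three" using that(2) by (auto simp: points_def)
      moreover have "fst x < fst y" using that(3) by (auto simp: below_def)
      moreover have "fst y \<le> t + 2" using that(1) by auto
      ultimately have "snd x \<in> three" "fst x \<le> Suc t" by linarith+
      then show ?thesis by (cases x) (auto simp: removed_def)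
    qed
    show "peel (points h) (below w) n (removed t R \<union> ?X \<union> ?Y) (usable t V0 V1 \<inter> {z. below w a z \<and> below w (Suc t, b) z})"
    proof (rule peel_mono[OF rest[unfolded peels_def prod.case]], goal_cases)
      case 1
      then show ?case by (auto simp: points_def removed_def)
    next
      case 2
      show ?case
      proof
        fix z assume "z \<in> points h \<inter> (usable (t + 2) V0' V1' - removed (t + 2) (nbrs (w (Suc t)) b))"
        moreover obtain k i where z: "z = (k, i)" by (cases z)
        moreover have "below w a (k, i)" if "t + 4 \<le> k"
          using a that by (cases a) (auto simp: below_def)
        ultimately show "z \<in> usable t V0 V1 \<inter> {z. below w a z \<and> below w (Suc t, b) z} - (removed t R \<union> ?X \<union> ?Y)"
          using V0'[of i] V1'[of i] by (auto simp: usable_def removed_def below_def nbrs_iff numeral_3_eq_3)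
      qed
    qed
  qed
qed

lemma peels_long:
  assumes R: "R \<subseteq> three" "R \<noteq> {}" and t: "t + 2 \<le> h" and V1: "V1 \<subseteq> three"
    and "some_long (w t) (w (Suc t)) (w (t + 2)) (R, V0, V1) (peels w h n (t + 2))"
  shows "peels w h (Suc n) t (R, V0, V1)"
proof -
  from assms(5) obtain b where b: "b \<in> V1" "nbrs (w t) b \<inter> R = {}" and
   m: "R \<inter> V0 \<noteq> {} \<and> peels w h n (t + 2) (nbrs (w (Suc t)) b, nbrs (w (Suc t)) b, three)
      \<or> (\<exists>a\<in>V1. a \<noteq> b \<and> peels w h n (t + 2) (nbrs (w (Suc t)) b, nbrs (w (Suc t)) b \<inter> nbrs (w (Suc t)) a, three))
      \<or> (\<exists>a\<in>three - nbrs (w (Suc t)) b. peels w h n (t + 2) (nbrs (w (Suc t)) b, {}, nbrs (w (t + 2)) a))"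
    unfolding some_long_def by auto
  have b3: "b \<in> three" using b V1 by auto
  note L = long_layer[where w = w, OF R t b(1) b3 b(2)]
  from m show ?thesis
  proof (elim disjE conjE bexE)
    assume *: "R \<inter> V0 \<noteq> {}" and **: "peels w h n (t + 2) (nbrs (w (Suc t)) b, nbrs (w (Suc t)) b, three)"
    from * obtain a where "a \<in> R \<inter> V0" by blast
    then show ?thesis
      by (intro L[of "(t, a)", OF _ **]) (auto simp: below_def)
  next
    fix a assume "a \<in> V1" "a \<noteq> b" and **: "peels w h n (t + 2) (nbrs (w (Suc t)) b, nbrs (w (Suc t)) b \<inter> nbrs (w (Suc t)) a, three)"
    then show ?thesis using V1
      by (intro L[of "(Suc t, a)", OF _ **]) (auto simp: below_def nbrs_iff)
  next
    fix a assume "a \<in> three - nbrs (w (Suc t)) b" and **: "peels w h n (t + 2) (nbrs (w (Suc t)) b, {}, nbrs (w (t + 2)) a)"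
    then show ?thesis
      by (intro L[of "(t + 2, a)", OF _ **]) (auto simp: below_def nbrs_iff)
  qed
qed

lemma some_short_swap:
  assumes "A \<subseteq> R" "a \<in> three \<inter> V1" "nbrs c a \<inter> R \<subseteq> A" "b \<in> (R - A) \<inter> V0"
    and "\<Phi> ({i \<in> three. \<not> nbrs c i \<inter> R \<subseteq> A \<and> \<not> nbrs c i \<inter> R \<subseteq> R - A}, {}, nbrs d a)"
  shows "some_short c d (R, V0, V1) \<Phi>"
proof -
  have eq: "R - (R - A) = A" using assms(1) by blast
  show ?thesis
    by (rule some_shortI[of "R - A" _ b _ a]) (use assms in \<open>auto simp: eq conj_commute\<close>)
qed

text \<open>
The case of a layer with a point \<open>z\<close> two levels up.  All of \<open>R\<close> is below \<open>z\<close> and thus in the same part \<open>X\<close>.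
A point of the other part \<open>Y\<close> is comparable neither to \<open>R\<close> nor to \<open>z\<close>, which confines it to level \<open>t + 1\<close>;
and this in turn keeps \<open>X\<close> within levels \<open>t\<close> to \<open>t + 2\<close>.  The layer is then contained in that of a long move.
\<close>

lemma high_layer:
  assumes L: "layer (points h) (below w) (removed t R) (usable t V0 V1) X Y a b"
    and rest: "peel (points h) (below w) n (removed t R \<union> X \<union> Y)
                 (usable t V0 V1 \<inter> {z. below w a z \<and> below w b z})"
    and R: "R \<subseteq> three" "R \<noteq> {}" and V: "V0 \<subseteq> R" "V1 \<subseteq> three"
    and z: "z \<in> X" "t + 2 \<le> fst z"
  shows "t + 2 \<le> h \<and> some_long (w t) (w (Suc t)) (w (t + 2)) (R, V0, V1) (peels w h n (t + 2))"
proof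
  note XY = layerD(1)[OF L] and a = layerD(2,3)[OF L] and b = layerD(4,5)[OF L]
    and sep = layerD(6)[OF L] and down = layerD(7)[OF L]
  show th: "t + 2 \<le> h" using z XY by (auto simp: points_def)
  have RX: "(t, r) \<in> X" if "r \<in> R" for r
  proof -
    have *: "below w (t, r) z" using z by (simp add: below_def)
    have "(t, r) \<in> removed t R \<union> X \<union> Y"
      using down[of z "(t, r)"] * z that R th by (auto simp: points_def)
    then show ?thesis using that sep[OF z(1), of "(t, r)"] * by (auto simp: removed_def)
  qed
  obtain r where r: "r \<in> R" using R by blast
  have lev: "t \<le> fst x \<and> fst x \<le> h \<and> snd x \<in> three \<and> (fst x = t \<longrightarrow> snd x \<in> R)" if "x \<in> X \<union> Y" for x
    using XY that by (cases x) (auto simp: points_def removed_def)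
  have Y1: "fst y = Suc t" if "y \<in> Y" for y
  proof -
    have "fst y \<noteq> t" using sep[OF z(1) that] z by (auto simp: below_def)
    moreover have "\<not> t + 2 \<le> fst y" using sep[OF RX[OF r] that] by (auto simp: below_def)
    ultimately show ?thesis using lev[of y] that by auto
  qed
  obtain j where j: "b = (Suc t, j)" using Y1[OF b(1)] by (cases b) auto
  have j1: "j \<in> V1" "j \<in> three" using b V by (auto simp: j usable_def)
  have nb: "joins (w t) l j \<longleftrightarrow> l \<in> nbrs (w t) j" if "l \<in> R" for l
    using that R by (auto simp: nbrs_iff joins_sym)
  have free: "nbrs (w t) j \<inter> R = {}"
  proof (rule ccontr)
    assume "\<not> ?thesis"
    then obtain l where "l \<in> R" "joins (w t) l j" using nb by blast
    then show False using sep[OF RX b(1), of l] by (simp add: j below_def)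
  qed
  have X2: "fst x \<le> t + 2 \<and> (fst x = t + 2 \<longrightarrow> snd x \<in> three - nbrs (w (Suc t)) j)" if "x \<in> X" for x
    using sep[OF that b(1)] lev[of x] that by (cases x) (auto simp: j below_def nbrs_iff)
  let ?N = "nbrs (w (Suc t)) j"
  have gone: "removed t R \<union> X \<union> Y \<subseteq> removed (t + 2) ?N"
  proof
    fix x assume "x \<in> removed t R \<union> X \<union> Y"
    then show "x \<in> removed (t + 2) ?N" using X2[of x] Y1[of x] by (cases x) (auto simp: removed_def)
  qed
  have step: "peels w h n (t + 2) (?N, V0', V1')"
    if *: "\<And>i. i \<in> ?N \<Longrightarrow> below w a (t + 2, i) \<Longrightarrow> i \<in> V0'" "\<And>i. i \<in> three \<Longrightarrow> below w a (t + 3, i) \<Longrightarrow> i \<in> V1'" for V0' V1'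
    unfolding peels_def prod.case
  proof (rule peel_mono[OF rest])
    show "points h \<inter> (removed t R \<union> X \<union> Y) \<subseteq> removed (t + 2) ?N" using gone by blast
    show "points h \<inter> (usable t V0 V1 \<inter> {z. below w a z \<and> below w b z} - (removed t R \<union> X \<union> Y))
        \<subseteq> usable (t + 2) V0' V1' - removed (t + 2) ?N"
    proof
      fix x assume x: "x \<in> points h \<inter> (usable t V0 V1 \<inter> {z. below w a z \<and> below w b z} - (removed t R \<union> X \<union> Y))"
      obtain k i where ki: "x = (k, i)" by (cases x)
      have k: "t + 2 \<le> k" "k = t + 2 \<Longrightarrow> i \<in> ?N" "i \<in> three"
        using x by (auto simp: ki j below_def points_def nbrs_iff)
      have "k = t + 2 \<or> k = t + 3 \<or> t + 4 \<le> k" using k(1) by linarith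
      then show "x \<in> usable (t + 2) V0' V1' - removed (t + 2) ?N"
        using x k *[of i] by (auto simp: ki usable_def removed_def numeral_3_eq_3)
    qed
  qed
  have "R \<inter> V0 \<noteq> {} \<and> peels w h n (t + 2) (?N, ?N, three)
      \<or> (\<exists>a\<in>V1. a \<noteq> j \<and> peels w h n (t + 2) (?N, ?N \<inter> nbrs (w (Suc t)) a, three))
      \<or> (\<exists>a\<in>three - ?N. peels w h n (t + 2) (?N, {}, nbrs (w (t + 2)) a))"
  proof -
    obtain k i where ki: "a = (k, i)" by (cases a)
    have "k \<le> t + 2" "t \<le> k" using X2[OF a(1)] lev[of a] a by (auto simp: ki)
    then consider "k = t" | "k = Suc t" | "k = t + 2" by linarith
    then show ?thesis
    proof cases
      case 1
      then have "i \<in> R \<inter> V0" using a V by (auto simp: ki usable_def)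
      moreover have "peels w h n (t + 2) (?N, ?N, three)" by (rule step) auto
      ultimately show ?thesis by blast
    next
      case 2
      then have "i \<in> V1" "i \<noteq> j" using a sep[OF a(1) b(1)] by (auto simp: ki j usable_def)
      moreover have "peels w h n (t + 2) (?N, ?N \<inter> nbrs (w (Suc t)) i, three)"
        by (rule step) (auto simp: ki 2 below_def nbrs_iff)
      ultimately show ?thesis by blast
    next
      case 3
      then have "i \<in> three - ?N" using X2[OF a(1)] by (simp add: ki)
      moreover have "peels w h n (t + 2) (?N, {}, nbrs (w (t + 2)) i)"
        by (rule step) (auto simp: ki 3 below_def nbrs_iff)
      ultimately show ?thesis by blast
    qed
  qed
  then show "some_long (w t) (w (Suc t)) (w (t + 2)) (R, V0, V1) (peels w h n (t + 2))"
    unfolding some_long_def prod.case using j1(1) free by (intro bexI[of _ j] conjI)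
qed

text \<open>
The case of a layer within levels \<open>t\<close> and \<open>t + 1\<close>.  Points of \<open>R\<close> outside of the layer are below none of its points,
so they may be added to the part \<open>X\<close>, and what results is contained in the layer of a short move.
\<close>

lemma low_layer:
  assumes L: "layer (points h) (below w) (removed t R) (usable t V0 V1) X Y a b"
    and rest: "peel (points h) (below w) n (removed t R \<union> X \<union> Y)
                 (usable t V0 V1 \<inter> {z. below w a z \<and> below w b z})"
    and R: "R \<subseteq> three" and V: "V0 \<subseteq> R" "V1 \<subseteq> three" and t: "Suc t \<le> h"
    and low: "\<And>z. z \<in> X \<union> Y \<Longrightarrow> fst z \<le> Suc t"
  shows "some_short (w t) (w (Suc t)) (R, V0, V1) (peels w h n (Suc t))"
proof -
  note XY = layerD(1)[OF L] and a = layerD(2,3)[OF L] and b = layerD(4,5)[OF L]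
    and sep = layerD(6)[OF L] and down = layerD(7)[OF L]
  define A where "A = {i \<in> R. (t, i) \<notin> Y}"
  have A: "A \<subseteq> R" by (auto simp: A_def)
  have lev: "(fst x = t \<or> fst x = Suc t) \<and> snd x \<in> three \<and> (fst x = t \<longrightarrow> snd x \<in> R)" if "x \<in> X \<union> Y" for x
    using XY that low[of x] by (cases x) (auto simp: points_def removed_def)
  have nb: "(t, l) \<in> X \<union> Y \<and> below w (t, l) (Suc t, i)" if "l \<in> nbrs (w t) i \<inter> R" "(Suc t, i) \<in> X \<union> Y" for l i
  proof -
    have "below w (t, l) (Suc t, i)" using that joins_sym[of "w t" l i] by (simp add: below_def nbrs_iff)
    moreover have "(t, l) \<in> points h" using that R t by (auto simp: points_def)
    ultimately show ?thesis using down[OF that(2)] that by (auto simp: removed_def)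
  qed
  have nbX: "nbrs (w t) i \<inter> R \<subseteq> A" if "(Suc t, i) \<in> X" for i
  proof
    fix l assume "l \<in> nbrs (w t) i \<inter> R"
    then show "l \<in> A" using nb[of l i] sep[OF that, of "(t, l)"] that by (simp add: A_def) blast
  qed
  have nbY: "nbrs (w t) i \<inter> R \<subseteq> R - A" if "(Suc t, i) \<in> Y" for i
  proof
    fix l assume "l \<in> nbrs (w t) i \<inter> R"
    then show "l \<in> R - A" using nb[of l i] sep[OF _ that, of "(t, l)"] that by (simp add: A_def) blast
  qed
  let ?R' = "{i \<in> three. \<not> nbrs (w t) i \<inter> R \<subseteq> A \<and> \<not> nbrs (w t) i \<inter> R \<subseteq> R - A}"
  have AX: "snd x \<in> A" if "x \<in> X" "fst x = t" for x
    using that lev[of x] sep[OF that(1), of x] by (cases x) (auto simp: A_def)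
  have AY: "snd y \<in> R - A" if "y \<in> Y" "fst y = t" for y
    using that lev[of y] by (cases y) (auto simp: A_def)
  have step: "peels w h n (Suc t) (?R', V0', V1')"
    if *: "\<And>i. i \<in> V1 \<Longrightarrow> below w a (Suc t, i) \<Longrightarrow> below w b (Suc t, i) \<Longrightarrow> i \<in> V0'"
          "\<And>i. i \<in> three \<Longrightarrow> below w a (t + 2, i) \<Longrightarrow> below w b (t + 2, i) \<Longrightarrow> i \<in> V1'" for V0' V1'
    unfolding peels_def prod.case
  proof (rule peel_mono[OF rest])
    show "points h \<inter> (removed t R \<union> X \<union> Y) \<subseteq> removed (Suc t) ?R'"
    proof
      fix x assume "x \<in> points h \<inter> (removed t R \<union> X \<union> Y)"
      then show "x \<in> removed (Suc t) ?R'"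
        using lev[of x] nbX[of "snd x"] nbY[of "snd x"] by (cases x) (auto simp: removed_def)
    qed
    show "points h \<inter> (usable t V0 V1 \<inter> {z. below w a z \<and> below w b z} - (removed t R \<union> X \<union> Y))
        \<subseteq> usable (Suc t) V0' V1' - removed (Suc t) ?R'"
    proof
      fix x assume x: "x \<in> points h \<inter> (usable t V0 V1 \<inter> {z. below w a z \<and> below w b z} - (removed t R \<union> X \<union> Y))"
      obtain k i where ki: "x = (k, i)" by (cases x)
      have i3: "i \<in> three" using x by (simp add: ki points_def)
      have bel: "below w a (k, i)" "below w b (k, i)" using x by (simp_all add: ki)
      have la: "fst a = t \<or> fst a = Suc t" "fst b = t \<or> fst b = Suc t" using lev a b by blast+
      have k: "t < k" using bel(1) la(1) by (auto simp: below_def)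
      have "i \<in> ?R'" if "k = Suc t"
      proof -
        have "fst a < k" "fst b < k" using bel by (auto simp: below_def)
        then have lt: "fst a = t" "fst b = t" using la that by linarith+
        have jn: "joins (w t) (snd a) i" "joins (w t) (snd b) i"
          using bel lt by (simp_all add: below_def that)
        from lt jn have "snd a \<in> nbrs (w t) i" "snd a \<in> A" "snd b \<in> nbrs (w t) i" "snd b \<in> R - A"
          using R AX[OF a(1)] AY[OF b(1)] joins_sym[of "w t" "snd a" i] joins_sym[of "w t" "snd b" i] A
          by (auto simp: nbrs_iff)
        then show ?thesis using i3 A by blast
      qed
      moreover have "k = Suc t \<or> k = t + 2 \<or> t + 3 \<le> k" using k by linarith
      moreover have "i \<in> V1" if "k = Suc t" using x that by (simp add: ki usable_def)
      ultimately show "x \<in> usable (Suc t) V0' V1' - removed (Suc t) ?R'"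
        using i3 bel *[of i] by (auto simp: ki usable_def removed_def)
    qed
  qed
  obtain ka i kb j where ij: "a = (ka, i)" "b = (kb, j)" by (cases a; cases b)
  have i: "ka = t \<Longrightarrow> i \<in> A \<inter> V0" "ka \<noteq> t \<Longrightarrow> ka = Suc t \<and> i \<in> three \<inter> V1 \<and> nbrs (w t) i \<inter> R \<subseteq> A"
    using a lev[of a] AX[OF a(1)] nbX[of i] ij V by (auto simp: usable_def)
  have j: "kb = t \<Longrightarrow> j \<in> (R - A) \<inter> V0" "kb \<noteq> t \<Longrightarrow> kb = Suc t \<and> j \<in> three \<inter> V1 \<and> nbrs (w t) j \<inter> R \<subseteq> R - A"
    using b lev[of b] AY[OF b(1)] nbY[of j] ij V by (auto simp: usable_def)
  consider "ka = t" "kb = t" | "ka = t" "kb \<noteq> t" | "ka \<noteq> t" "kb = t" | "ka \<noteq> t" "kb \<noteq> t"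
    by blast
  then show ?thesis
  proof cases
    case 1
    have "peels w h n (Suc t) (?R', V1 \<inter> nbrs (w t) i \<inter> nbrs (w t) j, three)"
      by (rule step) (use 1 ij V in \<open>auto simp: below_def nbrs_iff\<close>)
    then show ?thesis using i(1) j(1) 1 by (intro some_shortI[OF A, of i _ j]) simp
  next
    case 2
    have "peels w h n (Suc t) (?R', {}, nbrs (w (Suc t)) j)"
      by (rule step) (use 2 ij j(2) in \<open>auto simp: below_def nbrs_iff\<close>)
    then show ?thesis using i(1) j(2) 2 by (intro some_shortI[OF A, of i _ j]) simp
  next
    case 3
    have "peels w h n (Suc t) (?R', {}, nbrs (w (Suc t)) i)"
      by (rule step) (use 3 ij i(2) in \<open>auto simp: below_def nbrs_iff\<close>)
    then show ?thesis using i(2) j(1) 3 by (intro some_short_swap[OF A, of i _ _ j]) simp_all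
  next
    case 4
    have "peels w h n (Suc t) (?R', {}, nbrs (w (Suc t)) i \<inter> nbrs (w (Suc t)) j)"
      by (rule step) (use 4 ij i(2) j(2) in \<open>auto simp: below_def nbrs_iff\<close>)
    moreover have "i \<noteq> j" using 4 i(2) j(2) ij sep[OF a(1) b(1)] by auto
    ultimately show ?thesis using i(2) j(2) 4 by (intro some_shortI[OF A, of i _ j]) simp
  qed
qed

lemma peels_cases:
  assumes p: "peels w h (Suc n) t (R, V0, V1)" and R: "R \<subseteq> three" "R \<noteq> {}"
    and V: "V0 \<subseteq> R" "V1 \<subseteq> three" and t: "Suc t \<le> h"
  shows "some_short (w t) (w (Suc t)) (R, V0, V1) (peels w h n (Suc t))
     \<or> t + 2 \<le> h \<and> some_long (w t) (w (Suc t)) (w (t + 2)) (R, V0, V1) (peels w h n (t + 2))"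
proof -
  from p obtain X Y a b where L: "layer (points h) (below w) (removed t R) (usable t V0 V1) X Y a b"
    and rest: "peel (points h) (below w) n (removed t R \<union> X \<union> Y) (usable t V0 V1 \<inter> {z. below w a z \<and> below w b z})"
    by (auto simp only: peels_def prod.case peel.simps)
  have rest': "peel (points h) (below w) n (removed t R \<union> Y \<union> X) (usable t V0 V1 \<inter> {z. below w b z \<and> below w a z})"
  proof -
    have "removed t R \<union> Y \<union> X = removed t R \<union> X \<union> Y"
      "{z. below w b z \<and> below w a z} = {z. below w a z \<and> below w b z}" by blast+
    then show ?thesis using rest by simp
  qed
  show ?thesis
  proof (cases "\<exists>z\<in>X \<union> Y. t + 2 \<le> fst z")
    case True
    then show ?thesis
      using high_layer[OF L rest R V] high_layer[OF layer_swap[OF L] rest' R V] by blast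
  next
    case False
    then have "fst z \<le> Suc t" if "z \<in> X \<union> Y" for z using that by force
    then show ?thesis using low_layer[OF L rest R(1) V t] by blast
  qed
qed

section \<open>The automaton\<close>

text \<open>
The states that remain after identifying states up to a permutation of the columns and keeping
only the dominating ones.  The first half of a name tells how much of the lowest level is left, the
second half which restrictions hold for later pairs: none of the points left on the lowest level can be
used in the last four states, and of the next level the last three admit only what is above a given
point, or above two of them.
\<close>

datatype phase = Fresh | Two | TwoHalf | One | OneBarred | OneAbove | TwoAbove | OneAboveBoth

text \<open>
The letter \<open>c\<close> is the next one to be read: in the last three states it determines which points of the next
level lie above the given points of the level at hand.
\<close>

fun state_of :: "phase \<Rightarrow> bool \<Rightarrow> state" where
  "state_of Fresh c = (three, three, three)"
| "state_of Two c = ({0, 1}, {0, 1}, three)"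
| "state_of TwoHalf c = ({0, 1}, {0}, three)"
| "state_of One c = ({0}, {0}, three)"
| "state_of OneBarred c = ({0}, {}, three)"
| "state_of OneAbove c = ({0}, {}, nbrs c 1)"
| "state_of TwoAbove c = ({0, 1}, {}, nbrs c 2)"
| "state_of OneAboveBoth c = ({0}, {}, nbrs c 1 \<inter> nbrs c 2)"

text \<open>
Transitions by a short move that does not finish the next level; they read one letter.
\<close>

fun next1 :: "phase \<Rightarrow> bool \<Rightarrow> phase list" where
  "next1 Fresh c = (if c then [TwoHalf] else [])"
| "next1 TwoHalf c = (if c then [OneAbove] else [])"
| "next1 Two c = (if c then [One] else [])"
| "next1 TwoAbove c = (if c then [OneAboveBoth] else [])"
| "next1 _ c = []"

text \<open>
Transitions that read two letters: long moves, and short moves that take the whole of the next level.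
\<close>

fun next2 :: "phase \<Rightarrow> bool \<Rightarrow> bool \<Rightarrow> phase list" where
  "next2 Fresh c d = (if c then [] else [Fresh])"
| "next2 TwoHalf c d = (if c then [] else [if d then Two else One])"
| "next2 Two c d = (if c then [] else [if d then Two else One, Fresh])"
| "next2 TwoAbove c d = (if c then [] else [if d then TwoAbove else OneAbove])"
| "next2 One c d = [if d then Two else One]"
| "next2 OneBarred c d = [if d then TwoHalf else OneBarred]"
| "next2 OneAbove c d =
     [if c then if d then TwoHalf else OneBarred else if d then TwoAbove else OneAbove]"
| "next2 OneAboveBoth c d = (if c then [if d then TwoAbove else OneAbove] else [])"

text \<open>
The exceptional case of one last letter arises because a transition of two letters would
lead beyond the top level.
\<close>

fun accepts :: "phase \<Rightarrow> bool list \<Rightarrow> bool" where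
  "accepts S [] \<longleftrightarrow> S \<in> {Fresh, Two}"
| "accepts S [c] \<longleftrightarrow>
     (if c then S \<in> {One, OneBarred, OneAbove} else S \<in> {Fresh, Two, TwoHalf, One, OneBarred})"
| "accepts S (c # d # w) \<longleftrightarrow>
     (\<exists>S'\<in>set (next1 S c). accepts S' (d # w)) \<or> (\<exists>S'\<in>set (next2 S c d). accepts S' w)"

definition phases :: "phase list" where
  "phases = [Fresh, Two, TwoHalf, One, OneBarred, OneAbove, TwoAbove, OneAboveBoth]"

text \<open>
No loss is incurred by replacing the state \<open>m\<close> by one of the phases in \<open>Ss\<close>.
\<close>

definition reduces :: "phase list \<Rightarrow> bool \<Rightarrow> state \<Rightarrow> bool" where
  "reduces Ss c m \<longleftrightarrow> (\<exists>S\<in>set Ss. \<exists>\<sigma>\<in>set arrangements. covers (state_of S c) (renamed \<sigma> m))"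

text \<open>
Conversely, \<open>m\<close> is at least as good as the phase \<open>S\<close>.
\<close>

definition serves :: "state \<Rightarrow> phase \<Rightarrow> bool \<Rightarrow> bool" where
  "serves m S c \<longleftrightarrow> (\<exists>\<sigma>\<in>set arrangements. covers m (renamed \<sigma> (state_of S c)))"

text \<open>
Every move from one of the eight states leads to a state dominated by one to which the automaton passes.
A short move that leaves nothing of level \<open>t + 1\<close> ends with all of level \<open>t + 2\<close>.  The letters are
those above the levels \<open>t\<close>, \<open>t + 1\<close> and \<open>t + 2\<close>.
\<close>

lemma moves_reduce:
  "\<forall>S\<in>set phases. \<forall>c\<in>{True, False}. \<forall>d\<in>{True, False}. \<forall>e\<in>{True, False}.
     \<not> some_short c d (state_of S c) (\<lambda>(R, V0, V1).
        \<not> (if R = {} then reduces (next2 S c d) e (three, V1, three)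
           else reduces (next1 S c) d (R, V0, V1)))
   \<and> \<not> some_long c d e (state_of S c) (\<lambda>m. \<not> reduces (next2 S c d) e m)"
  by code_simp

text \<open>
This direction provides the retractions: the automaton makes no transition that is not achieved by a move.
\<close>

lemma moves_serve:
  "\<forall>S\<in>set phases. \<forall>c\<in>{True, False}. \<forall>d\<in>{True, False}. \<forall>e\<in>{True, False}.
     (\<forall>S'\<in>set (next1 S c). some_short c d (state_of S c) (\<lambda>m. serves m S' d))
   \<and> (\<forall>S'\<in>set (next2 S c d).
        some_short c d (state_of S c) (\<lambda>(R, V0, V1). R = {} \<and> serves (three, V1, three) S' e)
      \<or> some_long c d e (state_of S c) (\<lambda>m. serves m S' e))"
  by code_simp

text \<open>
At the last but one level there are only short moves, and they have to leave either nothing or two points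
of the top level as the last pair.
\<close>

lemma last_moves:
  "\<forall>S\<in>set phases. \<forall>c\<in>{True, False}. \<forall>d\<in>{True, False}.
     some_short c d (state_of S c)
       (\<lambda>(R, V0, V1). R = {} \<or> (\<exists>a\<in>R \<inter> V0. \<exists>b\<in>R \<inter> V0. a \<noteq> b)) \<longleftrightarrow> accepts S [c]"
  by code_simp

lemma some_short_conj:
  "some_short c d s \<Phi> \<Longrightarrow> \<not> some_short c d s (\<lambda>m. \<not> \<Psi> m) \<Longrightarrow> some_short c d s (\<lambda>m. \<Phi> m \<and> \<Psi> m)"
  unfolding some_short_def Let_def by (cases s) (simp only: prod.case, blast)

lemma some_long_conj:
  "some_long c d e s \<Phi> \<Longrightarrow> \<not> some_long c d e s (\<lambda>m. \<not> \<Psi> m) \<Longrightarrow> some_long c d e s (\<lambda>m. \<Phi> m \<and> \<Psi> m)"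
  unfolding some_long_def by (cases s) (simp only: prod.case, blast)

lemma some_short_mono:
  assumes "some_short c d s \<Phi>"
    and step: "\<And>R V0 V1. R \<subseteq> three \<Longrightarrow> \<Phi> (R, V0, V1) \<Longrightarrow> \<Psi> (R, V0, V1)"
  shows "some_short c d s \<Psi>"
proof -
  obtain R V0 V1 where s: "s = (R, V0, V1)" by (cases s)
  from assms(1) show ?thesis unfolding s
  proof (rule some_shortE, goal_cases)
    case (1 A a b)
    have sub: "{i \<in> three. \<not> nbrs c i \<inter> R \<subseteq> A \<and> \<not> nbrs c i \<inter> R \<subseteq> R - A} \<subseteq> three" by blast
    show ?case
      by (rule some_shortI[OF 1(1), of a _ b], insert 1(2))
        (elim disj_forward conj_forward; (assumption | erule step[OF sub]))
  qed
qed

lemma some_short_ex: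
  assumes "some_short c d s (\<lambda>m. \<exists>n. \<Phi> n m)"
  shows "\<exists>n. some_short c d s (\<Phi> n)"
proof -
  obtain R V0 V1 where s: "s = (R, V0, V1)" by (cases s)
  from assms show ?thesis unfolding s
  proof (rule some_shortE, goal_cases)
    case (1 A a b)
    from 1(2) show ?case
      by (elim disjE conjE exE) (rule exI, rule some_shortI[OF 1(1), of a _ b], blast)+
  qed
qed

lemma some_long_mono:
  "some_long c d e s \<Phi> \<Longrightarrow> (\<And>m. \<Phi> m \<Longrightarrow> \<Psi> m) \<Longrightarrow> some_long c d e s \<Psi>"
  unfolding some_long_def by (cases s) (simp only: prod.case, blast)

lemma some_shortD:
  assumes "some_short c d s \<Phi>"
  shows "\<exists>R V0 V1. \<Phi> (R, V0, V1)"
proof -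
  obtain R V0 V1 where s: "s = (R, V0, V1)" by (cases s)
  from assms show ?thesis unfolding s
    by (rule some_shortE) (elim disjE conjE; intro exI; assumption)
qed

lemma some_longD: "some_long c d e s \<Phi> \<Longrightarrow> \<exists>m. \<Phi> m"
  unfolding some_long_def by (cases s) (simp only: prod.case, elim bexE conjE disjE; intro exI; assumption)

lemma peels_next_level:
  "peels w h n (Suc t) ({}, V0, V1) \<longleftrightarrow> peels w h n (t + 2) (three, V1, three)"
proof -
  have "points h \<inter> removed (Suc t) {} = points h \<inter> removed (t + 2) three"
    "points h \<inter> (usable (Suc t) V0 V1 - removed (Suc t) {}) = points h \<inter> (usable (t + 2) V1 three - removed (t + 2) three)"
    by (auto simp: points_def removed_def usable_def)
  then show ?thesis
    unfolding peels_def prod.case by (intro iffI; elim peel_mono) blast+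
qed

lemma phases: "S \<in> set phases"
  by (cases S) (auto simp: phases_def)

lemma bool_values: "c \<in> {True, False}"
  by (cases c) auto

lemma moves_reduceD:
  "\<not> some_short c d (state_of S c) (\<lambda>(R, V0, V1).
      \<not> (if R = {} then reduces (next2 S c d) e (three, V1, three) else reduces (next1 S c) d (R, V0, V1)))"
  "\<not> some_long c d e (state_of S c) (\<lambda>m. \<not> reduces (next2 S c d) e m)"
  using moves_reduce[rule_format, OF phases bool_values bool_values bool_values] by blast+

lemma moves_serveD:
  "S' \<in> set (next1 S c) \<Longrightarrow> some_short c d (state_of S c) (\<lambda>m. serves m S' d)"
  "S' \<in> set (next2 S c d) \<Longrightarrow>
      some_short c d (state_of S c) (\<lambda>(R, V0, V1). R = {} \<and> serves (three, V1, three) S' e)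
    \<or> some_long c d e (state_of S c) (\<lambda>m. serves m S' e)"
  using moves_serve[rule_format, OF phases bool_values bool_values bool_values] by blast+

lemma last_movesD:
  "some_short c d (state_of S c) (\<lambda>(R, V0, V1). R = {} \<or> (\<exists>a\<in>R \<inter> V0. \<exists>b\<in>R \<inter> V0. a \<noteq> b))
     \<longleftrightarrow> accepts S [c]"
  by (rule last_moves[rule_format, OF phases bool_values bool_values])

lemma state_of_cases:
  obtains R V0 V1 where "state_of S c = (R, V0, V1)" "R \<subseteq> three" "R \<noteq> {}" "V0 \<subseteq> R" "V1 \<subseteq> three"
  by (rule that[of "fst (state_of S c)" "fst (snd (state_of S c))" "snd (snd (state_of S c))"])
    (cases S; auto simp: three_def nbrs_def)+

lemma reduces_peels:
  assumes "peels w h n t m" "reduces Ss (w t) m"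
  shows "\<exists>S\<in>set Ss. peels w h n t (state_of S (w t))"
  using assms peels_covers peels_renamed unfolding reduces_def by blast

lemma serves_peels:
  assumes "peels w h n t (state_of S (w t))" "serves m S (w t)"
  shows "peels w h n t m"
  using assms peels_covers peels_renamed unfolding serves_def by blast

lemma peels_move:
  assumes t: "t + 2 \<le> h" and p: "peels w h (Suc n) t (state_of S (w t))"
  shows "(\<exists>S'\<in>set (next1 S (w t)). peels w h n (Suc t) (state_of S' (w (Suc t))))
       \<or> (\<exists>S'\<in>set (next2 S (w t) (w (Suc t))). peels w h n (t + 2) (state_of S' (w (t + 2))))"
proof -
  let ?short = "\<lambda>(R, V0, V1). if R = {} then reduces (next2 S (w t) (w (Suc t))) (w (t + 2)) (three, V1, three)
           else reduces (next1 S (w t)) (w (Suc t)) (R, V0, V1)"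
  let ?long = "reduces (next2 S (w t) (w (Suc t))) (w (t + 2))"
  let ?s = "state_of S (w t)"
  have red1: "\<not> some_short (w t) (w (Suc t)) ?s (\<lambda>m. \<not> ?short m)"
    using moves_reduceD(1)[of "w t" "w (Suc t)" S "w (t + 2)"] by (simp add: case_prod_unfold)
  have red2: "\<not> some_long (w t) (w (Suc t)) (w (t + 2)) ?s (\<lambda>m. \<not> ?long m)"
    by (rule moves_reduceD(2))
  have "some_short (w t) (w (Suc t)) ?s (peels w h n (Suc t))
     \<or> some_long (w t) (w (Suc t)) (w (t + 2)) ?s (peels w h n (t + 2))"
  proof (rule state_of_cases[of S "w t"])
    fix R V0 V1 assume s: "?s = (R, V0, V1)" "R \<subseteq> three" "R \<noteq> {}" "V0 \<subseteq> R" "V1 \<subseteq> three"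
    show ?thesis using peels_cases[OF p[unfolded s(1)] s(2-5)] t unfolding s(1) by auto
  qed
  then show ?thesis
  proof
    assume "some_short (w t) (w (Suc t)) ?s (peels w h n (Suc t))"
    from some_shortD[OF some_short_conj[OF this red1]] obtain R V0 V1
      where m: "peels w h n (Suc t) (R, V0, V1)" "?short (R, V0, V1)" by (elim exE conjE)
    show ?thesis
    proof (cases "R = {}")
      case True
      have "peels w h n (t + 2) (three, V1, three)" using m(1) unfolding True peels_next_level .
      moreover have "?long (three, V1, three)" using m(2) True by simp
      ultimately show ?thesis by (intro disjI2 reduces_peels)
    next
      case False
      then have "reduces (next1 S (w t)) (w (Suc t)) (R, V0, V1)" using m(2) by simp
      with m(1) show ?thesis by (intro disjI1 reduces_peels)
    qed
  next
    assume "some_long (w t) (w (Suc t)) (w (t + 2)) ?s (peels w h n (t + 2))"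
    from some_longD[OF some_long_conj[OF this red2]] obtain m
      where "peels w h n (t + 2) m" "?long m" by (elim exE conjE)
    then show ?thesis by (intro disjI2 reduces_peels)
  qed
qed

lemma peels_unmove1:
  assumes t: "Suc t \<le> h" and S': "S' \<in> set (next1 S (w t))"
    and p: "peels w h n (Suc t) (state_of S' (w (Suc t)))"
  shows "peels w h (Suc n) t (state_of S (w t))"
proof (rule state_of_cases[of S "w t"])
  fix R V0 V1 assume s: "state_of S (w t) = (R, V0, V1)" "R \<subseteq> three"
  have "some_short (w t) (w (Suc t)) (state_of S (w t)) (\<lambda>m. serves m S' (w (Suc t)))"
    by (rule moves_serveD(1)[OF S'])
  then have "some_short (w t) (w (Suc t)) (R, V0, V1) (peels w h n (Suc t))"
    unfolding s(1) by (rule some_short_mono) (rule serves_peels[OF p])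
  then show ?thesis unfolding s(1) by (rule peels_short[OF s(2) t])
qed

lemma peels_unmove2:
  assumes t: "t + 2 \<le> h" and S': "S' \<in> set (next2 S (w t) (w (Suc t)))"
    and p: "peels w h n (t + 2) (state_of S' (w (t + 2)))"
  shows "peels w h (Suc n) t (state_of S (w t))"
proof (rule state_of_cases[of S "w t"])
  fix R V0 V1 assume s: "state_of S (w t) = (R, V0, V1)" "R \<subseteq> three" "R \<noteq> {}" "V0 \<subseteq> R" "V1 \<subseteq> three"
  have "some_short (w t) (w (Suc t)) (R, V0, V1) (\<lambda>(R, V0, V1). R = {} \<and> serves (three, V1, three) S' (w (t + 2)))
      \<or> some_long (w t) (w (Suc t)) (w (t + 2)) (R, V0, V1) (\<lambda>m. serves m S' (w (t + 2)))"
    using moves_serveD(2)[OF S'] unfolding s(1) by blast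
  then show ?thesis
  proof
    assume "some_short (w t) (w (Suc t)) (R, V0, V1) (\<lambda>(R, V0, V1). R = {} \<and> serves (three, V1, three) S' (w (t + 2)))"
    then have "some_short (w t) (w (Suc t)) (R, V0, V1) (peels w h n (Suc t))"
      by (rule some_short_mono) (auto simp: peels_next_level simp del: add_2_eq_Suc' intro: serves_peels[OF p])
    then show ?thesis unfolding s(1) by (rule peels_short[rotated 2]) (use s t in auto)
  next
    assume "some_long (w t) (w (Suc t)) (w (t + 2)) (R, V0, V1) (\<lambda>m. serves m S' (w (t + 2)))"
    then have "some_long (w t) (w (Suc t)) (w (t + 2)) (R, V0, V1) (peels w h n (t + 2))"
      by (rule some_long_mono) (rule serves_peels[OF p])
    then show ?thesis unfolding s(1) by (rule peels_long[OF s(2,3) t s(5)])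
  qed
qed

lemma peels_last_level:
  assumes "R \<subseteq> three"
  shows "(\<exists>n. peels w h n h (R, V0, V1)) \<longleftrightarrow> R = {} \<or> (\<exists>a\<in>R \<inter> V0. \<exists>b\<in>R \<inter> V0. a \<noteq> b)"
proof
  assume "\<exists>n. peels w h n h (R, V0, V1)"
  then obtain n where p: "peels w h n h (R, V0, V1)" by blast
  show "R = {} \<or> (\<exists>a\<in>R \<inter> V0. \<exists>b\<in>R \<inter> V0. a \<noteq> b)"
  proof (cases n)
    case 0
    then have "points h \<subseteq> removed h R" using p by (simp add: peels_def)
    then have "(h, r) \<in> removed h R" if "r \<in> three" for r using that by (auto simp: points_def)
    then show ?thesis using assms by (auto simp: removed_def)
  next
    case (Suc m)
    then obtain X Y a b where L: "layer (points h) (below w) (removed h R) (usable h V0 V1) X Y a b"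
      using p by (auto simp only: peels_def prod.case peel.simps)
    have "fst x = h \<and> snd x \<in> R \<inter> V0" if "x \<in> X \<union> Y" "x \<in> usable h V0 V1" for x
      using layerD(1)[OF L] that by (cases x) (auto simp: points_def removed_def usable_def)
    then have "fst a = h \<and> snd a \<in> R \<inter> V0" "fst b = h \<and> snd b \<in> R \<inter> V0"
      using layerD(2-5)[OF L] by blast+
    moreover have "a \<noteq> b" using layerD(6)[OF L layerD(2)[OF L] layerD(4)[OF L]] by blast
    ultimately have "snd a \<in> R \<inter> V0" "snd b \<in> R \<inter> V0" "snd a \<noteq> snd b" by (auto simp: prod_eq_iff)
    then show ?thesis by blast
  qed
next
  assume "R = {} \<or> (\<exists>a\<in>R \<inter> V0. \<exists>b\<in>R \<inter> V0. a \<noteq> b)"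
  then show "\<exists>n. peels w h n h (R, V0, V1)"
  proof (elim disjE bexE)
    assume "R = {}"
    then have "peels w h 0 h (R, V0, V1)" by (auto simp: peels_def points_def removed_def)
    then show ?thesis by blast
  next
    fix a b assume ab: "a \<in> R \<inter> V0" "b \<in> R \<inter> V0" "a \<noteq> b"
    have "peels w h (Suc 0) h (R, V0, V1)" unfolding peels_def prod.case
      by (rule peel_SucI[of "{h} \<times> (R - {b})" "{(h, b)}" _ _ "(h, a)" _ "(h, b)"])
        (use ab assms in \<open>auto simp: points_def removed_def usable_def below_def\<close>)
    then show ?thesis by blast
  qed
qed

lemma state_of_nonempty:
  assumes "t \<le> h" "peels w h n t (state_of S c)"
  shows "n \<noteq> 0"
proof (rule state_of_cases[of S c])
  fix R V0 V1 assume s: "state_of S c = (R, V0, V1)" "R \<subseteq> three" "R \<noteq> {}"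
  then obtain r where "r \<in> R" "(t, r) \<in> points h" using assms(1) by (auto simp: points_def)
  then show ?thesis using assms(2) s by (cases n) (auto simp: peels_def removed_def)
qed

text \<open>
Induction on the number of levels left.  Only the last two levels need separate arguments, because a
transition of two letters would leave the poset there.
\<close>

lemma peels_accepts:
  assumes "t \<le> h"
  shows "(\<exists>n. peels w h n t (state_of S (w t))) \<longleftrightarrow> accepts S (map w [t..<h])"
  using assms
proof (induction "h - t" arbitrary: t S rule: less_induct)
  case less
  consider "t = h" | "Suc t = h" | "t + 2 \<le> h" using less.prems by linarith
  then show ?case
  proof cases
    case 1
    show ?thesis
    proof (rule state_of_cases[of S "w h"])
      fix R V0 V1 assume s: "state_of S (w h) = (R, V0, V1)" "R \<subseteq> three" "R \<noteq> {}"
      have "(\<exists>a\<in>R \<inter> V0. \<exists>b\<in>R \<inter> V0. a \<noteq> b) \<longleftrightarrow> S \<in> {Fresh, Two}"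
        using s(1) by (cases S) (auto simp: three_def)
      then show ?thesis using peels_last_level[OF s(2), of w h V0 V1] s(3) by (simp add: 1 s(1))
    qed
  next
    case 2
    have word: "map w [t..<h] = [w t]" unfolding 2[symmetric] by simp
    let ?ok = "\<lambda>(R, V0, V1). R = {} \<or> (\<exists>a\<in>R \<inter> V0. \<exists>b\<in>R \<inter> V0. a \<noteq> b)"
      show ?thesis
    proof (rule state_of_cases[of S "w t"])
      fix R V0 V1 assume s: "state_of S (w t) = (R, V0, V1)" "R \<subseteq> three" "R \<noteq> {}" "V0 \<subseteq> R" "V1 \<subseteq> three"
      have last: "(\<exists>n. peels w h n (Suc t) (R, V0, V1)) \<longleftrightarrow> ?ok (R, V0, V1)" if "R \<subseteq> three" for R V0 V1
        using peels_last_level[OF that, of w h] 2 by simp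
      have "(\<exists>n. peels w h n t (R, V0, V1)) \<longleftrightarrow> some_short (w t) (w (Suc t)) (R, V0, V1) ?ok"
      proof
        assume "\<exists>n. peels w h n t (R, V0, V1)"
        then obtain n where n: "peels w h n t (R, V0, V1)" by blast
        then obtain m where "n = Suc m"
          using state_of_nonempty[of t h w n S "w t"] s(1) less.prems by (cases n) auto
        then have "some_short (w t) (w (Suc t)) (R, V0, V1) (peels w h m (Suc t))"
          using peels_cases[of w h m t R V0 V1] n s 2 by auto
        then show "some_short (w t) (w (Suc t)) (R, V0, V1) ?ok"
        proof (rule some_short_mono)
          fix R V0 V1 assume "R \<subseteq> three" "peels w h m (Suc t) (R, V0, V1)"
          then show "?ok (R, V0, V1)" unfolding last[OF \<open>R \<subseteq> three\<close>, symmetric] by (rule_tac exI)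
        qed
      next
        assume "some_short (w t) (w (Suc t)) (R, V0, V1) ?ok"
        then have "some_short (w t) (w (Suc t)) (R, V0, V1) (\<lambda>m. \<exists>n. peels w h n (Suc t) m)"
          by (rule some_short_mono) (use last in simp)
        then obtain n where "some_short (w t) (w (Suc t)) (R, V0, V1) (peels w h n (Suc t))"
          using some_short_ex by metis
        then show "\<exists>n. peels w h n t (R, V0, V1)"
          using peels_short[OF s(2), where h = h] 2 by blast
      qed
      then show ?thesis
        using last_movesD[of "w t" "w (Suc t)" S] word by (simp only: s(1))
    qed
  next
    case 3
    let ?S = "\<lambda>t S. \<exists>n. peels w h n t (state_of S (w t))"
    have "?S t S \<longleftrightarrow> (\<exists>S'\<in>set (next1 S (w t)). ?S (Suc t) S')
                    \<or> (\<exists>S'\<in>set (next2 S (w t) (w (Suc t))). ?S (t + 2) S')"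
    proof
      assume "?S t S"
      then obtain n where n: "peels w h n t (state_of S (w t))" by blast
      then obtain m where "n = Suc m" using state_of_nonempty[OF less.prems] by (cases n) auto
      then show "(\<exists>S'\<in>set (next1 S (w t)). ?S (Suc t) S')
                    \<or> (\<exists>S'\<in>set (next2 S (w t) (w (Suc t))). ?S (t + 2) S')"
        using peels_move[OF 3, of w m S] n by blast
    next
      assume "(\<exists>S'\<in>set (next1 S (w t)). ?S (Suc t) S')
                    \<or> (\<exists>S'\<in>set (next2 S (w t) (w (Suc t))). ?S (t + 2) S')"
      then show "?S t S"
      proof (elim disjE bexE exE)
        fix S' n assume "S' \<in> set (next1 S (w t))" "peels w h n (Suc t) (state_of S' (w (Suc t)))"
        then show "?S t S" using 3 by (intro exI[of _ "Suc n"] peels_unmove1[of t h S']) simp_all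
      next
        fix S' n assume "S' \<in> set (next2 S (w t) (w (Suc t)))" "peels w h n (t + 2) (state_of S' (w (t + 2)))"
        then show "?S t S" by (intro exI[of _ "Suc n"] peels_unmove2[OF 3])
      qed
    qed
    moreover have "map w [t..<h] = w t # w (Suc t) # map w [t + 2..<h]"
      using 3 by (simp add: upt_rec[of t h] upt_rec[of "Suc t" h])
    moreover have "map w [Suc t..<h] = w (Suc t) # map w [t + 2..<h]"
      using 3 by (simp add: upt_rec[of "Suc t" h])
    moreover have "?S (Suc t) S' \<longleftrightarrow> accepts S' (map w [Suc t..<h])" "?S (t + 2) S' \<longleftrightarrow> accepts S' (map w [t + 2..<h])" for S'
      using 3 less.hyps[of "Suc t" S'] less.hyps[of "t + 2" S'] by auto
    ultimately show ?thesis by (simp only: accepts.simps)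
  qed
qed

section \<open>Words of length at most six\<close>

definition retract_codes :: "nat list set" where
  "retract_codes = {[1,0],
                  [1,1,1], [1,0,1],
                  [1,0,0,1], [1,0,1,0], [1,0,0,0],
                  [1,1,1,0,1], [1,0,1,1,1], [1,1,0,0,1], [1,0,1,0,1], [1,0,0,1,1],
                  [1,0,0,0,1], [1,1,1,1,0], [1,1,1,0,0], [1,0,1,1,0], [1,0,1,0,0],
                  [1,1,1,1,1,1], [1,1,1,1,0,1], [1,0,1,1,1,1], [1,0,1,1,0,1],
                  [1,0,1,0,0,1], [1,0,0,1,0,1], [1,0,0,0,0,1], [1,0,1,0,1,0],
                  [1,0,0,1,1,0], [1,0,1,0,0,0], [1,0,0,1,0,0], [1,0,0,0,1,0],
                  [1,0,0,0,0,0]}"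

definition N2_retract_codes :: "nat list set" where
  "N2_retract_codes = {[1,1,1], [1,0,1],
                      [1,0,0,1],
                      [1,1,1,0,1], [1,0,1,1,1], [1,1,0,0,1], [1,0,1,0,1], [1,0,0,1,1],
                      [1,0,0,0,1],
                      [1,1,1,1,1,1], [1,1,1,1,0,1], [1,0,1,1,1,1], [1,0,1,1,0,1],
                      [1,0,1,0,0,1], [1,0,0,1,0,1], [1,0,0,0,0,1]}"

lemma accepts_Fresh_codes_aux:
  "\<forall>n\<in>{0, 1, 2, 3, 4, 5}. \<forall>v\<in>set (List.n_lists n [True, False]).
     accepts Fresh (True # v) \<longleftrightarrow> map (\<lambda>b. if b then 1 else 0) (True # v) \<in> retract_codes"
  unfolding retract_codes_def by code_simp

lemma accepts_Fresh_codes: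
  assumes "1 \<le> h" "h \<le> 6" "w 0"
  shows "accepts Fresh (map w [0..<h]) \<longleftrightarrow> map (\<lambda>k. if w k then 1 else 0) [0..<h] \<in> retract_codes"
proof -
  obtain n where n: "h = Suc n" using assms(1) by (cases h) auto
  let ?v = "map w [1..<h]"
  have "[0..<h] = 0 # [1..<h]" using n by (simp add: upt_rec)
  then have v: "map w [0..<h] = True # ?v"
    "map (\<lambda>k. if w k then 1 else 0) [0..<h] = map (\<lambda>b. if b then 1 else 0) (True # ?v)"
    using assms(3) by simp_all
  have "n \<in> {0, 1, 2, 3, 4, 5}" using n assms(2) by auto
  moreover have "?v \<in> set (List.n_lists n [True, False])" using n by (auto simp: set_n_lists)
  ultimately show ?thesis unfolding v using accepts_Fresh_codes_aux by blast
qed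

lemma N2_retract_codes_iff: "v \<in> N2_retract_codes \<longleftrightarrow> v \<in> retract_codes \<and> v ! (length v - 1) = 1"
proof -
  have "\<forall>v\<in>retract_codes. v \<in> N2_retract_codes \<longleftrightarrow> v ! (length v - 1) = 1" "\<forall>v\<in>N2_retract_codes. v \<in> retract_codes"
    unfolding N2_retract_codes_def retract_codes_def by code_simp+
  then show ?thesis by blast
qed

text \<open>
A 4-crown stack has at least two levels.  A peeling with a single layer does not exist, since with first
letter \<open>1\<close> the first layer leaves points of level 1.
\<close>

lemma stack_retract_accepts:
  assumes coded: "coded r h w c" and h: "1 \<le> h" and w: "w 0"
  shows "has_stack_retract r \<longleftrightarrow> accepts Fresh (map w [0..<h])"
proof -
  have start: "peels w h n 0 (state_of Fresh (w 0)) \<longleftrightarrow> peel (points h) (below w) n {} UNIV" for n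
    unfolding peels_def state_of.simps prod.case
    by (intro iffI; elim peel_mono) (auto simp: points_def removed_def usable_def)
  have two: "2 \<le> n" if p: "peels w h n 0 (state_of Fresh (w 0))" for n
  proof -
    have acc: "accepts Fresh (map w [0..<h])" using peels_accepts[of 0 h w Fresh] p by blast
    have "h \<noteq> 1" 
    proof
      assume "h = 1"
      then show False using acc w by simp
    qed
    then have h2: "0 + 2 \<le> h" using h by simp
    obtain m where m: "n = Suc m" using state_of_nonempty[OF _ p] by (cases n) auto
    have "peels w h m (Suc 0) (state_of TwoHalf (w (Suc 0)))"
      using peels_move[OF h2 p[unfolded m]] w by simp
    then have "m \<noteq> 0" by (rule state_of_nonempty[rotated]) (use h in simp)
    then show ?thesis using m by simp
  qed
  have "has_stack_retract r \<longleftrightarrow> (\<exists>n\<ge>2. peels w h n 0 (state_of Fresh (w 0)))"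
    unfolding coded.stack_retract_coded[OF coded] start ..
  also have "\<dots> \<longleftrightarrow> (\<exists>n. peels w h n 0 (state_of Fresh (w 0)))" using two by blast
  also have "\<dots> \<longleftrightarrow> accepts Fresh (map w [0..<h])" by (rule peels_accepts) simp
  finally show ?thesis .
qed

lemma N2_lower_segment_coded:
  assumes "N2_lower_segment P" "1 \<le> poset_height P"
  obtains w c where "coded P (poset_height P) w c" "w 0"
proof -
  from assms(1) obtain q k where q: "class_N2 q" and k: "k \<le> poset_height q" and P: "P = level_range q 0 k"
    unfolding N2_lower_segment_def lower_segment_def by auto
  obtain w c where c: "coded q (poset_height q) w c" using class_N2_coded_ex[OF q] by blast
  have cP: "coded P k w c" unfolding P by (rule coded.coded_segment[OF c k])
  then have kP: "poset_height P = k" by (rule coded.height_coded)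
  then have "w 0" using coded.class_N2_coded[OF c] q k assms(2) by auto
  then show thesis using that cP kP by blast
qed

lemma class_N2_lower_segment:
  assumes "class_N2 P"
  shows "N2_lower_segment P"
proof -
  obtain w c where c: "coded P (poset_height P) w c" using class_N2_coded_ex[OF assms] by blast
  have c': "coded (level_range P 0 (poset_height P)) (poset_height P) w c"
    by (rule coded.coded_segment[OF c order_refl])
  have "P = level_range P 0 (poset_height P)"
    by (rule trans[OF coded.r_eq[OF c] coded.r_eq[OF c', symmetric]])
  then show ?thesis unfolding N2_lower_segment_def lower_segment_def using assms
    by (intro exI[of _ P] conjI bexI[of _ "poset_height P"]) auto
qed

text \<open>
Numbering the points row by row gives a poset of natural numbers.
\<close>

lemma coded_exists: "\<exists>r :: nat rel. \<exists>c. coded r h w c"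
proof -
  let ?c = "\<lambda>(k, i). 3 * k + i"
  have "coded {(?c p, ?c q) | p q. p \<in> points h \<and> q \<in> points h \<and> (p = q \<or> below w p q)} h w ?c"
  proof
    show "inj_on ?c (points h)" by (auto simp: inj_on_def points_def three_def; presburger)
  qed simp
  then show ?thesis by blast
qed

text \<open>
A word that may end in \<open>0\<close> is extended by a final \<open>1\<close>; this gives a poset in the class, of which
the required one is a lower segment.
\<close>

lemma code_occurs:
  assumes v: "length v \<in> {1..6}" "set v \<subseteq> {0, 1}" "v ! 0 = (1 :: nat)"
  shows "\<exists>P :: nat rel. N2_lower_segment P \<and> encoded_by P v"
proof -
  define h where "h = length v"
  define w where "w k \<longleftrightarrow> k < h \<longrightarrow> v ! k = 1" for k
  obtain q :: "nat rel" and c where c: "coded q (Suc h) w c" using coded_exists by blast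
  have "class_N2 q" using coded.class_N2_coded[OF c] v by (simp add: w_def h_def)
  moreover have "lower_segment (level_range q 0 h) q"
    unfolding lower_segment_def coded.height_coded[OF c] by auto
  ultimately have "N2_lower_segment (level_range q 0 h)" unfolding N2_lower_segment_def by blast
  moreover have "coded (level_range q 0 h) h w c" by (rule coded.coded_segment[OF c]) simp
  then have "encoded_by (level_range q 0 h) v"
  proof (subst coded.encoded_by_iff)
    have "v ! k \<in> {0, 1}" if "k < h" for k using that v(2) unfolding h_def by (auto dest: nth_mem)
    then show "v = map (\<lambda>k. if w k then 1 else 0) [0..<h]"
      by (intro nth_equalityI) (auto simp: w_def h_def)
  qed
  ultimately show ?thesis by blast
qed

lemma N2_lower_segment_code:
  fixes P :: "'a rel"
  assumes "N2_lower_segment P" "poset_height P \<in> {1..6}"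
  obtains v where "\<And>u. encoded_by P u \<longleftrightarrow> u = v" "length v = poset_height P" "set v \<subseteq> {0, 1}" "v ! 0 = 1"
    "class_N2 P \<longleftrightarrow> poset_height P \<ge> 2 \<and> v ! (poset_height P - 1) = 1"
    "has_stack_retract P \<longleftrightarrow> v \<in> retract_codes"
proof -
  have h: "1 \<le> poset_height P" "poset_height P \<le> 6" using assms(2) by auto
  obtain w c where c: "coded P (poset_height P) w c" and w: "w 0"
    by (rule N2_lower_segment_coded[OF assms(1) h(1)])
  let ?v = "map (\<lambda>k. if w k then 1 else 0) [0..<poset_height P] :: nat list"
  show thesis
  proof (rule that[of ?v])
    show "encoded_by P u \<longleftrightarrow> u = ?v" for u by (rule coded.encoded_by_iff[OF c])
    show "class_N2 P \<longleftrightarrow> poset_height P \<ge> 2 \<and> ?v ! (poset_height P - 1) = 1"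
      using coded.class_N2_coded[OF c h(1)] w h(1) by auto
    show "has_stack_retract P \<longleftrightarrow> ?v \<in> retract_codes"
      using stack_retract_accepts[where w = w, OF c h(1) w] accepts_Fresh_codes[where w = w, OF h w] by simp
  qed (use w h(1) in auto)
qed

theorem mainTheorem4:
  shows
    "(\<comment> \<open>the code is well defined, membership in the class, and the retract criterion\<close>
      \<forall>P :: 'a rel. N2_lower_segment P \<and> poset_height P \<in> {1..6} \<longrightarrow>
       (\<exists>!w. encoded_by P w) \<and>
       (\<forall>w. encoded_by P w \<longrightarrow>
          (class_N2 P \<longleftrightarrow> poset_height P \<ge> 2 \<and> w ! (poset_height P - 1) = 1) \<and>
          (has_stack_retract P \<longleftrightarrow>
             w \<in> {[1,0],
                  [1,1,1], [1,0,1],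
                  [1,0,0,1], [1,0,1,0], [1,0,0,0],
                  [1,1,1,0,1], [1,0,1,1,1], [1,1,0,0,1], [1,0,1,0,1], [1,0,0,1,1],
                  [1,0,0,0,1], [1,1,1,1,0], [1,1,1,0,0], [1,0,1,1,0], [1,0,1,0,0],
                  [1,1,1,1,1,1], [1,1,1,1,0,1], [1,0,1,1,1,1], [1,0,1,1,0,1],
                  [1,0,1,0,0,1], [1,0,0,1,0,1], [1,0,0,0,0,1], [1,0,1,0,1,0],
                  [1,0,0,1,1,0], [1,0,1,0,0,0], [1,0,0,1,0,0], [1,0,0,0,1,0],
                  [1,0,0,0,0,0]})))
     \<and> (\<comment> \<open>the words which occur\<close>
      \<forall>P :: 'a rel. \<forall>w. N2_lower_segment P \<and> poset_height P \<in> {1..6} \<and> encoded_by P w \<longrightarrow>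
           set w \<subseteq> {0, 1} \<and> w ! 0 = 1)
     \<and> (\<forall>w. length w \<in> {1..6} \<and> set w \<subseteq> {0, 1} \<and> w ! 0 = 1 \<longrightarrow>
           (\<exists>P :: nat rel. N2_lower_segment P \<and> encoded_by P w))
     \<and> (\<comment> \<open>the posets of the class itself\<close>
      \<forall>P :: 'a rel. class_N2 P \<and> poset_height P \<le> 6 \<longrightarrow>
           (has_stack_retract P \<longleftrightarrow>
              (\<exists>w. encoded_by P w \<and>
                 w \<in> {[1,1,1], [1,0,1],
                      [1,0,0,1],
                      [1,1,1,0,1], [1,0,1,1,1], [1,1,0,0,1], [1,0,1,0,1], [1,0,0,1,1],
                      [1,0,0,0,1],
                      [1,1,1,1,1,1], [1,1,1,1,0,1], [1,0,1,1,1,1], [1,0,1,1,0,1],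
                      [1,0,1,0,0,1], [1,0,0,1,0,1], [1,0,0,0,0,1]})))"
proof (intro conjI allI impI)
  fix P :: "'a rel" assume P: "N2_lower_segment P \<and> poset_height P \<in> {1..6}"
  obtain v where v: "\<And>u. encoded_by P u \<longleftrightarrow> u = v" by (rule N2_lower_segment_code[of P]) (use P in auto)
  then show "\<exists>!w. encoded_by P w" by auto
next
  fix P :: "'a rel" and w assume P: "N2_lower_segment P \<and> poset_height P \<in> {1..6}" and w: "encoded_by P w"
  obtain v where "\<And>u. encoded_by P u \<longleftrightarrow> u = v"
    "class_N2 P \<longleftrightarrow> poset_height P \<ge> 2 \<and> v ! (poset_height P - 1) = 1"
    by (rule N2_lower_segment_code[of P]) (use P in auto)
  then show "class_N2 P \<longleftrightarrow> poset_height P \<ge> 2 \<and> w ! (poset_height P - 1) = 1" using w by simp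
next
  fix P :: "'a rel" and w assume P: "N2_lower_segment P \<and> poset_height P \<in> {1..6}" and w: "encoded_by P w"
  obtain v where "\<And>u. encoded_by P u \<longleftrightarrow> u = v" "has_stack_retract P \<longleftrightarrow> v \<in> retract_codes"
    by (rule N2_lower_segment_code[of P]) (use P in auto)
  then have "has_stack_retract P \<longleftrightarrow> w \<in> retract_codes" using w by simp
  then show "has_stack_retract P \<longleftrightarrow> w \<in> {[1,0],
                  [1,1,1], [1,0,1],
                  [1,0,0,1], [1,0,1,0], [1,0,0,0],
                  [1,1,1,0,1], [1,0,1,1,1], [1,1,0,0,1], [1,0,1,0,1], [1,0,0,1,1],
                  [1,0,0,0,1], [1,1,1,1,0], [1,1,1,0,0], [1,0,1,1,0], [1,0,1,0,0],
                  [1,1,1,1,1,1], [1,1,1,1,0,1], [1,0,1,1,1,1], [1,0,1,1,0,1],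
                  [1,0,1,0,0,1], [1,0,0,1,0,1], [1,0,0,0,0,1], [1,0,1,0,1,0],
                  [1,0,0,1,1,0], [1,0,1,0,0,0], [1,0,0,1,0,0], [1,0,0,0,1,0],
                  [1,0,0,0,0,0]}"
    unfolding retract_codes_def .
next
  fix P :: "'a rel" and w assume P: "N2_lower_segment P \<and> poset_height P \<in> {1..6} \<and> encoded_by P w"
  obtain v where "\<And>u. encoded_by P u \<longleftrightarrow> u = v" "set v \<subseteq> {0, 1}" "v ! 0 = 1"
    by (rule N2_lower_segment_code[of P]) (use P in auto)
  then show "set w \<subseteq> {0, 1}" "w ! 0 = 1" using P by auto
next
  fix w :: "nat list" assume "length w \<in> {1..6} \<and> set w \<subseteq> {0, 1} \<and> w ! 0 = 1"
  then show "\<exists>P :: nat rel. N2_lower_segment P \<and> encoded_by P w" using code_occurs by blast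
next
  fix P :: "'a rel" assume P: "class_N2 P \<and> poset_height P \<le> 6"
  then have P': "N2_lower_segment P" "poset_height P \<in> {1..6}" and h2: "2 \<le> poset_height P"
    using class_N2_lower_segment by (auto simp: class_N2_def)
  obtain v where v: "\<And>u. encoded_by P u \<longleftrightarrow> u = v" "length v = poset_height P"
    "class_N2 P \<longleftrightarrow> poset_height P \<ge> 2 \<and> v ! (poset_height P - 1) = 1"
    "has_stack_retract P \<longleftrightarrow> v \<in> retract_codes"
    by (rule N2_lower_segment_code[of P]) (use P' in auto)
  then have "has_stack_retract P \<longleftrightarrow> (\<exists>w. encoded_by P w \<and> w \<in> N2_retract_codes)"
    using P N2_retract_codes_iff[of v] by auto
  then show "has_stack_retract P \<longleftrightarrow> (\<exists>w. encoded_by P w \<and> w \<in> {[1,1,1], [1,0,1],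
                      [1,0,0,1],
                      [1,1,1,0,1], [1,0,1,1,1], [1,1,0,0,1], [1,0,1,0,1], [1,0,0,1,1],
                      [1,0,0,0,1],
                      [1,1,1,1,1,1], [1,1,1,1,0,1], [1,0,1,1,1,1], [1,0,1,1,0,1],
                      [1,0,1,0,0,1], [1,0,0,1,0,1], [1,0,0,0,0,1]})"
    unfolding N2_retract_codes_def .
qed

end
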